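(* Let $K\subset\mathbb{C}$ be a compact set such that $K\cap\sigma_c(\mathcal{H}_0)\neq\emptyset$. Then for all sufficiently small $\varepsilon>0$ the set $\sigma_c(\mathcal{H}_\varepsilon)\cap K$ contains no embedded eigenvalues, i.e. no point of $\sigma_c(\mathcal{H}_\varepsilon)\cap K$ is an eigenvalue of $\mathcal{H}_\varepsilon$.
   Context: Let $p,q:\mathbb{R}\to\mathbb{R}$ be $1$-periodic, $p$ piecewise continuously differentiable (continuous with piecewise continuous derivative), $q$ piecewise continuous, $p(x)\geq p_0>0$ for all $x$, and $p(0)=1$. Let $\mathcal{H}_0:=-\frac{d}{dx}p\frac{d}{dx}+q$ be the self-adjoint operator in $L_2(\mathbb{R})$ with domain $W_2^2(\mathbb{R})$. Let $Q\subset\mathbb{R}$ be a fixed bounded open interval. For each small $\varepsilon>0$ let $\mathcal{L}_\varepsilon:W_2^2(Q)\to L_2(Q)$ be a linear operator, bounded uniformly in $\varepsilon$ (operator norms bounded by a constant independent of $\varepsilon$). Denote also by $\mathcal{L}_\varepsilon$ the operator $W_{2,loc}^2(\mathbb{R})\to L_2(\mathbb{R})$ that restricts a function to $Q$, applies $\mathcal{L}_\varepsilon$, and extends the result by zero outside $Q$. Set $\mathcal{H}_\varepsilon:=\mathcal{H}_0-\varepsilon\mathcal{L}_\varepsilon$, an operator in $L_2(\mathbb{R})$ with domain $W_2^2(\mathbb{R})$. For a closed operator $A$, $\sigma_c(A)$ is the continuous spectrum in the sense of Glazman: the set of $\lambda\in\mathbb{C}$ for which there is a bounded sequence $u_n$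 in the domain of $A$ having no convergent subsequence, with $(A-\lambda)u_n\to 0$. (It may contain eigenvalues; these are called embedded.) *)

theory Defs
  imports "HOL-Analysis.Analysis"
begin

section \<open>Coefficients\<close>

text \<open>Piecewise continuity on the real line: finitely many discontinuities in every bounded
  interval, all of them with finite one-sided limits.\<close>

definition piecewise_cont :: "(real \<Rightarrow> real) \<Rightarrow> bool" where
  "piecewise_cont f \<longleftrightarrow>
     (\<forall>a b. finite {x \<in> {a..b}. \<not> isCont f x}) \<and>
     (\<forall>x. (\<exists>l. (f \<longlongrightarrow> l) (at_left x)) \<and> (\<exists>r. (f \<longlongrightarrow> r) (at_right x)))"

definition piecewise_C1 :: "(real \<Rightarrow> real) \<Rightarrow> bool" where
  "piecewise_C1 f \<longleftrightarrow>
     continuous_on UNIV f \<and>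
     (\<exists>g. piecewise_cont g \<and>
          (\<forall>a b. finite {x \<in> {a..b}. \<not> (f has_real_derivative g x) (at x)}))"

definition one_periodic :: "(real \<Rightarrow> 'a) \<Rightarrow> bool" where
  "one_periodic f \<longleftrightarrow> (\<forall>x. f (x + 1) = f x)"

section \<open>Lebesgue and Sobolev spaces of complex-valued functions\<close>

text \<open>Elements of the spaces over an open set \<open>S\<close> are represented by functions on all of the real
  line, whose values outside \<open>S\<close> are irrelevant; equality in these spaces is equality almost
  everywhere on \<open>S\<close>.\<close>

definition L2 :: "real set \<Rightarrow> (real \<Rightarrow> complex) set" where
  "L2 S = {u. u \<in> borel_measurable (lebesgue_on S) \<and>
              integrable (lebesgue_on S) (\<lambda>x. (cmod (u x))\<^sup>2)}"

text \<open>Meaningful for \<open>u \<in> L2 S\<close> only (a Bochner integral that does not exist is \<open>0\<close>).\<close>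

definition L2_norm :: "real set \<Rightarrow> (real \<Rightarrow> complex) \<Rightarrow> real" where
  "L2_norm S u = sqrt (LINT x|lebesgue_on S. (cmod (u x))\<^sup>2)"

definition test_function :: "real set \<Rightarrow> (real \<Rightarrow> real) \<Rightarrow> bool" where
  "test_function S \<phi> \<longleftrightarrow>
     (\<forall>n x. (deriv ^^ n) \<phi> differentiable (at x)) \<and>
     compact (closure {x. \<phi> x \<noteq> 0}) \<and> closure {x. \<phi> x \<noteq> 0} \<subseteq> S"

definition locally_integrable :: "real set \<Rightarrow> (real \<Rightarrow> complex) \<Rightarrow> bool" where
  "locally_integrable S u \<longleftrightarrow> (\<forall>T. compact T \<and> T \<subseteq> S \<longrightarrow> integrable (lebesgue_on T) u)"

definition has_weak_deriv :: "real set \<Rightarrow> (real \<Rightarrow> complex) \<Rightarrow> (real \<Rightarrow> complex) \<Rightarrow> bool" where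
  "has_weak_deriv S u v \<longleftrightarrow>
     locally_integrable S u \<and> locally_integrable S v \<and>
     (\<forall>\<phi>. test_function S \<phi> \<longrightarrow>
        (LINT x|lebesgue_on S. deriv \<phi> x *\<^sub>R u x) = - (LINT x|lebesgue_on S. \<phi> x *\<^sub>R v x))"

text \<open>A weak derivative is unique up to a null set; the following picks one representative.\<close>

definition weak_deriv :: "real set \<Rightarrow> (real \<Rightarrow> complex) \<Rightarrow> real \<Rightarrow> complex" where
  "weak_deriv S u = (SOME v. has_weak_deriv S u v)"

definition W22 :: "real set \<Rightarrow> (real \<Rightarrow> complex) set" where
  "W22 S = {u \<in> L2 S. \<exists>v \<in> L2 S. \<exists>w \<in> L2 S. has_weak_deriv S u v \<and> has_weak_deriv S v w}"

definition W22_norm :: "real set \<Rightarrow> (real \<Rightarrow> complex) \<Rightarrow> real" where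
  "W22_norm S u = sqrt ((L2_norm S u)\<^sup>2 + (L2_norm S (weak_deriv S u))\<^sup>2
                         + (L2_norm S (weak_deriv S (weak_deriv S u)))\<^sup>2)"

section \<open>Operators\<close>

text \<open>A linear operator from \<open>W22 S\<close> to \<open>L2 S\<close> with norm at most \<open>C\<close>, given on representatives.
  Linearity holds almost everywhere; together with the norm bound it implies that functions that
  agree almost everywhere on \<open>S\<close> have images that agree almost everywhere on \<open>S\<close>, so the operator is
  well defined on equivalence classes.\<close>

definition bounded_operator_W22_L2 ::
    "real set \<Rightarrow> real \<Rightarrow> ((real \<Rightarrow> complex) \<Rightarrow> real \<Rightarrow> complex) \<Rightarrow> bool" where
  "bounded_operator_W22_L2 S C L \<longleftrightarrow>
     (\<forall>u \<in> W22 S. L u \<in> L2 S) \<and>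
     (\<forall>u \<in> W22 S. \<forall>v \<in> W22 S. AE x in lebesgue_on S. L (\<lambda>y. u y + v y) x = L u x + L v x) \<and>
     (\<forall>c. \<forall>u \<in> W22 S. AE x in lebesgue_on S. L (\<lambda>y. c * u y) x = c * L u x) \<and>
     (\<forall>u \<in> W22 S. L2_norm S (L u) \<le> C * W22_norm S u)"

definition zero_outside :: "real set \<Rightarrow> (real \<Rightarrow> complex) \<Rightarrow> real \<Rightarrow> complex" where
  "zero_outside S u = (\<lambda>x. if x \<in> S then u x else 0)"

definition H0 :: "(real \<Rightarrow> real) \<Rightarrow> (real \<Rightarrow> real) \<Rightarrow> (real \<Rightarrow> complex) \<Rightarrow> real \<Rightarrow> complex" where
  "H0 p q u = (\<lambda>x. - weak_deriv UNIV (\<lambda>y. of_real (p y) * weak_deriv UNIV u y) x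
                   + of_real (q x) * u x)"

text \<open>The inner \<open>zero_outside S\<close> is the restriction to \<open>S\<close>, the outer one the extension by zero.\<close>

definition H_perturbed ::
    "(real \<Rightarrow> real) \<Rightarrow> (real \<Rightarrow> real) \<Rightarrow> real set \<Rightarrow>
     (real \<Rightarrow> (real \<Rightarrow> complex) \<Rightarrow> real \<Rightarrow> complex) \<Rightarrow> real \<Rightarrow>
     (real \<Rightarrow> complex) \<Rightarrow> real \<Rightarrow> complex" where
  "H_perturbed p q S L \<epsilon> u =
     (\<lambda>x. H0 p q u x - of_real \<epsilon> * zero_outside S (L \<epsilon> (zero_outside S u)) x)"

text \<open>In the following, \<open>A\<close> stands for an operator in \<open>L2 UNIV\<close> with domain \<open>D\<close>.\<close>

definition has_convergent_subseq :: "(nat \<Rightarrow> real \<Rightarrow> complex) \<Rightarrow> bool" where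
  "has_convergent_subseq u \<longleftrightarrow>
     (\<exists>r f. strict_mono r \<and> f \<in> L2 UNIV \<and>
            (\<lambda>n. L2_norm UNIV (\<lambda>x. u (r n) x - f x)) \<longlonglongrightarrow> 0)"

text \<open>Continuous spectrum in the sense of Glazman; it may contain eigenvalues.\<close>

definition continuous_spectrum ::
    "(real \<Rightarrow> complex) set \<Rightarrow> ((real \<Rightarrow> complex) \<Rightarrow> real \<Rightarrow> complex) \<Rightarrow> complex set" where
  "continuous_spectrum D A =
     {z. \<exists>u :: nat \<Rightarrow> real \<Rightarrow> complex.
           (\<forall>n. u n \<in> D) \<and> (\<exists>B. \<forall>n. L2_norm UNIV (u n) \<le> B) \<and>
           \<not> has_convergent_subseq u \<and>
           (\<lambda>n. L2_norm UNIV (\<lambda>x. A (u n) x - z * u n x)) \<longlonglongrightarrow> 0}"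

definition is_eigenvalue ::
    "(real \<Rightarrow> complex) set \<Rightarrow> ((real \<Rightarrow> complex) \<Rightarrow> real \<Rightarrow> complex) \<Rightarrow> complex \<Rightarrow> bool" where
  "is_eigenvalue D A z \<longleftrightarrow>
     (\<exists>u \<in> D. \<not> (AE x in lebesgue. u x = 0) \<and> (AE x in lebesgue. A u x = z * u x))"

end

theory Submission
  imports Defs "HOL-Computational_Algebra.Polynomial"
begin

text \<open>Write the equation \<open>H\<^sub>0 u - z u = g\<close> as the first-order system \<open>U' = W / p\<close>,
\<open>W' = (q - z) U - g\<close> for the continuous representatives of \<open>u\<close> and of \<open>p u'\<close>. By periodicity a
Floquet multiplier \<open>\<rho>\<close> is attached to every \<open>z\<close>, and all solutions satisfy
\<open>U (x + 2) - (\<rho> + 1 / \<rho>) U (x + 1) + U x = O (\<integral>\<bar>g\<bar>)\<close>, the integral being over a nearby interval of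
length 3. With the translation \<open>T\<close> by one period the left-hand side is \<open>(T - \<rho>) (T - 1 / \<rho>) U\<close>. The two
cases \<open>\<bar>\<rho>\<bar> = 1\<close> and \<open>\<bar>\<rho>\<bar> \<noteq> 1\<close> exclude the two halves of the definition of an embedded eigenvalue.

If \<open>\<bar>\<rho>\<bar> = 1\<close>, then \<open>z\<close> is no eigenvalue (lemma \<open>unimodular_imp_no_eigenvalue\<close>). An eigenfunction solves
the unperturbed equation with \<open>g = 0\<close> to the left of the perturbed interval \<open>{a<..<b}\<close>; there the
recurrence shows that \<open>U (x + 1) - U x / \<rho>\<close>, and then \<open>U\<close>, has periodic modulus, so that \<open>U = 0\<close> by square
integrability. Hence the solution has zero initial data at a point \<open>s < a\<close>, and Gronwall's
inequality bounds its \<open>W\<^sub>2\<^sup>2\<close>-norm on \<open>{a<..<b}\<close> by the norm of \<open>g = \<epsilon> L \<epsilon> u\<close>, that is, by a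
constant times \<open>\<epsilon>\<close> times that same norm. For small \<open>\<epsilon>\<close> everything vanishes.

If \<open>\<bar>\<rho>\<bar> \<noteq> 1\<close>, then \<open>z\<close> is not in the continuous spectrum (lemma
\<open>continuous_spectrum_imp_unimodular\<close>). Since \<open>T\<close> is an isometry, \<open>T - \<rho>\<close> and \<open>T - 1 / \<rho>\<close> are
bounded below, and \<open>\<parallel>u\<parallel> \<le> M \<parallel>g\<parallel>\<close> holds on the whole line. Let \<open>u\<^sub>n\<close> be a bounded sequence with
\<open>H\<^sub>\<epsilon> u\<^sub>n - z u\<^sub>n \<longlonglongrightarrow> 0\<close>. The initial data of \<open>u\<^sub>n\<close> at \<open>s\<close> are bounded, and one may pass to a
subsequence for which they converge. The same absorption of the perturbation as above,
applied to the differences \<open>u\<^sub>n - u\<^sub>m\<close>, makes the right-hand sides a Cauchy sequence, hence the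
\<open>u\<^sub>n\<close> too, and \<open>u\<^sub>n\<close> has a convergent subsequence.

The smallness required of \<open>\<epsilon>\<close> comes from Gronwall's inequality on the interval \<open>{s..b}\<close> (lemma
\<open>local_W22_estimate\<close>) and is uniform for bounded \<open>z\<close>; the constant \<open>M\<close>, which blows up as \<open>\<bar>\<rho>\<bar>\<close>
approaches \<open>1\<close>, does not enter it. This gives one \<open>\<epsilon>\<^sub>0\<close> for the whole compact set.

Weak derivatives are reduced to this classical picture by the lemma
\<open>has_weak_deriv_imp_primitive\<close>: a function with a weak derivative is almost everywhere equal to a
primitive of it.\<close>

section \<open>Primitives and integration by parts\<close>

text \<open>On an interval this is the notion of a (locally) absolutely continuous function \<open>F\<close> with
derivative \<open>f\<close>, stated without pointwise derivatives; \<open>f\<close> matters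
only up to null sets.\<close>

definition primitive_on :: "real set \<Rightarrow> (real \<Rightarrow> complex) \<Rightarrow> (real \<Rightarrow> complex) \<Rightarrow> bool" where
  "primitive_on I f F \<longleftrightarrow> (\<forall>x\<in>I. \<forall>y\<in>I. x \<le> y \<longrightarrow>
     f absolutely_integrable_on {x..y} \<and> integral {x..y} f = F y - F x)"

lemma primitive_onD:
  assumes "primitive_on I f F" "x \<in> I" "y \<in> I" "x \<le> y"
  shows "f absolutely_integrable_on {x..y}" "integral {x..y} f = F y - F x"
    "f integrable_on {x..y}"
  using assms set_lebesgue_integral_eq_integral(1) unfolding primitive_on_def by blast+

lemma primitive_on_subset: "primitive_on I f F \<Longrightarrow> J \<subseteq> I \<Longrightarrow> primitive_on J f F"
  unfolding primitive_on_def by blast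

lemma primitive_on_continuous_Icc:
  assumes "primitive_on {s..t} f F"
  shows "continuous_on {s..t} F"
proof (cases "s \<le> t")
  case True
  have "continuous_on {s..t} (\<lambda>x. F s + integral {s..x} f)"
    using primitive_onD(3)[OF assms, of s t] True
    by (intro continuous_intros indefinite_integral_continuous_1) auto
  also have "?this \<longleftrightarrow> continuous_on {s..t} F"
    by (rule continuous_on_cong) (use primitive_onD(2)[OF assms, of s] True in auto)
  finally show ?thesis .
qed auto

lemma primitive_on_continuous:
  assumes "primitive_on UNIV f F"
  shows "continuous_on S F"
proof -
  have "isCont F x" for x
  proof -
    have "continuous_on {x-1..x+1} F"
      by (rule primitive_on_continuous_Icc[OF primitive_on_subset[OF assms]]) auto
    then show ?thesis by (rule continuous_on_interior) auto
  qed
  then show ?thesis by (simp add: continuous_at_imp_continuous_on)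
qed

lemma primitive_on_add:
  assumes "primitive_on I f F" "primitive_on I g G"
  shows "primitive_on I (\<lambda>x. f x + g x) (\<lambda>x. F x + G x)"
  unfolding primitive_on_def using primitive_onD[OF assms(1)] primitive_onD[OF assms(2)]
  by (auto simp: integral_add)

lemma primitive_on_diff:
  assumes "primitive_on I f F" "primitive_on I g G"
  shows "primitive_on I (\<lambda>x. f x - g x) (\<lambda>x. F x - G x)"
  unfolding primitive_on_def using primitive_onD[OF assms(1)] primitive_onD[OF assms(2)]
  by (auto simp: integral_diff)

lemma primitive_on_mult:
  assumes "primitive_on I f F"
  shows "primitive_on I (\<lambda>x. c * f x) (\<lambda>x. c * F x)"
  unfolding primitive_on_def
proof (intro ballI impI conjI)
  fix x y assume xy: "x \<in> I" "y \<in> I" "x \<le> y"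
  show "(\<lambda>x. c * f x) absolutely_integrable_on {x..y}"
    using primitive_onD(1)[OF assms xy] by simp
  show "integral {x..y} (\<lambda>x. c * f x) = c * F y - c * F x"
    using primitive_onD(2)[OF assms xy] by (simp add: right_diff_distrib)
qed

lemma primitive_on_cong_negligible:
  assumes "primitive_on I f F" "negligible N" "\<And>x. x \<notin> N \<Longrightarrow> f x = g x"
  shows "primitive_on I g F"
  unfolding primitive_on_def
proof (intro ballI impI conjI)
  fix x y assume xy: "x \<in> I" "y \<in> I" "x \<le> y"
  show "g absolutely_integrable_on {x..y}"
    by (rule absolutely_integrable_spike[OF primitive_onD(1)[OF assms(1) xy] assms(2)])
       (simp add: assms(3))
  show "integral {x..y} g = F y - F x"
    using integral_spike[OF assms(2), of "{x..y}" g f] assms(3) primitive_onD(2)[OF assms(1) xy]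
    by simp
qed

lemma AE_lebesgue_iff_negligible:
  "(AE x in lebesgue. P x) \<longleftrightarrow> (\<exists>N. negligible N \<and> (\<forall>x. x \<notin> N \<longrightarrow> P x))"
  unfolding eventually_ae_filter_negligible by blast

lemma primitive_on_cong_AE:
  assumes "primitive_on I f F" "AE x in lebesgue. f x = g x"
  shows "primitive_on I g F"
  using assms primitive_on_cong_negligible unfolding AE_lebesgue_iff_negligible by blast

lemma absolutely_integrable_shift_Icc:
  fixes f :: "real \<Rightarrow> 'a::euclidean_space"
  shows "(\<lambda>x. f (x + c)) absolutely_integrable_on {a..b} \<longleftrightarrow> f absolutely_integrable_on {a+c..b+c}"
  using integrable_on_shift_Icc_real[of f c a b] integrable_on_shift_Icc_real[of "\<lambda>x. norm (f x)" c a b]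
  by (simp add: absolutely_integrable_on_def o_def add.commute)

lemma primitive_on_shift:
  assumes "primitive_on I f F" "\<And>x. x \<in> J \<Longrightarrow> x + c \<in> I"
  shows "primitive_on J (\<lambda>x. f (x + c)) (\<lambda>x. F (x + c))"
  unfolding primitive_on_def
proof (intro ballI impI conjI)
  fix x y assume xy: "x \<in> J" "y \<in> J" "x \<le> y"
  have 1: "f absolutely_integrable_on {x+c..y+c}" and 2: "integral {x+c..y+c} f = F (y+c) - F (x+c)"
    using primitive_onD[OF assms(1), of "x+c" "y+c"] assms(2) xy by auto
  show "(\<lambda>x. f (x + c)) absolutely_integrable_on {x..y}"
    using 1 by (simp add: absolutely_integrable_shift_Icc)
  show "integral {x..y} (\<lambda>x. f (x + c)) = F (y+c) - F (x+c)"
    using 2 integral_shift_Icc_real[of x y f c] by (simp add: o_def add.commute)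
qed

lemma primitive_onI_deriv:
  assumes "\<And>x y. x \<in> I \<Longrightarrow> y \<in> I \<Longrightarrow> finite {t\<in>{x..y}. \<not> (F has_vector_derivative f t) (at t)}"
    and "\<And>x y. x \<in> I \<Longrightarrow> y \<in> I \<Longrightarrow> continuous_on {x..y} F"
    and "\<And>x y. x \<in> I \<Longrightarrow> y \<in> I \<Longrightarrow> f absolutely_integrable_on {x..y}"
  shows "primitive_on I f F"
  unfolding primitive_on_def
proof (intro ballI impI conjI)
  fix x y assume xy: "x \<in> I" "y \<in> I" "x \<le> y"
  have "(f has_integral F y - F x) {x..y}"
    by (rule fundamental_theorem_of_calculus_strong[OF assms(1)[OF xy(1,2)] xy(3) _ assms(2)[OF xy(1,2)]]) auto
  then show "integral {x..y} f = F y - F x" by (rule integral_unique)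
qed (use assms in auto)

lemma primitive_on_norm_diff_le:
  assumes "primitive_on I f F" "x \<in> I" "y \<in> I" "x \<le> y"
  shows "norm (F y - F x) \<le> integral {x..y} (\<lambda>t. norm (f t))"
  using primitive_onD[OF assms] integral_norm_bound_integral[of f "{x..y}" "\<lambda>t. norm (f t)"]
  by (auto simp: absolutely_integrable_on_def)

lemma integrable_lebesgue_on_iff:
  fixes f :: "real \<Rightarrow> 'a::euclidean_space"
  assumes "S \<in> sets lebesgue"
  shows "integrable (lebesgue_on S) f \<longleftrightarrow> f absolutely_integrable_on S"
  using assms by (simp add: integrable_restrict_space set_integrable_def)

lemma lebesgue_on_integral_eq:
  fixes f :: "real \<Rightarrow> 'a::euclidean_space"
  assumes "S \<in> sets lebesgue" "f absolutely_integrable_on S"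
  shows "integral\<^sup>L (lebesgue_on S) f = integral S f"
  using has_integral_integral_lebesgue_on[of S f] assms integrable_lebesgue_on_iff
  by (metis integral_unique)

text \<open>Both sides are the integral of \<open>f t * g s\<close> over the triangle \<open>x \<le> s < t \<le> y\<close>.\<close>

lemma integral_by_parts_Fubini:
  fixes f g :: "real \<Rightarrow> complex"
  assumes xy: "x \<le> y" and f: "f absolutely_integrable_on {x..y}" and g: "g absolutely_integrable_on {x..y}"
  shows "integral {x..y} (\<lambda>t. f t * integral {x..t} g) = integral {x..y} (\<lambda>s. g s * integral {s..y} f)"
proof -
  let ?M = "lebesgue_on {x..y}"
  interpret finite_measure ?M
    by (rule finite_measureI) (simp add: emeasure_restrict_space space_restrict_space emeasure_lborel_Icc_eq)
  interpret P: pair_sigma_finite ?M ?M ..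
  have fi: "integrable ?M f" and gi: "integrable ?M g" using f g by (simp_all add: integrable_lebesgue_on_iff)
  note [measurable] = borel_measurable_integrable[OF fi] borel_measurable_integrable[OF gi]
  have idm[measurable]: "(\<lambda>x. x) \<in> borel_measurable ?M"
    by (simp add: continuous_imp_measurable_on_sets_lebesgue)
  \<comment> \<open>The integrand on the square, cut off to the triangle below the diagonal.\<close>
  define H where "H = (\<lambda>(t,s). f t * g s * (if s < t then 1 else 0) :: complex)"
  have Hm[measurable]: "H \<in> borel_measurable (?M \<Otimes>\<^sub>M ?M)"
    unfolding H_def by measurable
  have G: "(\<integral>s. g s * (if s < t then 1 else 0) \<partial>?M) = integral {x..t} g" if t: "t \<in> {x..y}" for t
  proof -
    have "(\<integral>s. g s * (if s < t then 1 else 0) \<partial>?M) = integral {x..y} (\<lambda>s. g s * (if s < t then 1 else 0))"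
      by (rule lebesgue_on_integral_eq)
        (auto intro!: Bochner_Integration.integrable_bound[OF gi] simp flip: integrable_lebesgue_on_iff)
    also have "\<dots> = integral {x..y} (\<lambda>s. if s \<in> {x..t} then g s else 0)"
      by (rule integral_spike[of "{t}"]) auto
    also have "\<dots> = integral ({x..t} \<inter> {x..y}) g" by (simp only: integral_restrict_Int)
    also have "{x..t} \<inter> {x..y} = {x..t}" using t by auto
    finally show ?thesis .
  qed
  have F: "(\<integral>t. f t * (if s < t then 1 else 0) \<partial>?M) = integral {s..y} f" if s: "s \<in> {x..y}" for s
  proof -
    have "(\<integral>t. f t * (if s < t then 1 else 0) \<partial>?M) = integral {x..y} (\<lambda>t. f t * (if s < t then 1 else 0))"
      by (rule lebesgue_on_integral_eq)
        (auto intro!: Bochner_Integration.integrable_bound[OF fi] simp flip: integrable_lebesgue_on_iff)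
    also have "\<dots> = integral {x..y} (\<lambda>t. if t \<in> {s..y} then f t else 0)"
      by (rule integral_spike[of "{s}"]) auto
    also have "\<dots> = integral ({s..y} \<inter> {x..y}) f" by (simp only: integral_restrict_Int)
    also have "{s..y} \<inter> {x..y} = {s..y}" using s by auto
    finally show ?thesis .
  qed
  have Hi: "integrable (?M \<Otimes>\<^sub>M ?M) H"
  proof (rule P.Fubini_integrable)
    show "AE t in ?M. integrable ?M (\<lambda>s. H (t, s))"
      unfolding H_def
      by (intro AE_I2) (auto intro!: Bochner_Integration.integrable_bound[OF integrable_mult_right[OF gi]] )
    have *: "integrable ?M (\<lambda>t. norm (f t) * (\<integral>s. norm (g s) \<partial>?M))" using fi by simp
    show "integrable ?M (\<lambda>t. \<integral>s. norm (H (t, s)) \<partial>?M)"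
    proof (rule Bochner_Integration.integrable_bound[OF *])
      show "AE t in ?M. norm (\<integral>s. norm (H (t, s)) \<partial>?M) \<le> norm (norm (f t) * (\<integral>s. norm (g s) \<partial>?M))"
      proof (intro AE_I2)
        fix t assume "t \<in> space ?M"
        have "(\<integral>s. norm (H (t, s)) \<partial>?M) \<le> (\<integral>s. norm (f t) * norm (g s) \<partial>?M)"
          by (rule integral_mono_AE') (use gi in \<open>auto simp: H_def norm_mult\<close>)
        then show "norm (\<integral>s. norm (H (t, s)) \<partial>?M) \<le> norm (norm (f t) * (\<integral>s. norm (g s) \<partial>?M))"
          by (simp add: abs_mult)
      qed
    qed measurable
  qed measurable
  have "(\<integral>s. (\<integral>t. H (t, s) \<partial>?M) \<partial>?M) = (\<integral>t. (\<integral>s. H (t, s) \<partial>?M) \<partial>?M)"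
    using P.Fubini_integral[of "\<lambda>t s. H (t, s)"] Hi by simp
  moreover have "(\<integral>s. (\<integral>t. H (t, s) \<partial>?M) \<partial>?M) = (\<integral>s. g s * integral {s..y} f \<partial>?M)"
  proof (rule Bochner_Integration.integral_cong[OF refl])
    fix s assume "s \<in> space ?M"
    then have "integral {s..y} f = (\<integral>t. f t * (if s < t then 1 else 0) \<partial>?M)" using F by (simp add: space_restrict_space)
    then show "(\<integral>t. H (t, s) \<partial>?M) = g s * integral {s..y} f"
      by (simp add: H_def mult_ac flip: integral_mult_right_zero)
  qed
  moreover have "(\<integral>t. (\<integral>s. H (t, s) \<partial>?M) \<partial>?M) = (\<integral>t. f t * integral {x..t} g \<partial>?M)"
  proof (rule Bochner_Integration.integral_cong[OF refl])
    fix t assume "t \<in> space ?M"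
    then have "integral {x..t} g = (\<integral>s. g s * (if s < t then 1 else 0) \<partial>?M)" using G by (simp add: space_restrict_space)
    then show "(\<integral>s. H (t, s) \<partial>?M) = f t * integral {x..t} g"
      by (simp add: H_def mult_ac flip: integral_mult_right_zero)
  qed
  moreover have "(\<lambda>t. f t * integral {x..t} g) absolutely_integrable_on {x..y}"
  proof -
    have "continuous_on {x..y} (\<lambda>t. integral {x..t} g)"
      using g by (intro indefinite_integral_continuous_1) (auto simp: absolutely_integrable_on_def)
    then show ?thesis using f
      by (subst mult.commute, intro absolutely_integrable_bounded_measurable_product[OF bilinear_times])
         (auto intro!: compact_imp_bounded compact_continuous_image continuous_imp_measurable_on_sets_lebesgue)
  qed
  moreover have "(\<lambda>s. g s * integral {s..y} f) absolutely_integrable_on {x..y}"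
  proof -
    have "continuous_on {x..y} (\<lambda>s. integral {s..y} f)"
      using f by (intro indefinite_integral_continuous_1') (auto simp: absolutely_integrable_on_def)
    then show ?thesis using g
      by (subst mult.commute, intro absolutely_integrable_bounded_measurable_product[OF bilinear_times])
         (auto intro!: compact_imp_bounded compact_continuous_image continuous_imp_measurable_on_sets_lebesgue)
  qed
  ultimately show ?thesis by (simp add: lebesgue_on_integral_eq)
qed

lemma absolutely_integrable_mult_continuous:
  fixes F f :: "real \<Rightarrow> complex"
  assumes "continuous_on {x..y} F" "f absolutely_integrable_on {x..y}"
  shows "(\<lambda>t. F t * f t) absolutely_integrable_on {x..y}"
  using assms
  by (intro absolutely_integrable_bounded_measurable_product[OF bilinear_times])
     (auto intro!: compact_imp_bounded compact_continuous_image continuous_imp_measurable_on_sets_lebesgue)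

text \<open>The product rule for absolutely continuous functions. It carries the integration by parts against
test functions, the constancy of the Wronskian, and the passage between \<open>u'\<close> and \<open>p u'\<close>.\<close>

lemma primitive_on_prod:
  assumes I: "is_interval I" and F: "primitive_on I f F" and G: "primitive_on I g G"
  shows "primitive_on I (\<lambda>x. f x * G x + F x * g x) (\<lambda>x. F x * G x)"
  unfolding primitive_on_def
proof (intro ballI impI)
  fix x y assume xy: "x \<in> I" "y \<in> I" "x \<le> y"
  have sub: "{x..y} \<subseteq> I" using mem_is_interval_1_I[OF I xy(1,2)] by auto
  have F': "primitive_on {x..y} f F" and G': "primitive_on {x..y} g G" 
    using F G primitive_on_subset sub by blast+
  note [simp] = primitive_onD(1)[OF F'] primitive_onD(1)[OF G']
  have fG: "(\<lambda>t. G t * f t) absolutely_integrable_on {x..y}" and gF: "(\<lambda>t. F t * g t) absolutely_integrable_on {x..y}"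
    using xy by (auto intro!: absolutely_integrable_mult_continuous primitive_on_continuous_Icc F' G')
  have fi: "f integrable_on {x..y}" "g integrable_on {x..y}" using primitive_onD(3)[OF F'] primitive_onD(3)[OF G'] xy by auto
  have fG': "(\<lambda>t. G t * f t) integrable_on {x..y}" and gF': "(\<lambda>t. F t * g t) integrable_on {x..y}"
    using fG gF absolutely_integrable_on_def by blast+
  have "integral {x..y} (\<lambda>t. f t * (G t - G x)) = integral {x..y} (\<lambda>s. g s * (F y - F s))"
  proof -
    have "integral {x..y} (\<lambda>t. f t * (G t - G x)) = integral {x..y} (\<lambda>t. f t * integral {x..t} g)"
      by (rule integral_cong) (use primitive_onD(2)[OF G'] in auto)
    also have "\<dots> = integral {x..y} (\<lambda>s. g s * integral {s..y} f)"
      using xy by (intro integral_by_parts_Fubini) auto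
    also have "\<dots> = integral {x..y} (\<lambda>s. g s * (F y - F s))"
      by (rule integral_cong) (use primitive_onD(2)[OF F'] in auto)
    finally show ?thesis .
  qed
  moreover have 2: "integral {x..y} (\<lambda>t. f t * (G t - G x)) = integral {x..y} (\<lambda>t. G t * f t) - G x * (F y - F x)"
  proof -
    have "integral {x..y} (\<lambda>t. G t * f t - G x * f t) = integral {x..y} (\<lambda>t. G t * f t) - integral {x..y} (\<lambda>t. G x * f t)"
      using fG' fi by (intro integral_diff integrable_on_mult_right)
    then show ?thesis using primitive_onD(2)[OF F'] xy by (simp add: algebra_simps)
  qed
  moreover have "integral {x..y} (\<lambda>s. g s * (F y - F s)) = F y * (G y - G x) - integral {x..y} (\<lambda>t. F t * g t)"
  proof -
    have "integral {x..y} (\<lambda>t. F y * g t - F t * g t) = integral {x..y} (\<lambda>t. F y * g t) - integral {x..y} (\<lambda>t. F t * g t)"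
      using gF' fi by (intro integral_diff integrable_on_mult_right)
    then show ?thesis using primitive_onD(2)[OF G'] xy by (simp add: algebra_simps)
  qed
  moreover have "integral {x..y} (\<lambda>x. f x * G x + F x * g x) = integral {x..y} (\<lambda>t. G t * f t) + integral {x..y} (\<lambda>t. F t * g t)"
    using fG' gF' by (simp add: mult.commute[of "f _"] integral_add)
  ultimately have 4: "integral {x..y} (\<lambda>t. G t * f t) - G x * (F y - F x) = F y * (G y - G x) - integral {x..y} (\<lambda>t. F t * g t)"
    and 5: "integral {x..y} (\<lambda>x. f x * G x + F x * g x) = integral {x..y} (\<lambda>t. G t * f t) + integral {x..y} (\<lambda>t. F t * g t)"
    by simp_all
  have "a + b = F y * G y - F x * G x" if "a - G x * (F y - F x) = F y * (G y - G x) - b" for a b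
    using that by algebra
  from this[OF 4] have "integral {x..y} (\<lambda>x. f x * G x + F x * g x) = F y * G y - F x * G x"
    by (simp only: 5)
  moreover have "(\<lambda>x. f x * G x + F x * g x) absolutely_integrable_on {x..y}"
    using set_integral_add(1)[OF fG gF] by (simp add: mult.commute)
  ultimately show "(\<lambda>x. f x * G x + F x * g x) absolutely_integrable_on {x..y} \<and>
    integral {x..y} (\<lambda>x. f x * G x + F x * g x) = F y * G y - F x * G x" by blast
qed

section \<open>Smooth test functions\<close>

definition smooth_fun :: "(real \<Rightarrow> real) \<Rightarrow> bool" where
  "smooth_fun f \<longleftrightarrow> (\<forall>n x. (deriv ^^ n) f differentiable (at x))"

text \<open>Iterated derivatives are controlled by exhibiting a class of functions that contains \<open>f\<close> and is
closed under differentiation. The basic smoothness proofs below name such classes.\<close>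

lemma smooth_fun_closed:
  assumes "f \<in> A" "\<And>g. g \<in> A \<Longrightarrow> \<exists>g'\<in>A. \<forall>x. (g has_real_derivative g' x) (at x)"
  shows "smooth_fun f"
proof -
  have "(deriv ^^ n) f \<in> A" for n
  proof (induction n)
    case (Suc n)
    from assms(2)[OF this] obtain g' where g': "g' \<in> A" "\<And>x. ((deriv ^^ n) f has_real_derivative g' x) (at x)" by blast
    then have "deriv ((deriv ^^ n) f) = g'" by (auto intro!: ext DERIV_imp_deriv)
    with g' show ?case by simp
  qed (use assms in auto)
  then show ?thesis using assms(2) unfolding smooth_fun_def
    by (meson real_differentiable_def)
qed

lemma smooth_fun_deriv:
  assumes "smooth_fun f"
  shows "(f has_real_derivative deriv f x) (at x)" "smooth_fun (deriv f)"
proof -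
  have "f differentiable (at x)" using assms unfolding smooth_fun_def by (metis funpow_0)
  then show "(f has_real_derivative deriv f x) (at x)"
    using DERIV_deriv_iff_real_differentiable by blast
  show "smooth_fun (deriv f)"
    using assms unfolding smooth_fun_def by (metis comp_apply funpow_Suc_right)
qed

lemma smooth_fun_antideriv:
  assumes "smooth_fun f" "\<And>x. (F has_real_derivative f x) (at x)"
  shows "smooth_fun F"
  using assms(2) by (intro smooth_fun_closed[of F "insert F {g. smooth_fun g}"])
    (use smooth_fun_deriv assms in blast)+

lemma smooth_fun_linear:
  assumes "smooth_fun f" "smooth_fun g"
  shows "smooth_fun (\<lambda>x. \<alpha> * f x + \<beta> * g x)"
proof (rule smooth_fun_closed)
  let ?A = "{\<lambda>x. \<alpha> * f x + \<beta> * g x | f g. smooth_fun f \<and> smooth_fun g}"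
  show "(\<lambda>x. \<alpha> * f x + \<beta> * g x) \<in> ?A" using assms by blast
  fix h assume "h \<in> ?A"
  then obtain f g where h: "h = (\<lambda>x. \<alpha> * f x + \<beta> * g x)" "smooth_fun f" "smooth_fun g" by blast
  show "\<exists>h'\<in>?A. \<forall>x. (h has_real_derivative h' x) (at x)"
  proof (rule bexI[of _ "\<lambda>x. \<alpha> * deriv f x + \<beta> * deriv g x"])
    show "\<forall>x. (h has_real_derivative \<alpha> * deriv f x + \<beta> * deriv g x) (at x)"
      unfolding h using smooth_fun_deriv(1) h(2,3) by (auto intro!: DERIV_add DERIV_cmult)
    show "(\<lambda>x. \<alpha> * deriv f x + \<beta> * deriv g x) \<in> ?A"
      using smooth_fun_deriv(2) h(2,3) by blast
  qed
qed

lemma smooth_fun_affine: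
  assumes "smooth_fun f"
  shows "smooth_fun (\<lambda>x. f (m * x + c))"
proof (rule smooth_fun_closed)
  let ?A = "{\<lambda>x. k * f (m * x + c) | k f. smooth_fun f}"
  show "(\<lambda>x. f (m * x + c)) \<in> ?A" using assms by (auto intro!: exI[of _ 1])
  fix h assume "h \<in> ?A"
  then obtain f k where h: "h = (\<lambda>x. k * f (m * x + c))" "smooth_fun f" by blast
  show "\<exists>h'\<in>?A. \<forall>x. (h has_real_derivative h' x) (at x)"
  proof (rule bexI[of _ "\<lambda>x. (k * m) * deriv f (m * x + c)"])
    show "\<forall>x. (h has_real_derivative (k * m) * deriv f (m * x + c)) (at x)"
    proof
      fix x
      have "((\<lambda>x. f (m * x + c)) has_real_derivative deriv f (m * x + c) * m) (at x)"
        by (rule DERIV_chain2[OF smooth_fun_deriv(1)[OF h(2)]]) (auto intro!: derivative_eq_intros)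
      from DERIV_cmult[OF this, of k]
      show "(h has_real_derivative (k * m) * deriv f (m * x + c)) (at x)"
        unfolding h by (simp add: mult_ac)
    qed
    show "(\<lambda>x. (k * m) * deriv f (m * x + c)) \<in> ?A" using smooth_fun_deriv(2)[OF h(2)] by blast
  qed
qed

text \<open>The span of products of smooth functions is closed under differentiation by the Leibniz rule,
whereas the set of single products is not.\<close>

inductive_set smooth_products :: "(real \<Rightarrow> real) set" where
  prod: "smooth_fun f \<Longrightarrow> smooth_fun g \<Longrightarrow> (\<lambda>x. f x * g x) \<in> smooth_products"
| sum: "f \<in> smooth_products \<Longrightarrow> g \<in> smooth_products \<Longrightarrow> (\<lambda>x. f x + g x) \<in> smooth_products"

lemma smooth_fun_mult:
  assumes "smooth_fun f" "smooth_fun g"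
  shows "smooth_fun (\<lambda>x. f x * g x)"
proof (rule smooth_fun_closed)
  show "(\<lambda>x. f x * g x) \<in> smooth_products" using assms by (rule smooth_products.prod)
  fix h assume "h \<in> smooth_products"
  then show "\<exists>h'\<in>smooth_products. \<forall>x. (h has_real_derivative h' x) (at x)"
  proof induction
    case (prod f g)
    show ?case
    proof (intro bexI allI)
      show "((\<lambda>x. f x * g x) has_real_derivative deriv f x * g x + f x * deriv g x) (at x)" for x
        using prod smooth_fun_deriv by (auto intro!: derivative_eq_intros)
      show "(\<lambda>x. deriv f x * g x + f x * deriv g x) \<in> smooth_products"
        using prod smooth_fun_deriv by (intro smooth_products.intros) auto
    qed
  next
    case (sum f g)
    then obtain f' g' where *: "f' \<in> smooth_products" "g' \<in> smooth_products"
      "\<And>x. (f has_real_derivative f' x) (at x)" "\<And>x. (g has_real_derivative g' x) (at x)" by blast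
    then show ?case
      by (intro bexI[of _ "\<lambda>x. f' x + g' x"]) (auto intro!: derivative_eq_intros smooth_products.sum)
  qed
qed

text \<open>The flat function \<open>exp (- \<delta> / x)\<close> of Cauchy, with a polynomial in \<open>1 / x\<close> as a factor: this family is
closed under differentiation.\<close>

definition exp_tail :: "real poly \<Rightarrow> real \<Rightarrow> real \<Rightarrow> real" where
  "exp_tail P \<delta> x = (if x > 0 then poly P (1 / x) * exp (- \<delta> / x) else 0)"

lemma exp_tail_tendsto_0:
  fixes \<delta> :: real
  assumes "\<delta> > 0"
  shows "((\<lambda>x. poly P (1 / x) * exp (- \<delta> / x)) \<longlongrightarrow> 0) (at_right 0)"
proof -
  have lim: "filterlim (\<lambda>x::real. \<delta> / x) at_top (at_right 0)"
    using filterlim_tendsto_pos_mult_at_top[OF tendsto_const assms filterlim_inverse_at_top_right]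
    by (simp add: divide_inverse)
  have "((\<lambda>x. (\<Sum>i\<le>degree P. (coeff P i / \<delta> ^ i) * ((\<delta> / x) ^ i / exp (\<delta> / x)))) \<longlongrightarrow> (\<Sum>i\<le>degree P. (coeff P i / \<delta> ^ i) * 0)) (at_right 0)"
    by (intro tendsto_sum tendsto_mult tendsto_const filterlim_compose[OF tendsto_power_div_exp_0 lim])
  moreover have "(\<Sum>i\<le>degree P. (coeff P i / \<delta> ^ i) * ((\<delta> / x) ^ i / exp (\<delta> / x))) = poly P (1 / x) * exp (- \<delta> / x)" for x
    using assms by (simp add: poly_altdef sum_distrib_right exp_minus divide_simps power_divide)
  ultimately show ?thesis by simp
qed

lemma exp_tail_DERIV:
  assumes "\<delta> > 0"
  shows "(exp_tail P \<delta> has_real_derivative exp_tail ([:0, 0, 1:] * (smult \<delta> P - pderiv P)) \<delta> x) (at x)"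
proof -
  consider "x > 0" | "x < 0" | "x = 0" by linarith
  then show ?thesis
  proof cases
    case 1
    have "((\<lambda>x. poly P (1 / x) * exp (- \<delta> / x)) has_real_derivative
        (poly (pderiv P) (1 / x) * (- 1 / x\<^sup>2)) * exp (- \<delta> / x) + poly P (1 / x) * (exp (- \<delta> / x) * (\<delta> / x\<^sup>2))) (at x)"
    proof -
      have inv: "((\<lambda>x. 1 / x) has_real_derivative (- 1 / x\<^sup>2)) (at x)"
        using 1 by (auto intro!: derivative_eq_intros simp: power2_eq_square)
      have expo: "((\<lambda>x. - \<delta> / x) has_real_derivative (\<delta> / x\<^sup>2)) (at x)"
        using 1 by (auto intro!: derivative_eq_intros simp: power2_eq_square)
      show ?thesis
        using DERIV_mult'[OF DERIV_chain2[OF poly_DERIV[of P "1 / x"] inv] DERIV_chain2[OF DERIV_exp expo]]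
        by (simp add: add.commute)
    qed
    moreover have "(poly (pderiv P) (1 / x) * (- 1 / x\<^sup>2)) * exp (- \<delta> / x) + poly P (1 / x) * (exp (- \<delta> / x) * (\<delta> / x\<^sup>2))
       = exp_tail ([:0, 0, 1:] * (smult \<delta> P - pderiv P)) \<delta> x"
      using 1 by (simp add: exp_tail_def power2_eq_square algebra_simps)
    ultimately have der: "((\<lambda>x. poly P (1 / x) * exp (- \<delta> / x)) has_real_derivative
        exp_tail ([:0, 0, 1:] * (smult \<delta> P - pderiv P)) \<delta> x) (at x)" by (simp only:)
    show ?thesis
      by (rule has_field_derivative_transform_within_open[OF der, of "{0<..}"])
         (simp_all add: exp_tail_def 1)
  next
    case 2
    have der: "((\<lambda>x. 0) has_real_derivative exp_tail ([:0, 0, 1:] * (smult \<delta> P - pderiv P)) \<delta> x) (at x)"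
      using 2 by (simp add: exp_tail_def)
    show ?thesis
      by (rule has_field_derivative_transform_within_open[OF der, of "{..<0}"])
         (simp_all add: exp_tail_def 2)
  next
    case 3
    have "((\<lambda>h. exp_tail P \<delta> h / h) \<longlongrightarrow> 0) (at_right 0)"
    proof (rule tendsto_cong[THEN iffD1, OF _ exp_tail_tendsto_0[OF assms, of "pCons 0 P"]])
      show "\<forall>\<^sub>F x in at_right 0. poly (pCons 0 P) (1 / x) * exp (- \<delta> / x) = exp_tail P \<delta> x / x"
        by (rule eventually_at_right_less[THEN eventually_mono]) (simp add: exp_tail_def)
    qed
    moreover have "((\<lambda>h. exp_tail P \<delta> h / h) \<longlongrightarrow> 0) (at_left 0)"
    proof (rule tendsto_cong[THEN iffD1, OF _ tendsto_const])
      show "\<forall>\<^sub>F x in at_left 0. 0 = exp_tail P \<delta> x / x"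
        by (auto simp: exp_tail_def eventually_at_filter)
    qed
    ultimately have "((\<lambda>h. exp_tail P \<delta> h / h) \<longlongrightarrow> 0) (at 0)"
      by (simp add: filterlim_split_at)
    then show ?thesis by (simp add: 3 DERIV_def exp_tail_def[of _ _ 0])
  qed
qed

lemma smooth_fun_exp_tail: "\<delta> > 0 \<Longrightarrow> smooth_fun (exp_tail P \<delta>)"
  by (rule smooth_fun_closed[of _ "range (\<lambda>P. exp_tail P \<delta>)"]) (use exp_tail_DERIV in auto)

text \<open>Up to the choice of the decay rate this is the usual bump function on \<open>{c<..<d}\<close>. As the rate
\<open>1 / Suc n\<close> tends to \<open>0\<close>, the functions tend to the indicator function while staying below \<open>1\<close>, so
that integrals against bumps determine integrals over intervals, without any mollification.\<close>

definition bump :: "real \<Rightarrow> real \<Rightarrow> nat \<Rightarrow> real \<Rightarrow> real" where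
  "bump c d n x = exp_tail 1 (1 / Suc n) (x - c) * exp_tail 1 (1 / Suc n) (d - x)"

lemma bump_eq_0: "x \<notin> {c<..<d} \<Longrightarrow> bump c d n x = 0"
  by (auto simp: bump_def exp_tail_def)

lemma bump_pos: "x \<in> {c<..<d} \<Longrightarrow> bump c d n x > 0"
  by (auto simp: bump_def exp_tail_def)

lemma bump_bounds: "0 \<le> bump c d n x" "bump c d n x \<le> 1"
  by (auto simp: bump_def exp_tail_def mult_le_one divide_nonneg_nonneg)

lemma smooth_fun_bump: "smooth_fun (bump c d n)"
proof -
  have "smooth_fun (\<lambda>x. exp_tail 1 (1 / Suc n) (1 * x + (- c)) * exp_tail 1 (1 / Suc n) ((-1) * x + d))"
    by (intro smooth_fun_mult smooth_fun_affine smooth_fun_exp_tail) auto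
  then show ?thesis unfolding bump_def[abs_def] by simp
qed

lemma bump_tendsto_indicator: "(\<lambda>n. bump c d n x) \<longlonglongrightarrow> indicator {c<..<d} x"
proof (cases "x \<in> {c<..<d}")
  case True
  have "(\<lambda>n. exp (- (1 / Suc n) / (x - c)) * exp (- (1 / Suc n) / (d - x))) \<longlonglongrightarrow> exp (- 0 / (x - c)) * exp (- 0 / (d - x))"
    using True by (intro tendsto_intros LIMSEQ_Suc lim_1_over_n) auto
  then show ?thesis using True by (simp add: bump_def exp_tail_def)
qed (simp add: bump_eq_0)

lemma test_functionI:
  assumes "smooth_fun \<phi>" "\<And>x. x \<notin> {c..d} \<Longrightarrow> \<phi> x = 0" "{c..d} \<subseteq> S"
  shows "test_function S \<phi>"
proof -
  have "closure {x. \<phi> x \<noteq> 0} \<subseteq> {c..d}"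
    by (rule closure_minimal) (use assms(2) in blast, simp)
  moreover from this have "compact (closure {x. \<phi> x \<noteq> 0})"
    by (meson compact_Icc closed_closure bounded_subset compact_eq_bounded_closed)
  ultimately show ?thesis using assms unfolding test_function_def smooth_fun_def by blast
qed

lemma test_function_bump: "{c..d} \<subseteq> S \<Longrightarrow> test_function S (bump c d n)"
  by (rule test_functionI[OF smooth_fun_bump, of c d]) (auto simp: bump_eq_0)

lemma test_function_smooth: "test_function S \<phi> \<Longrightarrow> smooth_fun \<phi>"
  by (simp add: test_function_def smooth_fun_def)

lemma smooth_fun_continuous: "smooth_fun f \<Longrightarrow> continuous_on A f"
  by (meson DERIV_isCont continuous_at_imp_continuous_on smooth_fun_deriv(1))

section \<open>Pairings with test functions\<close>

lemma locally_integrableD: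
  assumes "locally_integrable S u" "compact T" "T \<subseteq> S"
  shows "u absolutely_integrable_on T"
  using assms integrable_lebesgue_on_iff[of T u] unfolding locally_integrable_def
  by (metis lmeasurable_compact fmeasurableD)

lemma locally_integrableI:
  assumes "\<And>T. compact T \<Longrightarrow> T \<subseteq> S \<Longrightarrow> u absolutely_integrable_on T"
  shows "locally_integrable S u"
  using assms integrable_lebesgue_on_iff[of _ u] unfolding locally_integrable_def
  by (metis lmeasurable_compact fmeasurableD)

lemma locally_integrable_diff:
  assumes "locally_integrable S u" "locally_integrable S v"
  shows "locally_integrable S (\<lambda>x. u x - v x)"
proof (rule locally_integrableI)
  fix T assume T: "compact T" "T \<subseteq> S"
  show "(\<lambda>x. u x - v x) absolutely_integrable_on T"
    by (rule set_integral_diff(1)[OF locally_integrableD[OF assms(1) T] locally_integrableD[OF assms(2) T]])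
qed

text \<open>Translates a pairing with a compactly supported function on the measure space \<open>lebesgue_on S\<close> into a
gauge integral over the support, for which absolute integrability and spikes are convenient.\<close>

lemma LINT_compact_support:
  fixes \<phi> :: "real \<Rightarrow> real" and u :: "real \<Rightarrow> complex"
  assumes "continuous_on T \<phi>" "\<And>x. x \<notin> T \<Longrightarrow> \<phi> x = 0" "compact T" "T \<subseteq> S" "S \<in> sets lebesgue"
    "u absolutely_integrable_on T"
  shows "(\<lambda>x. \<phi> x *\<^sub>R u x) absolutely_integrable_on T"
    "(LINT x|lebesgue_on S. \<phi> x *\<^sub>R u x) = integral T (\<lambda>x. \<phi> x *\<^sub>R u x)"
proof -
  have T: "T \<in> sets lebesgue" using assms(3) lmeasurable_compact by blast
  show *: "(\<lambda>x. \<phi> x *\<^sub>R u x) absolutely_integrable_on T"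
    using assms T
    by (intro absolutely_integrable_bounded_measurable_product[OF bilinear_conv_bounded_bilinear[THEN iffD2, OF bounded_bilinear_scaleR]])
     (auto intro!: compact_imp_bounded compact_continuous_image continuous_imp_measurable_on_sets_lebesgue)
  have "(LINT x|lebesgue_on S. \<phi> x *\<^sub>R u x) = (LINT x|lebesgue. indicator S x *\<^sub>R (\<phi> x *\<^sub>R u x))"
    using assms(5) by (intro integral_restrict_space) auto
  also have "\<dots> = (LINT x|lebesgue. indicator T x *\<^sub>R (\<phi> x *\<^sub>R u x))"
    using assms(2,4) by (intro Bochner_Integration.integral_cong) (auto simp: indicator_def)
  also have "\<dots> = (LINT x|lebesgue_on T. \<phi> x *\<^sub>R u x)"
    using T by (intro integral_restrict_space[symmetric]) auto
  also have "\<dots> = integral T (\<lambda>x. \<phi> x *\<^sub>R u x)"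
    using lebesgue_on_integral_eq T * by blast
  finally show "(LINT x|lebesgue_on S. \<phi> x *\<^sub>R u x) = integral T (\<lambda>x. \<phi> x *\<^sub>R u x)" .
qed

lemma sigma_finite_lebesgue: "sigma_finite_measure (lebesgue :: 'a::euclidean_space measure)"
proof
  obtain A :: "'a set set" where A: "countable A" "A \<subseteq> sets lborel" "\<Union>A = space lborel" "\<forall>a\<in>A. emeasure lborel a \<noteq> \<infinity>"
    using lborel.sigma_finite_countable by blast
  have "emeasure lebesgue a \<noteq> \<infinity>" if "a \<in> A" for a
    using A(2,4) that by (auto simp: subset_iff)
  then show "\<exists>A::'a set set. countable A \<and> A \<subseteq> sets lebesgue \<and> \<Union>A = space lebesgue \<and> (\<forall>a\<in>A. emeasure lebesgue a \<noteq> \<infinity>)"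
    using A by (intro exI[of _ A]) auto
qed

text \<open>The sets over which \<open>w\<close> has integral zero form a Dynkin system. It contains the half-lines, hence all
Borel sets, hence all Lebesgue sets; a function whose integrals over all measurable sets vanish is
zero almost everywhere.\<close>

lemma AE_zero_of_initial_integrals:
  fixes w :: "real \<Rightarrow> complex"
  assumes w: "w absolutely_integrable_on {c..d}"
    and 0: "\<And>x. x \<in> {c..d} \<Longrightarrow> integral {c..x} w = 0"
  shows "negligible {x\<in>{c..d}. w x \<noteq> 0}"
proof -
  define f where "f = (\<lambda>x. indicator {c..d} x *\<^sub>R w x)"
  have f: "integrable lebesgue f" using w unfolding f_def set_integrable_def .
  have fA: "set_integrable lebesgue A f" if "A \<in> sets lebesgue" for A
    unfolding set_integrable_def using integrable_mult_indicator[OF that f] .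
  have borel: "(LINT x:A|lebesgue. f x) = 0" if "A \<in> sets borel" for A
  proof -
    have A: "A \<in> sigma_sets UNIV (range (\<lambda>a::real. {..a}))"
      using that by (simp add: borel_eq_atMost)
    have meas: "B \<in> sets lebesgue" if "B \<in> sigma_sets UNIV (range (\<lambda>a::real. {..a}))" for B
    proof -
      have "B \<in> sets borel" using that by (simp add: borel_eq_atMost)
      then show ?thesis by auto
    qed
    have total: "(LINT x:{..x}|lebesgue. f x) = 0" for x
    proof -
      have "(LINT x:{..x}|lebesgue. f x) = (LINT y:{c..min x d}|lebesgue. w y)"
        unfolding set_lebesgue_integral_def f_def by (intro Bochner_Integration.integral_cong) (auto simp: indicator_def)
      also have "\<dots> = integral {c..min x d} w"
        by (rule set_lebesgue_integral_eq_integral(2)) (rule set_integrable_subset[OF w], auto)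
      also have "\<dots> = 0" using 0[of "min x d"] by (cases "c \<le> min x d") auto
      finally show ?thesis .
    qed
    have univ: "(LINT x|lebesgue. f x) = 0"
    proof -
      have "(LINT x|lebesgue. f x) = (LINT x:{..d}|lebesgue. f x)"
        unfolding set_lebesgue_integral_def f_def by (intro Bochner_Integration.integral_cong) (auto simp: indicator_def)
      then show ?thesis using total by simp
    qed
    have sub: "range (\<lambda>a::real. {..a}) \<subseteq> Pow UNIV" by simp
    have st: "Int_stable (range (\<lambda>a::real. {..a}))"
      by (auto simp: Int_stable_def image_iff)
    show ?thesis
      using st sub A
    proof (induction rule: sigma_sets_induct_disjoint)
      case (basic B)
      then show ?case using total by auto
    next
      case empty
      then show ?case by (simp add: set_lebesgue_integral_def)
    next
      case (compl B)
      have "(LINT x:UNIV - B|lebesgue. f x) = (LINT x|lebesgue. f x - indicator B x *\<^sub>R f x)"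
        unfolding set_lebesgue_integral_def by (intro Bochner_Integration.integral_cong) (auto simp: indicator_def)
      also have "\<dots> = (LINT x|lebesgue. f x) - (LINT x:B|lebesgue. f x)"
        using f fA[OF meas[OF compl(1)]] by (simp add: set_integrable_def set_lebesgue_integral_def)
      finally show ?case using compl univ by simp
    next
      case (union B)
      then have "(LINT x:(\<Union>i. B i)|lebesgue. f x) = (\<Sum>i. (LINT x:B i|lebesgue. f x))"
        by (intro lebesgue_integral_countable_add fA) (auto simp: disjoint_family_on_def intro!: meas sigma_sets.Union)
      then show ?case using union by simp
    qed
  qed
  have "AE x in lebesgue. f x = 0"
  proof (rule sigma_finite_measure.density_zero[OF sigma_finite_lebesgue f])
    fix A :: "real set" assume "A \<in> sets lebesgue"
    then obtain B N N' where B: "A = B \<union> N" "N \<subseteq> N'" "N' \<in> null_sets lborel" "B \<in> sets borel"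
      by (elim sets_completionE) simp
    have "AE x in lebesgue. x \<notin> N'"
      using B(3) by (intro AE_not_in null_sets_completionI)
    then have "AE x in lebesgue. indicator A x *\<^sub>R f x = indicator B x *\<^sub>R f x"
      by eventually_elim (use B in \<open>auto simp: indicator_def\<close>)
    then have "(LINT x:A|lebesgue. f x) = (LINT x:B|lebesgue. f x)"
      unfolding set_lebesgue_integral_def
      using fA[OF \<open>A \<in> sets lebesgue\<close>] fA[of B] B(4)
      by (intro integral_cong_AE) (auto simp: set_integrable_def)
    then show "(LINT x:A|lebesgue. f x) = 0" using borel[OF B(4)] by simp
  qed
  then obtain N where "negligible N" "\<And>x. x \<notin> N \<Longrightarrow> f x = 0"
    unfolding AE_lebesgue_iff_negligible by blast
  then show ?thesis
    by (elim negligible_subset) (auto simp: f_def indicator_def split: if_splits)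
qed

lemma AE_lebesgue_on_iff:
  assumes "S \<in> sets lebesgue"
  shows "(AE x in lebesgue_on S. P x) \<longleftrightarrow> negligible {x\<in>S. \<not> P x}"
proof -
  have "(AE x in lebesgue_on S. P x) \<longleftrightarrow> (AE x in lebesgue. x \<in> S \<longrightarrow> P x)"
    using assms by (subst AE_restrict_space_iff) auto
  also have "\<dots> \<longleftrightarrow> negligible {x\<in>S. \<not> P x}"
    unfolding AE_lebesgue_iff_negligible
    by (metis (mono_tags, lifting) mem_Collect_eq negligible_subset subsetI)
  finally show ?thesis .
qed

text \<open>The fundamental lemma of the calculus of variations. By dominated convergence, integrals against
bumps determine those over intervals; an open set is covered by countably many
compact intervals with rational end points.\<close>

lemma AE_zero_of_bumps:
  assumes S: "open S" and w: "locally_integrable S w"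
    and 0: "\<And>c d n. c < d \<Longrightarrow> {c..d} \<subseteq> S \<Longrightarrow> (LINT x|lebesgue_on S. bump c d n x *\<^sub>R w x) = 0"
  shows "AE x in lebesgue_on S. w x = 0"
proof -
  have Sl: "S \<in> sets lebesgue" using S by (simp add: lborelD borel_open)
  have "negligible {x\<in>{c..d}. w x \<noteq> 0}" if cd: "{c..d} \<subseteq> S" for c d
  proof (rule AE_zero_of_initial_integrals)
    show w': "w absolutely_integrable_on {c..d}" using locally_integrableD[OF w] cd by auto
    fix x assume x: "x \<in> {c..d}"
    show "integral {c..x} w = 0"
    proof (cases "c < x")
      case True
      have cx: "{c..x} \<subseteq> S" using x cd by auto
      have wx: "w absolutely_integrable_on {c..x}" by (rule set_integrable_subset[OF w']) (use x in auto)
      have bx: "(\<lambda>t. bump c x n t *\<^sub>R w t) absolutely_integrable_on {c..x}"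
           "(LINT x'|lebesgue_on S. bump c x n x' *\<^sub>R w x') = integral {c..x} (\<lambda>t. bump c x n t *\<^sub>R w t)" for n
      proof -
        have z: "bump c x n t = 0" if "t \<notin> {c..x}" for t using that by (intro bump_eq_0) auto
        show "(\<lambda>t. bump c x n t *\<^sub>R w t) absolutely_integrable_on {c..x}"
           "(LINT x'|lebesgue_on S. bump c x n x' *\<^sub>R w x') = integral {c..x} (\<lambda>t. bump c x n t *\<^sub>R w t)"
          using LINT_compact_support[OF smooth_fun_continuous[OF smooth_fun_bump] z compact_Icc cx Sl wx] by auto
      qed
      have "(\<lambda>n. integral {c..x} (\<lambda>t. bump c x n t *\<^sub>R w t)) \<longlonglongrightarrow> integral {c..x} (\<lambda>t. indicator {c<..<x} t *\<^sub>R w t)"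
      proof (rule dominated_convergence(2))
        show "(\<lambda>t. bump c x n t *\<^sub>R w t) integrable_on {c..x}" for n
          using bx(1) absolutely_integrable_on_def by blast
        show "(\<lambda>t. norm (w t)) integrable_on {c..x}" using wx absolutely_integrable_on_def by blast
        show "norm (bump c x n t *\<^sub>R w t) \<le> norm (w t)" for n t
          using bump_bounds[of c x n t] by (simp add: mult_left_le_one_le)
        show "(\<lambda>n. bump c x n t *\<^sub>R w t) \<longlonglongrightarrow> indicator {c<..<x} t *\<^sub>R w t" for t
          by (intro tendsto_scaleR bump_tendsto_indicator tendsto_const)
      qed
      moreover have "integral {c..x} (\<lambda>t. bump c x n t *\<^sub>R w t) = 0" for n
        using 0[OF True cx] bx(2) by simp
      ultimately have "integral {c..x} (\<lambda>t. indicator {c<..<x} t *\<^sub>R w t) = 0"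
        by (simp add: LIMSEQ_const_iff)
      moreover have "integral {c..x} (\<lambda>t. indicator {c<..<x} t *\<^sub>R w t) = integral {c..x} w"
        by (rule integral_spike[of "{c,x}"]) (auto simp: indicator_def)
      ultimately show ?thesis by simp
    qed (use x in auto)
  qed
  then have *: "negligible (\<Union>(c,d)\<in>{(c,d). c \<in> \<rat> \<and> d \<in> \<rat> \<and> {c..d} \<subseteq> S}. {x\<in>{c..d}. w x \<noteq> 0})"
    by (intro negligible_countable_Union countable_image)
       (auto intro!: countable_subset[of "{(c,d). c \<in> \<rat> \<and> d \<in> \<rat> \<and> {c..d} \<subseteq> S}" "\<rat> \<times> \<rat>"] countable_rat)
  have "{x\<in>S. w x \<noteq> 0} \<subseteq> (\<Union>(c,d)\<in>{(c,d). c \<in> \<rat> \<and> d \<in> \<rat> \<and> {c..d} \<subseteq> S}. {x\<in>{c..d}. w x \<noteq> 0})"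
  proof
    fix x assume x: "x \<in> {x\<in>S. w x \<noteq> 0}"
    then obtain e where e: "e > 0" "ball x e \<subseteq> S" using S openE by blast
    obtain c d where "c \<in> \<rat>" "x - e < c" "c < x" "d \<in> \<rat>" "x < d" "d < x + e"
      using Rats_dense_in_real[of "x - e" x] Rats_dense_in_real[of x "x + e"] e by auto
    moreover from this have "{c..d} \<subseteq> ball x e" by (auto simp: dist_real_def)
    ultimately show "x \<in> (\<Union>(c,d)\<in>{(c,d). c \<in> \<rat> \<and> d \<in> \<rat> \<and> {c..d} \<subseteq> S}. {x\<in>{c..d}. w x \<noteq> 0})"
      using x e by (intro UN_I[of "(c,d)"]) auto
  qed
  then have "negligible {x\<in>S. w x \<noteq> 0}" using * negligible_subset by blast
  then show ?thesis using Sl by (simp add: AE_lebesgue_on_iff)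
qed

section \<open>Weak derivatives\<close>

lemma test_function_support:
  assumes "test_function S \<phi>"
  obtains T where "compact T" "T \<subseteq> S" "\<And>x. x \<notin> T \<Longrightarrow> \<phi> x = 0" "\<And>x. x \<notin> T \<Longrightarrow> deriv \<phi> x = 0"
proof
  let ?T = "closure {x. \<phi> x \<noteq> 0}"
  show "compact ?T" "?T \<subseteq> S" using assms by (auto simp: test_function_def)
  show *: "\<phi> x = 0" if "x \<notin> ?T" for x using that closure_subset[of "{x. \<phi> x \<noteq> 0}"] by auto
  show "deriv \<phi> x = 0" if x: "x \<notin> ?T" for x
  proof (rule DERIV_imp_deriv)
    have der: "((\<lambda>x. 0) has_real_derivative 0) (at x)" by simp
    show "(\<phi> has_real_derivative 0) (at x)"
    proof (rule has_field_derivative_transform_within_open[OF der])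
      show "open (- ?T)" by (intro open_Compl closed_closure)
      show "x \<in> - ?T" using x by simp
      show "0 = \<phi> y" if "y \<in> - ?T" for y using *[of y] that by (metis ComplD)
    qed
  qed
qed

lemma integral_AE_cong:
  assumes "AE x in lebesgue_on S. u x = u' x" "T \<subseteq> S" "S \<in> sets lebesgue"
  shows "integral T (\<lambda>x. \<phi> x *\<^sub>R u x) = integral T (\<lambda>x. \<phi> x *\<^sub>R u' x :: complex)"
  using assms by (intro integral_spike[of "{x\<in>S. u x \<noteq> u' x}"]) (auto simp: AE_lebesgue_on_iff)

lemma locally_integrable_cong_AE:
  assumes "AE x in lebesgue_on S. u x = u' x" "S \<in> sets lebesgue" "locally_integrable S u"
  shows "locally_integrable S u'"
proof (rule locally_integrableI)
  fix T assume T: "compact T" "T \<subseteq> S"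
  show "u' absolutely_integrable_on T"
    by (rule absolutely_integrable_spike[OF locally_integrableD[OF assms(3) T], of "{x\<in>S. u x \<noteq> u' x}"])
       (use assms T in \<open>auto simp: AE_lebesgue_on_iff\<close>)
qed

text \<open>Since \<open>weak_deriv\<close> selects an arbitrary representative, all later statements about it are
obtained by computing with a convenient representative and transferring the result with this lemma.\<close>

lemma has_weak_deriv_cong_AE:
  assumes u: "AE x in lebesgue_on S. u x = u' x" and v: "AE x in lebesgue_on S. v x = v' x"
    and S: "S \<in> sets lebesgue" and wd: "has_weak_deriv S u v"
  shows "has_weak_deriv S u' v'"
proof -
  have li: "locally_integrable S u" "locally_integrable S v" using wd by (auto simp: has_weak_deriv_def)
  have li': "locally_integrable S u'" "locally_integrable S v'"
    using locally_integrable_cong_AE u v S li by blast+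
  have "(LINT x|lebesgue_on S. deriv \<phi> x *\<^sub>R u' x) = - (LINT x|lebesgue_on S. \<phi> x *\<^sub>R v' x)" if t: "test_function S \<phi>" for \<phi>
  proof -
    obtain T where T: "compact T" "T \<subseteq> S" "\<And>x. x \<notin> T \<Longrightarrow> \<phi> x = 0" "\<And>x. x \<notin> T \<Longrightarrow> deriv \<phi> x = 0"
      by (rule test_function_support[OF t]) (rule that)
    have c: "continuous_on T \<phi>" "continuous_on T (deriv \<phi>)"
      using test_function_smooth[OF t] smooth_fun_continuous smooth_fun_deriv(2) by blast+
    note L = LINT_compact_support(2)[OF c(1) T(3) T(1,2) S locally_integrableD[OF _ T(1,2)]]
      LINT_compact_support(2)[OF c(2) T(4) T(1,2) S locally_integrableD[OF _ T(1,2)]]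
    have "(LINT x|lebesgue_on S. deriv \<phi> x *\<^sub>R u x) = - (LINT x|lebesgue_on S. \<phi> x *\<^sub>R v x)"
      using wd t by (auto simp: has_weak_deriv_def)
    then show ?thesis using L li li' integral_AE_cong[OF u T(2) S] integral_AE_cong[OF v T(2) S] by simp
  qed
  then show ?thesis using li' by (simp add: has_weak_deriv_def)
qed

lemma has_weak_deriv_unique:
  assumes S: "open S" and v: "has_weak_deriv S u v" and v': "has_weak_deriv S u v'"
  shows "AE x in lebesgue_on S. v x = v' x"
proof -
  have Sl: "S \<in> sets lebesgue" using S by (simp add: lborelD borel_open)
  have li: "locally_integrable S v" "locally_integrable S v'" using v v' by (auto simp: has_weak_deriv_def)
  have "AE x in lebesgue_on S. v x - v' x = 0"
  proof (rule AE_zero_of_bumps[OF S])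
    show "locally_integrable S (\<lambda>x. v x - v' x)"
      by (rule locally_integrable_diff[OF li])
    fix c d :: real and n assume cd: "c < d" "{c..d} \<subseteq> S"
    have z: "bump c d n t = 0" if "t \<notin> {c..d}" for t using that by (intro bump_eq_0) auto
    note L = LINT_compact_support[OF smooth_fun_continuous[OF smooth_fun_bump] z compact_Icc cd(2) Sl]
    have a: "v absolutely_integrable_on {c..d}" "v' absolutely_integrable_on {c..d}"
      using li cd by (auto intro: locally_integrableD)
    have "(LINT x|lebesgue_on S. bump c d n x *\<^sub>R v x) = (LINT x|lebesgue_on S. bump c d n x *\<^sub>R v' x)"
    proof -
      have "(LINT x|lebesgue_on S. deriv (bump c d n) x *\<^sub>R u x) = - (LINT x|lebesgue_on S. bump c d n x *\<^sub>R v x)"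
        using v test_function_bump[OF cd(2), of n] by (simp add: has_weak_deriv_def)
      moreover have "(LINT x|lebesgue_on S. deriv (bump c d n) x *\<^sub>R u x) = - (LINT x|lebesgue_on S. bump c d n x *\<^sub>R v' x)"
        using v' test_function_bump[OF cd(2), of n] by (simp add: has_weak_deriv_def)
      ultimately show ?thesis by (metis minus_minus)
    qed
    then have "integral {c..d} (\<lambda>x. bump c d n x *\<^sub>R v x) = integral {c..d} (\<lambda>x. bump c d n x *\<^sub>R v' x)"
      using L(2) a by simp
    moreover have "(\<lambda>x. bump c d n x *\<^sub>R v x) integrable_on {c..d}" "(\<lambda>x. bump c d n x *\<^sub>R v' x) integrable_on {c..d}"
      using L(1) a absolutely_integrable_on_def by blast+
    ultimately have "integral {c..d} (\<lambda>x. bump c d n x *\<^sub>R (v x - v' x)) = 0"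
      by (simp add: scaleR_diff_right integral_diff)
    then show "(LINT x|lebesgue_on S. bump c d n x *\<^sub>R (v x - v' x)) = 0"
      using L(2)[of "\<lambda>x. v x - v' x"] a by simp
  qed
  then show ?thesis by simp
qed

lemma weak_deriv_AE_eq:
  assumes "open S" "has_weak_deriv S u v"
  shows "AE x in lebesgue_on S. weak_deriv S u x = v x"
proof -
  have "has_weak_deriv S u (weak_deriv S u)"
    unfolding weak_deriv_def by (rule someI[of "\<lambda>v. has_weak_deriv S u v"]) (rule assms(2))
  then show ?thesis by (rule has_weak_deriv_unique[OF assms(1) _ assms(2)])
qed

lemma primitive_imp_locally_integrable:
  assumes "primitive_on UNIV f F"
  shows "locally_integrable S f" "locally_integrable S F"
proof -
  show "locally_integrable S f"
  proof (rule locally_integrableI)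
    fix T :: "real set" assume "compact T"
    then obtain c where "T \<subseteq> {-c..c}" by (metis bounded_subset_cbox_symmetric cbox_interval compact_imp_bounded)
    moreover have "f absolutely_integrable_on {-c..c}"
      using primitive_onD(1)[OF assms, of "-c" c] by (cases "-c \<le> c") auto
    ultimately show "f absolutely_integrable_on T"
      using \<open>compact T\<close> set_integrable_subset lmeasurable_compact by blast
  qed
  show "locally_integrable S F"
  proof (rule locally_integrableI)
    fix T :: "real set" assume "compact T"
    then obtain c where "T \<subseteq> {-c..c}" by (metis bounded_subset_cbox_symmetric cbox_interval compact_imp_bounded)
    moreover have "F absolutely_integrable_on {-c..c}"
      using primitive_on_continuous[OF assms] by (intro absolutely_integrable_continuous_real)
    ultimately show "F absolutely_integrable_on T"
      using \<open>compact T\<close> set_integrable_subset lmeasurable_compact by blast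
  qed
qed

lemma smooth_fun_primitive:
  assumes "smooth_fun \<phi>"
  shows "primitive_on I (\<lambda>x. of_real (deriv \<phi> x)) (\<lambda>x. of_real (\<phi> x))"
proof (rule primitive_onI_deriv)
  have *: "((\<lambda>x. of_real (\<phi> x)) has_vector_derivative (of_real (deriv \<phi> t) :: complex)) (at t)" for t
    using smooth_fun_deriv(1)[OF assms, of t]
    by (metis has_real_derivative_iff_has_vector_derivative has_vector_derivative_of_real)
  show "finite {t \<in> {x..y}. \<not> ((\<lambda>x. of_real (\<phi> x)) has_vector_derivative (of_real (deriv \<phi> t) :: complex)) (at t)}" for x y
    using * by simp
  show "continuous_on {x..y} (\<lambda>x. of_real (\<phi> x) :: complex)" for x y
    using assms by (intro continuous_intros smooth_fun_continuous)
  show "(\<lambda>x. of_real (deriv \<phi> x) :: complex) absolutely_integrable_on {x..y}" for x y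
    using assms smooth_fun_deriv(2) by (intro absolutely_integrable_continuous_real continuous_intros smooth_fun_continuous) blast
qed

lemma primitive_imp_has_weak_deriv:
  assumes F: "primitive_on UNIV f F" and S: "S \<in> sets lebesgue"
  shows "has_weak_deriv S F f"
  unfolding has_weak_deriv_def
proof (intro conjI allI impI primitive_imp_locally_integrable[OF F])
  fix \<phi> assume t: "test_function S \<phi>"
  obtain T where T: "compact T" "T \<subseteq> S" "\<And>x. x \<notin> T \<Longrightarrow> \<phi> x = 0" "\<And>x. x \<notin> T \<Longrightarrow> deriv \<phi> x = 0"
    by (rule test_function_support[OF t]) (rule that)
  obtain c' where c': "T \<subseteq> {-c'..c'}" by (metis T(1) bounded_subset_cbox_symmetric cbox_interval compact_imp_bounded)
  define c where "c = \<bar>c'\<bar> + 1"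
  have c: "T \<subseteq> {-c..c}" "c \<notin> T" "-c \<notin> T" "-c \<le> c" using subsetD[OF c'] by (force simp: c_def)+
  have sm: "smooth_fun \<phi>" "smooth_fun (deriv \<phi>)" using test_function_smooth[OF t] smooth_fun_deriv by blast+
  have li: "f absolutely_integrable_on T" "F absolutely_integrable_on T"
    using primitive_imp_locally_integrable[OF F] locally_integrableD T by blast+
  have a: "(\<lambda>x. deriv \<phi> x *\<^sub>R F x) absolutely_integrable_on T" "(\<lambda>x. \<phi> x *\<^sub>R f x) absolutely_integrable_on T"
    by (rule LINT_compact_support[OF smooth_fun_continuous]; use sm T li S in blast)+
  have "(LINT x|lebesgue_on S. deriv \<phi> x *\<^sub>R F x) = integral T (\<lambda>x. deriv \<phi> x *\<^sub>R F x)"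
    by (rule LINT_compact_support[OF smooth_fun_continuous]; use sm T li S in blast)
  moreover have "(LINT x|lebesgue_on S. \<phi> x *\<^sub>R f x) = integral T (\<lambda>x. \<phi> x *\<^sub>R f x)"
    by (rule LINT_compact_support[OF smooth_fun_continuous]; use sm T li S in blast)
  moreover have "integral T (\<lambda>x. deriv \<phi> x *\<^sub>R F x) + integral T (\<lambda>x. \<phi> x *\<^sub>R f x)
     = integral T (\<lambda>x. deriv \<phi> x *\<^sub>R F x + \<phi> x *\<^sub>R f x)"
    using a absolutely_integrable_on_def by (intro integral_add[symmetric]) blast+
  moreover have "\<dots> = integral {-c..c} (\<lambda>x. if x \<in> T then deriv \<phi> x *\<^sub>R F x + \<phi> x *\<^sub>R f x else 0)"
    using c by (simp add: integral_restrict_Int Int_absorb2)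
  moreover have "\<dots> = integral {-c..c} (\<lambda>x. of_real (deriv \<phi> x) * F x + of_real (\<phi> x) * f x)"
    using T by (intro integral_cong) (auto simp: scaleR_conv_of_real)
  moreover have "\<dots> = of_real (\<phi> c) * F c - of_real (\<phi> (-c)) * F (-c)"
    using primitive_onD(2)[OF primitive_on_prod[OF is_interval_univ smooth_fun_primitive[OF sm(1)] F], of "-c" c] c by simp
  ultimately have "(LINT x|lebesgue_on S. deriv \<phi> x *\<^sub>R F x) + (LINT x|lebesgue_on S. \<phi> x *\<^sub>R f x) = 0"
    using T(3) c by simp
  then show "(LINT x|lebesgue_on S. deriv \<phi> x *\<^sub>R F x) = - (LINT x|lebesgue_on S. \<phi> x *\<^sub>R f x)"
    by (simp add: eq_neg_iff_add_eq_0)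
qed

lemma exists_primitive:
  assumes "locally_integrable UNIV v"
  shows "\<exists>V. primitive_on UNIV v V"
proof -
  have a: "v absolutely_integrable_on {x..y}" for x y
    using assms by (rule locally_integrableD) auto
  then have i: "v integrable_on {x..y}" for x y using absolutely_integrable_on_def by blast
  define V where "V x = (if 0 \<le> x then integral {0..x} v else - integral {x..0} v)" for x
  have "integral {x..y} v = V y - V x" if "x \<le> y" for x y
  proof -
    consider "0 \<le> x" | "x < 0" "0 \<le> y" | "y < 0" using that by linarith
    then show ?thesis
    proof cases
      case 1 then show ?thesis
        using that Henstock_Kurzweil_Integration.integral_combine[of 0 x y v] i by (auto simp: V_def algebra_simps)
    next
      case 2 then show ?thesis
        using that Henstock_Kurzweil_Integration.integral_combine[of x 0 y v] i by (auto simp: V_def algebra_simps)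
    next
      case 3 then show ?thesis
        using that Henstock_Kurzweil_Integration.integral_combine[of x y 0 v] i by (auto simp: V_def algebra_simps)
    qed
  qed
  then show ?thesis using a unfolding primitive_on_def by blast
qed

text \<open>Mean zero is exactly what makes the primitive of a test function vanish on both sides of the
support again. Integrating from \<open>c - 1\<close> instead of \<open>c\<close> keeps the left end of the support in the interior.\<close>

lemma smooth_fun_zero_integral_antideriv:
  assumes sm: "smooth_fun \<eta>" and 0: "\<And>x. x \<notin> {c..d} \<Longrightarrow> \<eta> x = 0" and int: "integral {c..d} \<eta> = 0" and cd: "c \<le> d"
  obtains \<psi> where "smooth_fun \<psi>" "\<And>x. (\<psi> has_real_derivative \<eta> x) (at x)" "\<And>x. x \<notin> {c..d} \<Longrightarrow> \<psi> x = 0"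
proof -
  define \<psi> where "\<psi> x = integral {c-1..x} \<eta>" for x
  have con: "continuous_on A \<eta>" for A using sm smooth_fun_continuous by blast
  have int_on: "\<eta> integrable_on {x..y}" for x y by (intro integrable_continuous_real con)
  have zero: "\<psi> x = 0" if "x \<notin> {c..d}" for x
  proof -
    consider "x < c" | "x > d" using \<open>x \<notin> {c..d}\<close> by force
    then show ?thesis
    proof cases
      case 1
      have "integral {c-1..x} \<eta> = integral {c-1..x} (\<lambda>_. 0)"
        by (rule integral_cong) (use 0 1 in auto)
      then show ?thesis by (simp add: \<psi>_def)
    next
      case 2
      have "\<psi> x = integral {c-1..c} \<eta> + integral {c..x} \<eta>"
        using 2 cd Henstock_Kurzweil_Integration.integral_combine[of "c-1" c x \<eta>] int_on by (simp add: \<psi>_def)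
      also have "integral {c-1..c} \<eta> = integral {c-1..c} (\<lambda>_. 0)"
        by (rule integral_spike[of "{c}"]) (use 0 in auto)
      also have "integral {c..x} \<eta> = integral {c..d} \<eta> + integral {d..x} \<eta>"
        using 2 cd Henstock_Kurzweil_Integration.integral_combine[of c d x \<eta>] int_on by simp
      also have "integral {d..x} \<eta> = integral {d..x} (\<lambda>_. 0)"
        by (rule integral_spike[of "{d}"]) (use 0 in auto)
      finally show ?thesis using int by simp
    qed
  qed
  have der: "(\<psi> has_real_derivative \<eta> x) (at x)" for x
  proof (cases "x < c")
    case True
    have "((\<lambda>x. 0) has_real_derivative \<eta> x) (at x)" using 0[of x] True by simp
    then show ?thesis
      by (rule has_field_derivative_transform_within_open[of _ _ _ "{..<c}"]) (use True zero in auto)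
  next
    case False
    have "(\<psi> has_real_derivative \<eta> x) (at x within {c-1..x+1})"
      unfolding \<psi>_def by (rule integral_has_real_derivative[OF con]) (use False in auto)
    then show ?thesis using False by (simp add: at_within_Icc_at)
  qed
  show ?thesis using that[OF smooth_fun_antideriv[OF sm der] der zero] .
qed

text \<open>The lemma of du Bois-Reymond. A bump minus a suitable multiple of one fixed bump has mean zero and
is therefore the derivative of a test function. So the pairing of \<open>u\<close> with a bump is a fixed constant \<open>k\<close>
times the integral of that bump, and \<open>u - k\<close> is orthogonal to all bumps.\<close>

lemma weak_deriv_zero_imp_const:
  assumes "has_weak_deriv UNIV u (\<lambda>_. 0)"
  shows "\<exists>k. AE x in lebesgue. u x = k"
proof -
  have u: "locally_integrable UNIV u" using assms by (simp add: has_weak_deriv_def)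
  have ui: "u absolutely_integrable_on {x..y}" for x y
    using u by (rule locally_integrableD) auto
  define B where "B c d n = integral {c..d} (bump c d n)" for c d :: real and n
  have z: "bump c d n t = 0" if "t \<notin> {c..d}" for c d n t using that by (intro bump_eq_0) auto
  have bc: "continuous_on A (bump c d n)" for A c d n by (rule smooth_fun_continuous[OF smooth_fun_bump])
  have bi: "bump c d n integrable_on {x..y}" for c d n x y by (intro integrable_continuous_real bc)
  have bui: "(\<lambda>x. bump c d n x *\<^sub>R u x) absolutely_integrable_on {c..d}" for c d n
    using LINT_compact_support(1)[OF bc z compact_Icc subset_UNIV _ ui] by auto
  have ext: "integral {x..y} (bump c d n) = B c d n"
     "integral {x..y} (\<lambda>t. bump c d n t *\<^sub>R u t) = integral {c..d} (\<lambda>t. bump c d n t *\<^sub>R u t)"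
     "(\<lambda>t. bump c d n t *\<^sub>R u t) integrable_on {x..y}" if "x \<le> c" "d \<le> y" for x y c d n
  proof -
    have s: "{c..d} \<subseteq> {x..y}" using that by auto
    have "(\<lambda>t. if t \<in> {c..d} then bump c d n t else 0) = bump c d n" using z by auto
    then show "integral {x..y} (bump c d n) = B c d n"
      using integral_restrict_Int[where T="{x..y}" and f="bump c d n" and S="{c..d}"] unfolding B_def Int_absorb2[OF s] by simp
    have e: "(\<lambda>t. if t \<in> {c..d} then bump c d n t *\<^sub>R u t else 0) = (\<lambda>t. bump c d n t *\<^sub>R u t)" using z by auto
    then show "integral {x..y} (\<lambda>t. bump c d n t *\<^sub>R u t) = integral {c..d} (\<lambda>t. bump c d n t *\<^sub>R u t)"
      using integral_restrict_Int[where T="{x..y}" and f="\<lambda>t. bump c d n t *\<^sub>R u t" and S="{c..d}"] unfolding Int_absorb2[OF s] by simp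
    show "(\<lambda>t. bump c d n t *\<^sub>R u t) integrable_on {x..y}"
      using integrable_restrict_Int[of "{c..d}" "\<lambda>t. bump c d n t *\<^sub>R u t" "{x..y}"] bui[of c d n]
      unfolding Int_absorb2[OF s] e absolutely_integrable_on_def by blast
  qed
  define B1 where "B1 = B 0 1 0"
  have B1: "B1 > 0"
  proof -
    have "B1 \<noteq> 0"
    proof
      assume "B1 = 0"
      then have "bump 0 1 0 (1/2) = 0"
        using integral_eq_0_iff[of 0 1 "bump 0 1 0"] bc bump_bounds(1) by (auto simp: B1_def B_def)
      then show False using bump_pos[of "1/2" 0 1 0] by simp
    qed
    moreover have "B1 \<ge> 0" unfolding B1_def B_def using bi bump_bounds(1) by (intro integral_nonneg) auto
    ultimately show ?thesis by simp
  qed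
  define k where "k = integral {0..1} (\<lambda>t. bump 0 1 0 t *\<^sub>R u t) / of_real B1"
  have key: "integral {c..d} (\<lambda>t. bump c d n t *\<^sub>R u t) = B c d n *\<^sub>R k" if cd: "c < d" for c d n
  proof -
    define x y where "x = min 0 c" and "y = max 1 d"
    have xy: "x \<le> 0" "x \<le> c" "1 \<le> y" "d \<le> y" "x \<le> y" by (auto simp: x_def y_def)
    \<comment> \<open>The coefficient makes the integral vanish.\<close>
    define \<eta> where "\<eta> t = 1 * bump c d n t + (- (B c d n / B1)) * bump 0 1 0 t" for t
    have sm: "smooth_fun \<eta>" unfolding \<eta>_def by (intro smooth_fun_linear smooth_fun_bump)
    have 0: "\<eta> t = 0" if "t \<notin> {x..y}" for t
    proof -
      have "t \<notin> {c..d}" "t \<notin> {0..1}" using that xy by auto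
      then show ?thesis by (simp add: \<eta>_def z)
    qed
    have "integral {x..y} \<eta> = integral {x..y} (\<lambda>t. 1 * bump c d n t) + integral {x..y} (\<lambda>t. (- (B c d n / B1)) * bump 0 1 0 t)"
      unfolding \<eta>_def by (intro integral_add integrable_on_mult_right bi)
    also have "\<dots> = integral {x..y} (bump c d n) + (- (B c d n / B1)) * integral {x..y} (bump 0 1 0)"
      by (simp only: integral_mult_right mult_1)
    also have "\<dots> = 0" using ext(1)[of x c d y n] ext(1)[of x 0 1 y 0] xy B1 by (simp add: B1_def)
    finally obtain \<psi> where \<psi>: "smooth_fun \<psi>" "\<And>t. (\<psi> has_real_derivative \<eta> t) (at t)" "\<And>t. t \<notin> {x..y} \<Longrightarrow> \<psi> t = 0"
      using smooth_fun_zero_integral_antideriv[OF sm 0 _ xy(5)] by blast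
    have "test_function UNIV \<psi>" by (rule test_functionI[OF \<psi>(1,3)]) auto
    then have "(LINT t|lebesgue_on UNIV. deriv \<psi> t *\<^sub>R u t) = 0"
      using assms by (simp add: has_weak_deriv_def)
    moreover have "deriv \<psi> = \<eta>" using \<psi>(2) DERIV_imp_deriv by blast
    ultimately have "(LINT t|lebesgue_on UNIV. \<eta> t *\<^sub>R u t) = 0" by (simp only:)
    then have "integral {x..y} (\<lambda>t. \<eta> t *\<^sub>R u t) = 0"
      using LINT_compact_support(2)[OF smooth_fun_continuous[OF sm] 0 compact_Icc subset_UNIV _ ui] by simp
    also have "(\<lambda>t. \<eta> t *\<^sub>R u t) = (\<lambda>t. bump c d n t *\<^sub>R u t + (- (B c d n / B1)) *\<^sub>R (bump 0 1 0 t *\<^sub>R u t))"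
      by (simp add: \<eta>_def algebra_simps)
    also have "integral {x..y} \<dots> = integral {x..y} (\<lambda>t. bump c d n t *\<^sub>R u t) + (- (B c d n / B1)) *\<^sub>R integral {x..y} (\<lambda>t. bump 0 1 0 t *\<^sub>R u t)"
    proof -
      have i: "(\<lambda>t. bump c d n t *\<^sub>R u t) integrable_on {x..y}" "(\<lambda>t. bump 0 1 0 t *\<^sub>R u t) integrable_on {x..y}"
        using ext(3)[of x c d y n] ext(3)[of x 0 1 y 0] xy by auto
      show ?thesis
        unfolding integral_add[OF i(1) integrable_cmul[OF i(2)]] integral_cmul by simp
    qed
    finally show ?thesis
      using ext(2)[of x c d y n] ext(2)[of x 0 1 y 0] xy B1
      by (simp add: k_def scaleR_conv_of_real field_simps)
  qed
  have "AE x in lebesgue_on UNIV. u x - k = 0"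
  proof (rule AE_zero_of_bumps)
    show "locally_integrable UNIV (\<lambda>x. u x - k)"
      by (intro locally_integrable_diff u locally_integrableI absolutely_integrable_on_const lmeasurable_compact)
    fix c d :: real and n assume cd: "c < d"
    have "integral {c..d} (\<lambda>t. bump c d n t *\<^sub>R (u t - k)) = integral {c..d} (\<lambda>t. bump c d n t *\<^sub>R u t) - integral {c..d} (\<lambda>t. bump c d n t *\<^sub>R k)"
      unfolding scaleR_diff_right using ext(3)[of c c d d n] bi[of c d n c d]
      by (intro integral_diff) (auto intro!: integrable_on_scaleR_left)
    also have "integral {c..d} (\<lambda>t. bump c d n t *\<^sub>R k) = B c d n *\<^sub>R k"
      unfolding B_def by (rule integral_unique[OF has_integral_scaleR_left[OF integrable_integral[OF bi]]])
    finally have "integral {c..d} (\<lambda>t. bump c d n t *\<^sub>R (u t - k)) = 0" using key[OF cd, of n] by simp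
    then show "(LINT x|lebesgue_on UNIV. bump c d n x *\<^sub>R (u x - k)) = 0"
    proof (subst LINT_compact_support(2)[OF bc, of "{c..d}" c d n UNIV])
      show "bump c d n t = 0" if "t \<notin> {c..d}" for t using z that .
      show "(\<lambda>x. u x - k) absolutely_integrable_on {c..d}"
        by (intro set_integral_diff(1) ui absolutely_integrable_continuous_real continuous_on_const)
    qed auto
  qed auto
  then have "AE x in lebesgue. u x = k" unfolding lebesgue_on_UNIV_eq by simp
  then show ?thesis by blast
qed

text \<open>A primitive \<open>V\<close> of \<open>v\<close> has the weak derivative \<open>v\<close>, by integration by parts; hence \<open>u - V\<close> is
constant almost everywhere.\<close>

lemma has_weak_deriv_imp_primitive:
  assumes "has_weak_deriv UNIV u v"
  shows "\<exists>U. primitive_on UNIV v U \<and> (AE x in lebesgue. u x = U x)"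
proof -
  have li: "locally_integrable UNIV u" "locally_integrable UNIV v"
    using assms by (auto simp: has_weak_deriv_def)
  obtain V where V: "primitive_on UNIV v V" using exists_primitive[OF li(2)] by blast
  have wV: "has_weak_deriv UNIV V v" using primitive_imp_has_weak_deriv[OF V] by simp
  have lV: "locally_integrable UNIV V" using wV by (simp add: has_weak_deriv_def)
  have "has_weak_deriv UNIV (\<lambda>x. u x - V x) (\<lambda>_. 0)"
    unfolding has_weak_deriv_def
  proof (intro conjI allI impI)
    show "locally_integrable UNIV (\<lambda>x. u x - V x)"
      by (rule locally_integrable_diff[OF li(1) lV])
    show "locally_integrable UNIV (\<lambda>_. 0)" by (rule locally_integrableI) simp
    fix \<phi> assume t: "test_function UNIV \<phi>"
    obtain T where T: "compact T" "T \<subseteq> UNIV" "\<And>x. x \<notin> T \<Longrightarrow> \<phi> x = 0" "\<And>x. x \<notin> T \<Longrightarrow> deriv \<phi> x = 0"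
      by (rule test_function_support[OF t]) (rule that)
    have c: "continuous_on T (deriv \<phi>)"
      using test_function_smooth[OF t] smooth_fun_continuous smooth_fun_deriv(2) by blast
    note L = LINT_compact_support[OF c _ T(1) subset_UNIV _ locally_integrableD[OF _ T(1) subset_UNIV]]
    have LU: "(LINT x|lebesgue_on UNIV. deriv \<phi> x *\<^sub>R w x) = integral T (\<lambda>x. deriv \<phi> x *\<^sub>R w x)"
       "(\<lambda>x. deriv \<phi> x *\<^sub>R w x) integrable_on T" if "locally_integrable UNIV w" for w
      using L[OF T(4) _ that] absolutely_integrable_on_def by auto
    have "(LINT x|lebesgue_on UNIV. deriv \<phi> x *\<^sub>R u x) = (LINT x|lebesgue_on UNIV. deriv \<phi> x *\<^sub>R V x)"
      using assms wV t by (simp add: has_weak_deriv_def)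
    then have "integral T (\<lambda>x. deriv \<phi> x *\<^sub>R (u x - V x)) = 0"
      using LU(1)[OF li(1)] LU(1)[OF lV] integral_diff[OF LU(2)[OF li(1)] LU(2)[OF lV]]
      by (simp add: scaleR_diff_right)
    moreover have "locally_integrable UNIV (\<lambda>x. u x - V x)"
      by (rule locally_integrable_diff[OF li(1) lV])
    ultimately show "(LINT x|lebesgue_on UNIV. deriv \<phi> x *\<^sub>R (u x - V x)) = - (LINT x|lebesgue_on UNIV. \<phi> x *\<^sub>R 0)"
      using LU(1) by simp
  qed
  then obtain k where k: "AE x in lebesgue. u x - V x = k" using weak_deriv_zero_imp_const by blast
  have "primitive_on UNIV v (\<lambda>x. V x + k)"
    using V unfolding primitive_on_def by auto
  moreover have "AE x in lebesgue. u x = V x + k" using k by eventually_elim (simp add: algebra_simps)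
  ultimately show ?thesis by blast
qed

section \<open>Piecewise continuous functions\<close>

text \<open>One-sided limits bound the function near every point, and Bolzano's bisection principle turns
this into a bound on the compact interval.\<close>

lemma piecewise_cont_bounded_Icc:
  assumes "piecewise_cont f"
  shows "\<exists>B. \<forall>x\<in>{a..b}. \<bar>f x :: real\<bar> \<le> B"
proof (cases "a \<le> b")
  case True
  then show ?thesis
  proof (induction rule: Bolzano)
    case (trans a b c)
    then obtain B B' where "\<forall>x\<in>{a..b}. \<bar>f x\<bar> \<le> B" "\<forall>x\<in>{b..c}. \<bar>f x\<bar> \<le> B'" by blast
    then have "\<forall>x\<in>{a..c}. \<bar>f x\<bar> \<le> max B B'"
      by (metis atLeastAtMost_iff le_max_iff_disj linorder_linear)
    then show ?case by blast
  next
    case (local x)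
    obtain l r where l: "(f \<longlongrightarrow> l) (at_left x)" and r: "(f \<longlongrightarrow> r) (at_right x)"
      using assms unfolding piecewise_cont_def by blast
    have "\<forall>\<^sub>F y in at_left x. \<bar>f y\<bar> < \<bar>l\<bar> + 1" by (rule order_tendstoD(2)[OF tendsto_rabs[OF l]]) simp
    then obtain d1 where d1: "d1 < x" "\<And>y. d1 < y \<Longrightarrow> y < x \<Longrightarrow> \<bar>f y\<bar> < \<bar>l\<bar> + 1"
      unfolding eventually_at_left_field by blast
    have "\<forall>\<^sub>F y in at_right x. \<bar>f y\<bar> < \<bar>r\<bar> + 1" by (rule order_tendstoD(2)[OF tendsto_rabs[OF r]]) simp
    then obtain d2 where d2: "d2 > x" "\<And>y. x < y \<Longrightarrow> y < d2 \<Longrightarrow> \<bar>f y\<bar> < \<bar>r\<bar> + 1"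
      unfolding eventually_at_right_field by blast
    let ?B = "max \<bar>f x\<bar> (max (\<bar>l\<bar> + 1) (\<bar>r\<bar> + 1))"
    have B: "\<bar>f y\<bar> \<le> ?B" if "d1 < y" "y < d2" for y
      using d1(2)[of y] d2(2)[of y] that by (cases y x rule: linorder_cases) (auto simp: le_max_iff_disj)
    show ?case
    proof (rule exI[of _ "min (x - d1) (d2 - x)"], intro conjI allI impI)
      show "min (x - d1) (d2 - x) > 0" using d1 d2 by simp
      fix a b assume "a \<le> x \<and> x \<le> b \<and> b - a < min (x - d1) (d2 - x)"
      then have "\<forall>y\<in>{a..b}. \<bar>f y\<bar> \<le> ?B" using B by auto
      then show "\<exists>B. \<forall>y\<in>{a..b}. \<bar>f y\<bar> \<le> B" by blast
    qed
  qed
qed auto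

lemma countable_if_finite_Icc:
  fixes P :: "real \<Rightarrow> bool"
  assumes "\<And>a b. finite {x\<in>{a..b}. P x}"
  shows "countable {x. P x}"
proof -
  have "{x. P x} = (\<Union>n. {x\<in>{-real n..real n}. P x})"
  proof (intro set_eqI iffI)
    fix x assume "x \<in> {x. P x}"
    moreover obtain n where "\<bar>x\<bar> \<le> real n" using real_arch_simple by blast
    ultimately show "x \<in> (\<Union>n. {x\<in>{-real n..real n}. P x})" by (auto simp: abs_le_iff intro!: exI[of _ n])
  qed auto
  moreover have "countable (\<Union>n. {x\<in>{-real n..real n}. P x})"
    by (rule countable_UN[OF _ countable_finite[OF assms]]) simp
  ultimately show ?thesis by simp
qed

lemma piecewise_cont_borel_measurable:
  assumes "piecewise_cont f"
  shows "f \<in> borel_measurable borel"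
proof (rule borel_measurable_continuous_countable_exceptions)
  show "countable {x. \<not> isCont f x}"
    using assms unfolding piecewise_cont_def by (intro countable_if_finite_Icc) blast
  show "continuous_on (- {x. \<not> isCont f x}) f"
    by (intro continuous_at_imp_continuous_on) auto
qed

lemma one_periodic_int:
  assumes "one_periodic f"
  shows "f (x + of_int k) = f x"
proof (induction k rule: int_induct[of _ 0])
  case (step1 i)
  then show ?case using assms unfolding one_periodic_def by (metis add.assoc of_int_1 of_int_add)
next
  case (step2 i)
  have "f (x + of_int (i - 1) + 1) = f (x + of_int (i - 1))" using assms unfolding one_periodic_def by blast
  then show ?case using step2 by simp
qed simp

lemma one_periodic_bounded:
  assumes "one_periodic f" "\<And>x. x \<in> {0..1} \<Longrightarrow> \<bar>f x\<bar> \<le> B"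
  shows "\<bar>f x\<bar> \<le> B"
proof -
  have "f x = f (frac x)" using one_periodic_int[OF assms(1), of "frac x" "\<lfloor>x\<rfloor>"] by (simp add: frac_def)
  moreover have "frac x \<in> {0..1}" using frac_lt_1[of x] frac_ge_0[of x] by (simp add: less_imp_le)
  ultimately show ?thesis using assms(2) by simp
qed

section \<open>The first-order system\<close>

locale periodic_coefficients =
  fixes p q :: "real \<Rightarrow> real" and p\<^sub>0 :: real
  assumes p_periodic: "one_periodic p" and q_periodic: "one_periodic q"
    and p_C1: "piecewise_C1 p" and q_cont: "piecewise_cont q"
    and p0_pos: "p\<^sub>0 > 0" and p_ge: "\<And>x. p x \<ge> p\<^sub>0"
begin

lemma p_continuous: "continuous_on A p"
  using p_C1 continuous_on_subset unfolding piecewise_C1_def by blast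

lemma p_pos: "p x > 0" using p_ge[of x] p0_pos by linarith

lemma q_measurable: "q \<in> borel_measurable borel"
  using q_cont by (rule piecewise_cont_borel_measurable)

definition q_bound :: real where "q_bound = (SOME B. \<forall>x. \<bar>q x\<bar> \<le> B)"

lemma q_le_bound: "\<bar>q x\<bar> \<le> q_bound"
proof -
  obtain B where "\<forall>x\<in>{0..1}. \<bar>q x\<bar> \<le> B" using piecewise_cont_bounded_Icc[OF q_cont] by blast
  then have "\<forall>x. \<bar>q x\<bar> \<le> B" using one_periodic_bounded[OF q_periodic] by blast
  then have "\<forall>x. \<bar>q x\<bar> \<le> q_bound" unfolding q_bound_def by (rule someI)
  then show ?thesis by blast
qed

lemma q_bound_nonneg: "q_bound \<ge> 0" using q_le_bound[of 0] by linarith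

lemma p_bounded: "\<exists>B>0. \<forall>x. p x \<le> B"
proof -
  obtain B where "\<forall>x\<in>{0..1}. \<bar>p x\<bar> \<le> B"
    using compact_imp_bounded[OF compact_continuous_image[OF p_continuous compact_Icc]]
    unfolding bounded_iff by (metis imageI real_norm_def)
  then have "\<forall>x. \<bar>p x\<bar> \<le> B" using one_periodic_bounded[OF p_periodic] by blast
  then show ?thesis using p_pos by (intro exI[of _ B]) (metis abs_of_pos order.strict_trans1 order_less_le_trans)
qed

text \<open>The equation \<open>- (p u')' + q u - z u = g\<close> as a first-order system for \<open>U = u\<close> and the quasi-derivative
\<open>W = p u'\<close>, which is absolutely continuous even where \<open>p\<close> has corners.\<close>

definition solves :: "complex \<Rightarrow> real set \<Rightarrow> (real \<Rightarrow> complex) \<Rightarrow> (real \<Rightarrow> complex) \<Rightarrow> (real \<Rightarrow> complex) \<Rightarrow> bool" where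
  "solves z I g U W \<longleftrightarrow> primitive_on I (\<lambda>x. W x / of_real (p x)) U \<and>
     primitive_on I (\<lambda>x. (of_real (q x) - z) * U x - g x) W"

lemma solves_subset: "solves z I g U W \<Longrightarrow> J \<subseteq> I \<Longrightarrow> solves z J g U W"
  unfolding solves_def using primitive_on_subset by blast

lemma solves_add:
  assumes "solves z I g U W" "solves z I g' U' W'"
  shows "solves z I (\<lambda>x. g x + g' x) (\<lambda>x. U x + U' x) (\<lambda>x. W x + W' x)"
  using assms primitive_on_add[of I _ U _ U'] primitive_on_add[of I _ W _ W']
  unfolding solves_def by (fastforce simp: algebra_simps add_divide_distrib)

lemma solves_mult:
  assumes "solves z I g U W"
  shows "solves z I (\<lambda>x. c * g x) (\<lambda>x. c * U x) (\<lambda>x. c * W x)"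
  using assms primitive_on_mult[of I _ U c] primitive_on_mult[of I _ W c]
  unfolding solves_def by (fastforce simp: algebra_simps)

lemma solves_diff:
  assumes "solves z I g U W" "solves z I g' U' W'"
  shows "solves z I (\<lambda>x. g x - g' x) (\<lambda>x. U x - U' x) (\<lambda>x. W x - W' x)"
  using solves_add[OF assms(1) solves_mult[OF assms(2), of "-1"]] by simp

lemma solves_shift:
  assumes "solves z {s + of_int k..t + of_int k} g U W"
  shows "solves z {s..t} (\<lambda>x. g (x + of_int k)) (\<lambda>x. U (x + of_int k)) (\<lambda>x. W (x + of_int k))"
  using assms primitive_on_shift[of "{s + of_int k..t + of_int k}" _ U "{s..t}" "of_int k"]
    primitive_on_shift[of "{s + of_int k..t + of_int k}" _ W "{s..t}" "of_int k"]
  unfolding solves_def by (fastforce simp: one_periodic_int[OF p_periodic] one_periodic_int[OF q_periodic])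

lemma solves_continuous:
  assumes "solves z {s..t} g U W"
  shows "continuous_on {s..t} U" "continuous_on {s..t} W"
  using assms primitive_on_continuous_Icc unfolding solves_def by blast+

lemma coefficient_integrable:
  fixes U :: "real \<Rightarrow> complex"
  assumes "continuous_on {s..t} U"
  shows "(\<lambda>x. (of_real (q x) - z) * U x) absolutely_integrable_on {s..t}"
proof -
  have m: "(\<lambda>x. of_real (q x) - z) \<in> borel_measurable (lebesgue_on {s..t})"
  proof (intro measurable_restrict_space1 measurable_completion)
    have "(\<lambda>x. of_real (q x) - z) \<in> borel_measurable borel"
      by (rule measurable_compose[OF q_measurable]) (intro borel_measurable_continuous_onI continuous_intros)
    then show "(\<lambda>x. of_real (q x) - z) \<in> borel_measurable lborel" by simp
  qed
  have "bounded ((\<lambda>x. of_real (q x) - z) ` {s..t})"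
  proof (rule boundedI)
    fix y assume "y \<in> (\<lambda>x. of_real (q x) - z) ` {s..t}"
    then obtain x where "y = of_real (q x) - z" by blast
    then show "norm y \<le> q_bound + norm z"
      using norm_triangle_ineq4[of "of_real (q x)" z] q_le_bound[of x] by simp
  qed
  then show ?thesis
    using m absolutely_integrable_continuous_real[OF assms]
    by (intro absolutely_integrable_bounded_measurable_product[OF bilinear_times]) auto
qed

lemma inverse_p_integrable:
  fixes W :: "real \<Rightarrow> complex"
  assumes "continuous_on {s..t} W"
  shows "(\<lambda>x. W x / of_real (p x)) absolutely_integrable_on {s..t}"
  by (intro absolutely_integrable_continuous_real continuous_intros p_continuous assms)
     (use p_pos in \<open>simp add: less_imp_neq[symmetric]\<close>)

lemma solves_integrable:
  assumes "solves z {s..t} g U W"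
  shows "g absolutely_integrable_on {s..t}"
proof (cases "s \<le> t")
  case True
  have 1: "(\<lambda>x. (of_real (q x) - z) * U x) absolutely_integrable_on {s..t}"
    by (rule coefficient_integrable) (rule solves_continuous[OF assms])
  have 2: "(\<lambda>x. (of_real (q x) - z) * U x - g x) absolutely_integrable_on {s..t}"
    using assms True unfolding solves_def by (intro primitive_onD(1)[where x=s and y=t]) auto
  show ?thesis using set_integral_diff(1)[OF 1 2] by simp
qed auto

text \<open>A common bound for the coefficients \<open>1 / p\<close> and \<open>q - z\<close> of the system. It depends on \<open>z\<close> only
through \<open>\<bar>z\<bar>\<close>, which makes the estimates that use it uniform on bounded sets of \<open>z\<close>.\<close>

definition growth :: "complex \<Rightarrow> real" where
  "growth z = 1 / p\<^sub>0 + q_bound + norm z"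

lemma growth_pos: "growth z > 0"
  unfolding growth_def using p0_pos q_bound_nonneg by (intro add_pos_nonneg) auto

lemma norm_div_p_le: "norm (w / of_real (p x)) \<le> growth z * norm (w :: complex)"
proof -
  have "norm (w / of_real (p x)) = norm w * (1 / p x)" using p_pos[of x] by (simp add: norm_divide)
  also have "\<dots> \<le> norm w * growth z"
  proof (rule mult_left_mono)
    have "1 / p x \<le> 1 / p\<^sub>0" using p_ge[of x] p0_pos by (intro divide_left_mono) auto
    then show "1 / p x \<le> growth z" unfolding growth_def using q_bound_nonneg norm_ge_zero[of z] by linarith
  qed simp
  finally show ?thesis by (simp add: mult.commute)
qed

lemma norm_q_mult_le: "norm ((of_real (q x) - z) * u) \<le> growth z * norm u"
proof -
  have "norm (of_real (q x) - z) \<le> q_bound + norm z"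
    using norm_triangle_ineq4[of "of_real (q x)" z] q_le_bound[of x] by simp
  also have "\<dots> \<le> growth z" unfolding growth_def using p0_pos by simp
  finally show ?thesis by (simp add: norm_mult mult_right_mono)
qed

end

section \<open>Gronwall's inequality\<close>

text \<open>The right-hand side \<open>R\<close> of the integral inequality satisfies \<open>R' = K N \<le> K R\<close>, so that \<open>R x * exp (- K * x)\<close>
decreases.\<close>

lemma gronwall_integral:
  fixes N :: "real \<Rightarrow> real"
  assumes N: "continuous_on {s..t} N" and K: "0 \<le> K"
    and le: "\<And>x. x \<in> {s..t} \<Longrightarrow> N x \<le> A + K * integral {s..x} N" and x: "x \<in> {s..t}"
  shows "N x \<le> A * exp (K * (x - s))"
proof -
  define R where "R y = A + K * integral {s..y} N" for y
  have cR: "continuous_on {s..x} R"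
    unfolding R_def using N x
    by (intro continuous_intros indefinite_integral_continuous_1 integrable_continuous_real)
       (auto elim: continuous_on_subset)
  have "R x * exp (- K * (x - s)) \<le> R s * exp (- K * (s - s))"
  proof (rule DERIV_nonpos_imp_decreasing_open[of s x "\<lambda>y. R y * exp (- K * (y - s))"])
    show "continuous_on {s..x} (\<lambda>y. R y * exp (- K * (y - s)))"
      by (intro continuous_intros cR)
    fix y assume y: "s < y" "y < x"
    have "((\<lambda>y. integral {s..y} N) has_real_derivative N y) (at y within {s..t})"
      using N x y by (intro integral_has_real_derivative) auto
    then have "((\<lambda>y. integral {s..y} N) has_real_derivative N y) (at y)"
      using x y by (simp add: at_within_Icc_at)
    then have "((\<lambda>y. R y * exp (- K * (y - s))) has_real_derivative
        (K * N y) * exp (- K * (y - s)) + R y * (exp (- K * (y - s)) * (- K))) (at y)"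
      unfolding R_def by (auto intro!: derivative_eq_intros)
    moreover have "(K * N y) * exp (- K * (y - s)) + R y * (exp (- K * (y - s)) * (- K)) \<le> 0"
    proof -
      have "K * N y \<le> K * R y" using le[of y] x y K by (intro mult_left_mono) (auto simp: R_def)
      then have "(K * N y) * exp (- K * (y - s)) \<le> (K * R y) * exp (- K * (y - s))" by (intro mult_right_mono) auto
      then show ?thesis by (simp add: algebra_simps)
    qed
    ultimately show "\<exists>d. ((\<lambda>y. R y * exp (- K * (y - s))) has_real_derivative d) (at y) \<and> d \<le> 0" by blast
  qed (use x in auto)
  then have "R x * exp (- K * (x - s)) * exp (K * (x - s)) \<le> A * exp (K * (x - s))"
    by (intro mult_right_mono) (simp_all add: R_def)
  also have "R x * exp (- K * (x - s)) * exp (K * (x - s)) = R x * exp (- K * (x - s) + K * (x - s))"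
    by (simp only: exp_add mult.assoc)
  also have "\<dots> = R x" by simp
  finally show ?thesis using le[OF x] by (simp add: R_def)
qed

context periodic_coefficients
begin

text \<open>Continuous dependence on the data. This estimate is used with zero data for uniqueness, on single
periods for the recurrence, and on \<open>{s..b}\<close> for the absorption of the perturbation.\<close>

lemma solves_bound:
  assumes sol: "solves z {s..t} g U W" and x: "x \<in> {s..t}"
  shows "norm (U x) + norm (W x) \<le>
    (norm (U s) + norm (W s) + integral {s..t} (\<lambda>t. norm (g t))) * exp (growth z * (x - s))"
proof (rule gronwall_integral[where t=t and N="\<lambda>x. norm (U x) + norm (W x)"])
  note c = solves_continuous[OF sol]
  let ?N = "\<lambda>x. norm (U x) + norm (W x)"
  show cN: "continuous_on {s..t} ?N" by (intro continuous_intros c)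
  show "0 \<le> growth z" using growth_pos by (simp add: less_imp_le)
  fix y assume y: "y \<in> {s..t}"
  have sol': "solves z {s..y} g U W" using sol by (rule solves_subset) (use y in auto)
  note c' = solves_continuous[OF sol']
  have g: "(\<lambda>t. norm (g t)) integrable_on {s..y}" "(\<lambda>t. norm (g t)) integrable_on {s..t}"
    using solves_integrable[OF sol'] solves_integrable[OF sol] absolutely_integrable_on_def by blast+
  have Ui: "(\<lambda>x. growth z * norm (U x)) integrable_on {s..y}" and Wi: "(\<lambda>x. growth z * norm (W x)) integrable_on {s..y}"
    by (intro integrable_continuous_real continuous_intros c')+
  have "norm (U y - U s) \<le> integral {s..y} (\<lambda>x. norm (W x / of_real (p x)))"
    using sol y unfolding solves_def by (intro primitive_on_norm_diff_le[where I="{s..t}"]) auto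
  also have "\<dots> \<le> integral {s..y} (\<lambda>x. growth z * norm (W x))"
    using inverse_p_integrable[OF c'(2)] Wi norm_div_p_le
    by (intro integral_le) (auto simp: absolutely_integrable_on_def)
  finally have 1: "norm (U y) \<le> norm (U s) + integral {s..y} (\<lambda>x. growth z * norm (W x))"
    using norm_triangle_sub[of "U y" "U s"] by linarith
  have "norm (W y - W s) \<le> integral {s..y} (\<lambda>x. norm ((of_real (q x) - z) * U x - g x))"
    using sol y unfolding solves_def by (intro primitive_on_norm_diff_le[where I="{s..t}"]) auto
  also have "\<dots> \<le> integral {s..y} (\<lambda>x. growth z * norm (U x) + norm (g x))"
  proof (rule integral_le)
    show "(\<lambda>x. norm ((of_real (q x) - z) * U x - g x)) integrable_on {s..y}"
      using set_integral_diff(1)[OF coefficient_integrable[OF c'(1)] solves_integrable[OF sol']]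
      by (simp add: absolutely_integrable_on_def)
    show "(\<lambda>x. growth z * norm (U x) + norm (g x)) integrable_on {s..y}"
      by (intro integrable_add Ui g)
    show "norm ((of_real (q x) - z) * U x - g x) \<le> growth z * norm (U x) + norm (g x)" for x
      using norm_triangle_ineq4[of "(of_real (q x) - z) * U x" "g x"] norm_q_mult_le[of x z "U x"] by linarith
  qed
  also have "\<dots> = integral {s..y} (\<lambda>x. growth z * norm (U x)) + integral {s..y} (\<lambda>x. norm (g x))"
    by (intro integral_add Ui g)
  also have "integral {s..y} (\<lambda>x. norm (g x)) \<le> integral {s..t} (\<lambda>x. norm (g x))"
    using y by (intro integral_subset_le g) auto
  finally have 2: "norm (W y) \<le> norm (W s) + integral {s..y} (\<lambda>x. growth z * norm (U x)) + integral {s..t} (\<lambda>x. norm (g x))"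
    using norm_triangle_sub[of "W y" "W s"] by linarith
  have "integral {s..y} (\<lambda>x. growth z * norm (W x)) + integral {s..y} (\<lambda>x. growth z * norm (U x))
     = integral {s..y} (\<lambda>x. growth z * ?N x)"
    by (subst integral_add[symmetric, OF Wi Ui]) (simp add: algebra_simps)
  also have "\<dots> = growth z * integral {s..y} ?N" by simp
  finally show "?N y \<le> norm (U s) + norm (W s) + integral {s..t} (\<lambda>t. norm (g t)) + growth z * integral {s..y} ?N"
    using 1 2 by linarith
qed (rule x)

end

section \<open>Solutions with prescribed initial data\<close>

lemma primitive_on_from_left:
  assumes f: "f absolutely_integrable_on {s..t}" and F: "\<And>x. x \<in> {s..t} \<Longrightarrow> F x = c + integral {s..x} f"
  shows "primitive_on {s..t} f F"
  unfolding primitive_on_def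
proof (intro ballI impI conjI)
  fix x y assume xy: "x \<in> {s..t}" "y \<in> {s..t}" "x \<le> y"
  show "f absolutely_integrable_on {x..y}" by (rule set_integrable_subset[OF f]) (use xy in auto)
  have "f absolutely_integrable_on {s..y}" by (rule set_integrable_subset[OF f]) (use xy in auto)
  then have "f integrable_on {s..y}" using absolutely_integrable_on_def by blast
  then have "integral {s..x} f + integral {x..y} f = integral {s..y} f"
    using xy by (intro Henstock_Kurzweil_Integration.integral_combine) auto
  then show "integral {x..y} f = F y - F x" using F[OF xy(1)] F[OF xy(2)] by (simp add: algebra_simps)
qed

lemma integral_exp_le:
  fixes l :: real
  assumes "l > 0" "0 \<le> c"
  shows "integral {0..c} (\<lambda>t. exp (l * t)) \<le> exp (l * c) / l"
proof -
  have "((\<lambda>t. exp (l * t)) has_integral (exp (l * c) / l - exp (l * 0) / l)) {0..c}"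
    using assms
    by (intro fundamental_theorem_of_calculus)
       (auto intro!: derivative_eq_intros simp flip: has_real_derivative_iff_has_vector_derivative)
  then show ?thesis using assms by (simp add: integral_unique)
qed

text \<open>Bounded continuous functions form a complete space on the whole line; functions on \<open>{0..1}\<close> are
embedded there by keeping them constant outside.\<close>

definition clamp01 :: "real \<Rightarrow> real" where "clamp01 x = max 0 (min 1 x)"

lemma clamp01: "clamp01 x \<in> {0..1}" "0 \<le> clamp01 x" "clamp01 x \<le> 1" "x \<in> {0..1} \<Longrightarrow> clamp01 x = x"
  by (auto simp: clamp01_def)

lemma continuous_clamp01: "continuous_on A clamp01"
  unfolding clamp01_def by (intro continuous_intros)

lemma bcontfun_clamp01:
  fixes G :: "real \<Rightarrow> 'b::metric_space"
  assumes "continuous_on {0..1} G"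
  shows "(\<lambda>x. G (clamp01 x)) \<in> bcontfun"
  unfolding bcontfun_def
proof (intro CollectI conjI)
  show "continuous_on UNIV (\<lambda>x. G (clamp01 x))"
    by (rule continuous_on_compose2[OF assms continuous_clamp01]) (use clamp01 in auto)
  have "bounded (G ` {0..1})" using assms by (intro compact_imp_bounded compact_continuous_image) auto
  then show "bounded (range (\<lambda>x. G (clamp01 x)))" by (rule bounded_subset) (use clamp01 in auto)
qed

context periodic_coefficients
begin

text \<open>The Picard operator contracts with respect to the sup norm with weight \<open>exp (- weight z * x)\<close> on all
of \<open>{0..1}\<close>: the integral equations are rewritten for the functions multiplied by this weight. The
factor 4 gives each of the two components the constant 1/4.\<close>

definition weight :: "complex \<Rightarrow> real" where "weight z = 4 * growth z"

definition picard_U :: "complex \<Rightarrow> complex \<Rightarrow> (real \<Rightarrow> complex \<times> complex) \<Rightarrow> real \<Rightarrow> complex" where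
  "picard_U z \<alpha> Z x = of_real (exp (- weight z * x)) *
     (\<alpha> + integral {0..x} (\<lambda>t. (of_real (exp (weight z * t)) * snd (Z t)) / of_real (p t)))"

definition picard_W :: "complex \<Rightarrow> complex \<Rightarrow> (real \<Rightarrow> complex \<times> complex) \<Rightarrow> real \<Rightarrow> complex" where
  "picard_W z \<beta> Z x = of_real (exp (- weight z * x)) *
     (\<beta> + integral {0..x} (\<lambda>t. (of_real (q t) - z) * (of_real (exp (weight z * t)) * fst (Z t))))"

lemma picard_integrable:
  fixes Z :: "real \<Rightarrow> complex \<times> complex"
  assumes "continuous_on UNIV Z"
  shows "(\<lambda>t. (of_real (exp (weight z * t)) * snd (Z t)) / of_real (p t)) absolutely_integrable_on {0..x}"
    and "(\<lambda>t. (of_real (q t) - z) * (of_real (exp (weight z * t)) * fst (Z t))) absolutely_integrable_on {0..x}"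
  by (rule inverse_p_integrable coefficient_integrable; intro continuous_intros continuous_on_subset[OF assms]; simp)+

lemma picard_continuous:
  fixes Z :: "real \<Rightarrow> complex \<times> complex"
  assumes "continuous_on UNIV Z"
  shows "continuous_on {0..1} (picard_U z \<alpha> Z)" "continuous_on {0..1} (picard_W z \<beta> Z)"
  unfolding picard_U_def[abs_def] picard_W_def[abs_def] using picard_integrable[OF assms]
  by (intro continuous_intros indefinite_integral_continuous_1; simp add: absolutely_integrable_on_def)+

lemma weighted_integral_le:
  fixes f g :: "real \<Rightarrow> complex"
  assumes x: "0 \<le> x" and f: "f absolutely_integrable_on {0..x}" and g: "g absolutely_integrable_on {0..x}"
    and d: "\<And>t. norm (f t - g t) \<le> growth z * (exp (weight z * t) * d)" and d0: "0 \<le> d"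
  shows "norm (of_real (exp (- weight z * x)) * (\<alpha> + integral {0..x} f) - of_real (exp (- weight z * x)) * (\<alpha> + integral {0..x} g)) \<le> d / 4"
proof -
  have w: "weight z > 0" using growth_pos by (simp add: weight_def)
  have i: "f integrable_on {0..x}" "g integrable_on {0..x}" using f g absolutely_integrable_on_def by blast+
  have "of_real (exp (- weight z * x)) * (\<alpha> + integral {0..x} f) - of_real (exp (- weight z * x)) * (\<alpha> + integral {0..x} g)
     = of_real (exp (- weight z * x)) * integral {0..x} (\<lambda>t. f t - g t)"
    by (simp add: integral_diff[OF i] algebra_simps)
  also have "norm \<dots> \<le> exp (- weight z * x) * integral {0..x} (\<lambda>t. growth z * d * exp (weight z * t))"
    unfolding norm_mult norm_of_real abs_exp_cancel
    using d by (intro mult_left_mono integral_norm_bound_integral integrable_diff i integrable_continuous_real continuous_intros)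
      (auto simp: mult_ac)
  also have "\<dots> \<le> exp (- weight z * x) * (growth z * d * (exp (weight z * x) / weight z))"
    proof (rule mult_left_mono)
      have "integral {0..x} (\<lambda>t. growth z * d * exp (weight z * t)) = growth z * d * integral {0..x} (\<lambda>t. exp (weight z * t))"
        by simp
      also have "\<dots> \<le> growth z * d * (exp (weight z * x) / weight z)"
        by (rule mult_left_mono[OF integral_exp_le[OF w x]]) (use growth_pos[of z] d0 in simp)
      finally show "integral {0..x} (\<lambda>t. growth z * d * exp (weight z * t)) \<le> growth z * d * (exp (weight z * x) / weight z)" .
    qed simp
  also have "\<dots> = growth z * d / weight z * (exp (- weight z * x) * exp (weight z * x))" by simp
  also have "exp (- weight z * x) * exp (weight z * x) = 1" by (simp add: exp_minus)
  also have "growth z * d / weight z * 1 = d / 4" using growth_pos[of z] by (simp add: weight_def)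
  finally show ?thesis .
qed

text \<open>Banach's fixed point theorem for the weighted Picard operator. One period suffices, because all
other intervals are reached by translation.\<close>

lemma exists_homogeneous_solution:
  "\<exists>U W. solves z {0..1} (\<lambda>_. 0) U W \<and> U 0 = \<alpha> \<and> W 0 = \<beta>"
proof -
  define T where "T Z = Bcontfun (\<lambda>x. (picard_U z \<alpha> (apply_bcontfun Z) (clamp01 x), picard_W z \<beta> (apply_bcontfun Z) (clamp01 x)))"
    for Z :: "real \<Rightarrow>\<^sub>C (complex \<times> complex)"
  have T: "apply_bcontfun (T Z) x = (picard_U z \<alpha> (apply_bcontfun Z) (clamp01 x), picard_W z \<beta> (apply_bcontfun Z) (clamp01 x))" for Z x
    unfolding T_def
    by (subst Bcontfun_inverse) (auto intro!: bcontfun_clamp01[of "\<lambda>x. (picard_U z \<alpha> (apply_bcontfun Z) x, picard_W z \<beta> (apply_bcontfun Z) x)"] continuous_intros picard_continuous)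
  have lip: "dist (T X) (T Y) \<le> 1/2 * dist X Y" for X Y
  proof (rule dist_bound)
    fix x
    let ?c = "clamp01 x"
    have fs: "norm (fst (X t) - fst (Y t)) \<le> dist X Y" "norm (snd (X t) - snd (Y t)) \<le> dist X Y" for t
      using dist_bounded[of X t Y] dist_fst_le[of "X t" "Y t"] dist_snd_le[of "X t" "Y t"] by (simp_all add: dist_norm)
    have 1: "norm (picard_U z \<alpha> X ?c - picard_U z \<alpha> Y ?c) \<le> dist X Y / 4"
      unfolding picard_U_def
    proof (rule weighted_integral_le[OF clamp01(2) picard_integrable(1) picard_integrable(1)])
      fix t
      have "norm (of_real (exp (weight z * t)) * snd (X t) / of_real (p t) - of_real (exp (weight z * t)) * snd (Y t) / of_real (p t))
        = norm ((of_real (exp (weight z * t)) * (snd (X t) - snd (Y t))) / of_real (p t))" by (simp add: algebra_simps diff_divide_distrib)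
      also have "\<dots> \<le> growth z * norm (of_real (exp (weight z * t)) * (snd (X t) - snd (Y t)))" by (rule norm_div_p_le)
      also have "\<dots> \<le> growth z * (exp (weight z * t) * dist X Y)"
        using fs[of t] growth_pos[of z] by (simp add: norm_mult)
      finally show "norm (of_real (exp (weight z * t)) * snd (X t) / of_real (p t) - of_real (exp (weight z * t)) * snd (Y t) / of_real (p t))
         \<le> growth z * (exp (weight z * t) * dist X Y)" .
    qed auto
    have 2: "norm (picard_W z \<beta> X ?c - picard_W z \<beta> Y ?c) \<le> dist X Y / 4"
      unfolding picard_W_def
    proof (rule weighted_integral_le[OF clamp01(2) picard_integrable(2) picard_integrable(2)])
      fix t
      have "norm ((of_real (q t) - z) * (of_real (exp (weight z * t)) * fst (X t)) - (of_real (q t) - z) * (of_real (exp (weight z * t)) * fst (Y t)))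
        = norm ((of_real (q t) - z) * (of_real (exp (weight z * t)) * (fst (X t) - fst (Y t))))" by (simp add: algebra_simps)
      also have "\<dots> \<le> growth z * norm (of_real (exp (weight z * t)) * (fst (X t) - fst (Y t)))" by (rule norm_q_mult_le)
      also have "\<dots> \<le> growth z * (exp (weight z * t) * dist X Y)"
        using fs[of t] growth_pos[of z] by (simp add: norm_mult)
      finally show "norm ((of_real (q t) - z) * (of_real (exp (weight z * t)) * fst (X t)) - (of_real (q t) - z) * (of_real (exp (weight z * t)) * fst (Y t)))
         \<le> growth z * (exp (weight z * t) * dist X Y)" .
    qed auto
    have "dist (T X x) (T Y x) \<le> norm (picard_U z \<alpha> X ?c - picard_U z \<alpha> Y ?c) + norm (picard_W z \<beta> X ?c - picard_W z \<beta> Y ?c)"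
      unfolding T dist_norm using norm_Pair_le by (metis diff_Pair)
    then show "dist (T X x) (T Y x) \<le> 1/2 * dist X Y" using 1 2 by linarith
  qed
  obtain Z where Z: "T Z = Z"
    using banach_fix_type[of "1/2" T] lip by auto
  define U where "U t = of_real (exp (weight z * t)) * fst (Z t)" for t
  define W where "W t = of_real (exp (weight z * t)) * snd (Z t)" for t
  have inv: "of_real (exp (weight z * x)) * (of_real (exp (- weight z * x)) * c) = (c :: complex)" for x c
    by (simp add: mult.assoc[symmetric] exp_minus flip: of_real_mult)
  have Zx: "Z x = (picard_U z \<alpha> Z x, picard_W z \<beta> Z x)" if "x \<in> {0..1}" for x
    using T[of Z x] Z clamp01(4)[OF that] by simp
  have Ueq: "U x = \<alpha> + integral {0..x} (\<lambda>t. W t / of_real (p t))" if "x \<in> {0..1}" for x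
    unfolding U_def W_def by (subst Zx[OF that]) (simp only: fst_conv picard_U_def inv)
  have Weq: "W x = \<beta> + integral {0..x} (\<lambda>t. (of_real (q t) - z) * U t)" if "x \<in> {0..1}" for x
    unfolding U_def W_def by (subst Zx[OF that]) (simp only: snd_conv picard_W_def inv)
  have "primitive_on {0..1} (\<lambda>x. W x / of_real (p x)) U"
    by (rule primitive_on_from_left[OF _ Ueq])  (use picard_integrable(1)[where Z=Z and z=z and x=1] in \<open>simp_all add: W_def\<close>)
  moreover have "primitive_on {0..1} (\<lambda>x. (of_real (q x) - z) * U x) W"
    by (rule primitive_on_from_left[OF _ Weq]) (use picard_integrable(2)[where Z=Z and z=z and x=1] in \<open>simp_all add: U_def\<close>)
  ultimately have "solves z {0..1} (\<lambda>_. 0) U W" by (simp add: solves_def)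
  moreover have "U 0 = \<alpha>" "W 0 = \<beta>" using Ueq[of 0] Weq[of 0] by simp_all
  ultimately show ?thesis by blast
qed

text \<open>This is the reason why the monodromy matrix has determinant one, so that the two Floquet
multipliers are \<open>\<rho>\<close> and \<open>1 / \<rho>\<close>.\<close>

lemma wronskian_const:
  assumes 1: "solves z {s..t} (\<lambda>_. 0) U1 W1" and 2: "solves z {s..t} (\<lambda>_. 0) U2 W2" and "s \<le> t"
  shows "U1 t * W2 t - U2 t * W1 t = U1 s * W2 s - U2 s * W1 s"
proof -
  have "primitive_on {s..t} (\<lambda>x. (W1 x / of_real (p x) * W2 x + U1 x * ((of_real (q x) - z) * U2 x - 0))
      - (W2 x / of_real (p x) * W1 x + U2 x * ((of_real (q x) - z) * U1 x - 0))) (\<lambda>x. U1 x * W2 x - U2 x * W1 x)"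
    using 1 2 unfolding solves_def by (intro primitive_on_diff primitive_on_prod) (auto simp: is_interval_cc)
  also have "(\<lambda>x. (W1 x / of_real (p x) * W2 x + U1 x * ((of_real (q x) - z) * U2 x - 0))
      - (W2 x / of_real (p x) * W1 x + U2 x * ((of_real (q x) - z) * U1 x - 0))) = (\<lambda>_. 0)"
    by (simp add: fun_eq_iff)
  finally have "integral {s..t} (\<lambda>_. 0) = (U1 t * W2 t - U2 t * W1 t) - (U1 s * W2 s - U2 s * W1 s)"
    using \<open>s \<le> t\<close> by (intro primitive_onD(2)[where I="{s..t}"]) auto
  then show ?thesis by simp
qed

text \<open>The columns of the monodromy matrix are the values at \<open>1\<close> of the two fundamental solutions. Subtracting
the homogeneous solution with the same data leaves a solution with zero data, which the
right-hand side controls.\<close>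

lemma exists_monodromy:
  "\<exists>m11 m12 m21 m22 C. m11 * m22 - m12 * m21 = 1 \<and> 0 \<le> C \<and>
    (\<forall>g U W. solves z {0..1} g U W \<longrightarrow>
       norm (U 1 - (m11 * U 0 + m12 * W 0)) + norm (W 1 - (m21 * U 0 + m22 * W 0))
         \<le> C * integral {0..1} (\<lambda>t. norm (g t)))"
proof -
  obtain U1 W1 where s1: "solves z {0..1} (\<lambda>_. 0) U1 W1" and i1: "U1 0 = 1" "W1 0 = 0"
    using exists_homogeneous_solution by blast
  obtain U2 W2 where s2: "solves z {0..1} (\<lambda>_. 0) U2 W2" and i2: "U2 0 = 0" "W2 0 = 1"
    using exists_homogeneous_solution by blast
  show ?thesis
  proof (rule exI[of _ "U1 1"], rule exI[of _ "U2 1"], rule exI[of _ "W1 1"], rule exI[of _ "W2 1"],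
      rule exI[of _ "exp (growth z)"], intro conjI allI impI)
    show "U1 1 * W2 1 - U2 1 * W1 1 = 1"
      using wronskian_const[OF s1 s2] i1 i2 by simp
    fix g U W assume s: "solves z {0..1} g U W"
    have "solves z {0..1} (\<lambda>x. g x - (U 0 * 0 + W 0 * 0))
       (\<lambda>x. U x - (U 0 * U1 x + W 0 * U2 x)) (\<lambda>x. W x - (U 0 * W1 x + W 0 * W2 x))"
      by (intro solves_diff solves_add solves_mult s s1 s2)
    from solves_bound[OF this, of 1]
    show "norm (U 1 - (U1 1 * U 0 + U2 1 * W 0)) + norm (W 1 - (W1 1 * U 0 + W2 1 * W 0))
         \<le> exp (growth z) * integral {0..1} (\<lambda>t. norm (g t))"
      using i1 i2 by (simp add: mult.commute)
  qed simp
qed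

end

section \<open>The space of square integrable functions\<close>

text \<open>The link between the Bochner integral over \<open>lebesgue_on S\<close>, in which the space is defined, and the gauge
integral.\<close>

lemma L2_facts:
  assumes "u \<in> L2 S" "S \<in> sets lebesgue"
  shows "u \<in> borel_measurable (lebesgue_on S)" "integrable (lebesgue_on S) (\<lambda>x. (cmod (u x))\<^sup>2)"
    "(\<lambda>x. (cmod (u x))\<^sup>2) absolutely_integrable_on S"
    "(\<lambda>x. (cmod (u x))\<^sup>2) integrable_on S"
    "(L2_norm S u)\<^sup>2 = integral S (\<lambda>x. (cmod (u x))\<^sup>2)"
proof -
  show 1: "u \<in> borel_measurable (lebesgue_on S)" "integrable (lebesgue_on S) (\<lambda>x. (cmod (u x))\<^sup>2)"
    using assms by (auto simp: L2_def)
  then show 2: "(\<lambda>x. (cmod (u x))\<^sup>2) absolutely_integrable_on S"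
    using integrable_lebesgue_on_iff[OF assms(2)] by blast
  then show "(\<lambda>x. (cmod (u x))\<^sup>2) integrable_on S" using absolutely_integrable_on_def by blast
  show "(L2_norm S u)\<^sup>2 = integral S (\<lambda>x. (cmod (u x))\<^sup>2)"
  proof -
    have "0 \<le> (LINT x|lebesgue_on S. (cmod (u x))\<^sup>2)" by simp
    then show ?thesis unfolding L2_norm_def lebesgue_on_integral_eq[OF assms(2) 2] by (rule real_sqrt_pow2)
  qed
qed

lemma L2_norm_nonneg: "0 \<le> L2_norm S u"
  unfolding L2_norm_def by simp

lemma L2_norm_square: "(L2_norm S u)\<^sup>2 = (LINT x|lebesgue_on S. (cmod (u x))\<^sup>2)"
  unfolding L2_norm_def by simp

lemma square_sum_le_weighted:
  fixes a b A B :: real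
  assumes "A > 0" "B > 0"
  shows "(a + b)\<^sup>2 \<le> (A + B) * (a\<^sup>2 / A + b\<^sup>2 / B)"
proof -
  have "(A + B) * (a\<^sup>2 / A + b\<^sup>2 / B) - (a + b)\<^sup>2 = (B * a - A * b)\<^sup>2 / (A * B)"
    using assms by (simp add: field_simps power2_eq_square)
  also have "\<dots> \<ge> 0" using assms by simp
  finally show ?thesis by simp
qed

text \<open>Minkowski's inequality, by convexity of the square: with weights \<open>A > \<parallel>u\<parallel>\<close> and \<open>B > \<parallel>v\<parallel>\<close> the pointwise
bound integrates to \<open>\<parallel>u + v\<parallel>\<^sup>2 \<le> (A + B)\<^sup>2\<close>. The surplus \<open>e\<close> avoids division by zero.\<close>

lemma L2_add:
  assumes "u \<in> L2 S" "v \<in> L2 S"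
  shows "(\<lambda>x. u x + v x) \<in> L2 S" "L2_norm S (\<lambda>x. u x + v x) \<le> L2_norm S u + L2_norm S v"
proof -
  let ?M = "lebesgue_on S"
  have [measurable]: "u \<in> borel_measurable ?M" "v \<in> borel_measurable ?M" using assms by (auto simp: L2_def)
  have i: "integrable ?M (\<lambda>x. (cmod (u x))\<^sup>2)" "integrable ?M (\<lambda>x. (cmod (v x))\<^sup>2)" using assms by (auto simp: L2_def)
  have le: "(cmod (u x + v x))\<^sup>2 \<le> (A + B) * ((cmod (u x))\<^sup>2 / A + (cmod (v x))\<^sup>2 / B)" if "A > 0" "B > 0" for x A B
  proof -
    have "(cmod (u x + v x))\<^sup>2 \<le> (cmod (u x) + cmod (v x))\<^sup>2" by (intro power_mono norm_triangle_ineq) simp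
    also have "\<dots> \<le> (A + B) * ((cmod (u x))\<^sup>2 / A + (cmod (v x))\<^sup>2 / B)" by (rule square_sum_le_weighted[OF that])
    finally show ?thesis .
  qed
  have j: "integrable ?M (\<lambda>x. (A + B) * ((cmod (u x))\<^sup>2 / A + (cmod (v x))\<^sup>2 / B))" for A B
    using i by simp
  have k: "integrable ?M (\<lambda>x. (cmod (u x + v x))\<^sup>2)"
  proof (rule Bochner_Integration.integrable_bound[OF j[of 1 1]])
    show "AE x in ?M. norm ((cmod (u x + v x))\<^sup>2) \<le> norm ((1 + 1) * ((cmod (u x))\<^sup>2 / 1 + (cmod (v x))\<^sup>2 / 1))"
    proof (intro AE_I2)
      fix x
      show "norm ((cmod (u x + v x))\<^sup>2) \<le> norm ((1 + 1) * ((cmod (u x))\<^sup>2 / 1 + (cmod (v x))\<^sup>2 / 1))"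
        using le[of 1 1 x] by simp
    qed
  qed measurable
  then show "(\<lambda>x. u x + v x) \<in> L2 S" by (simp add: L2_def)
  show "L2_norm S (\<lambda>x. u x + v x) \<le> L2_norm S u + L2_norm S v"
  proof (rule field_le_epsilon)
    fix e :: real assume e: "e > 0"
    define A where "A = L2_norm S u + e / 2"
    define B where "B = L2_norm S v + e / 2"
    have AB: "A > 0" "B > 0" "L2_norm S u \<le> A" "L2_norm S v \<le> B"
      unfolding A_def B_def using e L2_norm_nonneg[of S] by (simp_all add: add_nonneg_pos)
    have "(L2_norm S (\<lambda>x. u x + v x))\<^sup>2 \<le> (LINT x|?M. (A + B) * ((cmod (u x))\<^sup>2 / A + (cmod (v x))\<^sup>2 / B))"
      unfolding L2_norm_square using le[OF AB(1,2)] by (intro integral_mono k j) auto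
    also have "\<dots> = (A + B) * ((L2_norm S u)\<^sup>2 / A + (L2_norm S v)\<^sup>2 / B)"
      unfolding L2_norm_square using i by simp
    also have "\<dots> \<le> (A + B) * (A\<^sup>2 / A + B\<^sup>2 / B)"
      using AB L2_norm_nonneg[of S] by (intro mult_left_mono add_mono divide_right_mono power_mono) auto
    also have "\<dots> = (A + B)\<^sup>2" using AB by (simp add: power2_eq_square)
    finally have sq: "(L2_norm S (\<lambda>x. u x + v x))\<^sup>2 \<le> (A + B)\<^sup>2" .
    have "L2_norm S (\<lambda>x. u x + v x) \<le> A + B" by (rule power2_le_imp_le[OF sq]) (use AB in linarith)
    then show "L2_norm S (\<lambda>x. u x + v x) \<le> L2_norm S u + L2_norm S v + e" by (simp add: A_def B_def)
  qed
qed

lemma L2_mult: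
  assumes "u \<in> L2 S"
  shows "(\<lambda>x. c * u x) \<in> L2 S"
  using assms by (auto simp: L2_def norm_mult power_mult_distrib)

lemma L2_norm_mult: "L2_norm S (\<lambda>x. c * u x) = cmod c * L2_norm S u"
  by (simp add: L2_norm_def norm_mult power_mult_distrib real_sqrt_mult)

lemma L2_diff:
  assumes "u \<in> L2 S" "v \<in> L2 S"
  shows "(\<lambda>x. u x - v x) \<in> L2 S" "L2_norm S (\<lambda>x. u x - v x) \<le> L2_norm S u + L2_norm S v"
  using L2_add[OF assms(1) L2_mult[OF assms(2), of "-1"]] L2_norm_mult[of S "-1" v] by simp_all

lemma L2_norm_diff_commute: "L2_norm S (\<lambda>x. u x - v x) = L2_norm S (\<lambda>x. v x - u x)"
  by (simp add: L2_norm_def norm_minus_commute)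

lemma L2_norm_triangle:
  assumes "u \<in> L2 S" "v \<in> L2 S"
  shows "\<bar>L2_norm S u - L2_norm S v\<bar> \<le> L2_norm S (\<lambda>x. u x - v x)"
  using L2_add(2)[OF L2_diff(1)[OF assms] assms(2)] L2_add(2)[OF L2_diff(1)[OF assms(2,1)] assms(1)]
    L2_norm_diff_commute[of S u v] by simp

lemma borel_measurable_lebesgue_on_cong_AE:
  fixes u v :: "real \<Rightarrow> complex"
  assumes S: "S \<in> sets lebesgue" and u: "u \<in> borel_measurable (lebesgue_on S)" and ae: "AE x in lebesgue_on S. u x = v x"
  shows "v \<in> borel_measurable (lebesgue_on S)"
proof -
  have "(\<lambda>x. if x \<in> S then u x else 0) \<in> borel_measurable lebesgue"
    using u S by (simp add: borel_measurable_if)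
  moreover have "AE x in lebesgue. (if x \<in> S then u x else 0) = (if x \<in> S then v x else 0)"
    using ae S by (auto simp: AE_restrict_space_iff)
  ultimately have "(\<lambda>x. if x \<in> S then v x else 0) \<in> borel_measurable lebesgue" by (rule borel_measurable_AE)
  then show ?thesis using S by (simp add: borel_measurable_if)
qed

lemma L2_cong_AE:
  assumes S: "S \<in> sets lebesgue" and u: "u \<in> L2 S" and ae: "AE x in lebesgue_on S. u x = v x"
  shows "v \<in> L2 S" "L2_norm S v = L2_norm S u"
proof -
  have um[measurable]: "u \<in> borel_measurable (lebesgue_on S)" and ui: "integrable (lebesgue_on S) (\<lambda>x. (cmod (u x))\<^sup>2)"
    using L2_facts[OF u S] by auto
  have vm[measurable]: "v \<in> borel_measurable (lebesgue_on S)"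
    by (rule borel_measurable_lebesgue_on_cong_AE[OF S um ae])
  have ae': "AE x in lebesgue_on S. (cmod (u x))\<^sup>2 = (cmod (v x))\<^sup>2" using ae by eventually_elim simp
  then have "integrable (lebesgue_on S) (\<lambda>x. (cmod (v x))\<^sup>2)"
    using ui integrable_cong_AE[OF _ _ ae'] by simp
  then show "v \<in> L2 S" using vm by (simp add: L2_def)
  have "(LINT x|lebesgue_on S. (cmod (v x))\<^sup>2) = (LINT x|lebesgue_on S. (cmod (u x))\<^sup>2)"
    by (rule integral_cong_AE) (use ae' in auto)
  then show "L2_norm S v = L2_norm S u" by (simp add: L2_norm_def)
qed

lemma AE_lebesgue_imp_AE_on:
  assumes "AE x in lebesgue. P x" "S \<in> sets lebesgue"
  shows "AE x in lebesgue_on S. P x"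
  using assms by (auto simp: AE_restrict_space_iff)

lemma L2_subset:
  assumes u: "u \<in> L2 S" and S: "S \<in> sets lebesgue" and T: "T \<in> sets lebesgue" "T \<subseteq> S"
  shows "u \<in> L2 T" "L2_norm T u \<le> L2_norm S u"
proof -
  have "(\<lambda>x. (cmod (u x))\<^sup>2) absolutely_integrable_on T"
    by (rule set_integrable_subset[OF L2_facts(3)[OF u S] T])
  moreover have "u \<in> borel_measurable (lebesgue_on T)"
    using L2_facts(1)[OF u S] T(2) measurable_restrict_mono by blast
  ultimately show uT: "u \<in> L2 T" by (simp add: L2_def integrable_lebesgue_on_iff[OF T(1)])
  have "(L2_norm T u)\<^sup>2 \<le> (L2_norm S u)\<^sup>2"
    unfolding L2_facts(5)[OF u S] L2_facts(5)[OF uT T(1)]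
    by (intro integral_subset_le T L2_facts(4)[OF u S] L2_facts(4)[OF uT T(1)]) auto
  then show "L2_norm T u \<le> L2_norm S u" using L2_norm_nonneg by (rule power2_le_imp_le)
qed

lemma L2_bounded_measurable_mult:
  assumes u: "u \<in> L2 S" and f: "f \<in> borel_measurable (lebesgue_on S)" and B: "\<And>x. norm (f x) \<le> B"
  shows "(\<lambda>x. f x * u x) \<in> L2 S"
proof -
  have B0: "B \<ge> 0" using B[of 0] norm_ge_zero order_trans by blast
  have [measurable]: "u \<in> borel_measurable (lebesgue_on S)" using u by (simp add: L2_def)
  note [measurable] = f
  have i: "integrable (lebesgue_on S) (\<lambda>x. B\<^sup>2 * (cmod (u x))\<^sup>2)" using u by (simp add: L2_def)
  have le: "norm ((cmod (f x * u x))\<^sup>2) \<le> norm (B\<^sup>2 * (cmod (u x))\<^sup>2)" for x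
    using B[of x] by (simp add: norm_mult power_mult_distrib mult_right_mono power_mono)
  have "integrable (lebesgue_on S) (\<lambda>x. (cmod (f x * u x))\<^sup>2)"
    by (rule Bochner_Integration.integrable_bound[OF i _ AE_I2[OF le]]) measurable
  then show ?thesis by (simp add: L2_def)
qed

lemma continuous_L2_Icc:
  assumes "continuous_on {s..t} U"
  shows "U \<in> L2 {s..t}"
proof -
  have "(\<lambda>x. (cmod (U x))\<^sup>2) absolutely_integrable_on {s..t}"
    by (intro absolutely_integrable_continuous_real continuous_intros assms)
  then show ?thesis
    using assms by (auto simp: L2_def integrable_lebesgue_on_iff continuous_imp_measurable_on_sets_lebesgue)
qed

text \<open>The Cauchy-Schwarz inequality against the constant function, from \<open>\<bar>g\<bar> \<le> c / 2 + \<bar>g\<bar>\<^sup>2 / (2 c)\<close> with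
the optimal \<open>c\<close>.\<close>

lemma L2_Icc_integral_le:
  assumes g: "g \<in> L2 {s..t}" and st: "s \<le> t"
  shows "g absolutely_integrable_on {s..t}"
    "integral {s..t} (\<lambda>x. norm (g x)) \<le> sqrt (t - s) * L2_norm {s..t} g"
proof -
  have S: "{s..t} \<in> sets lebesgue" by simp
  note g' = L2_facts[OF g S]
  have le: "norm (g x) \<le> c / 2 + (norm (g x))\<^sup>2 / (2 * c)" if "c > 0" for x c
  proof -
    have "0 \<le> (norm (g x) - c)\<^sup>2 / (2 * c)" using that by simp
    also have "\<dots> = c / 2 + (norm (g x))\<^sup>2 / (2 * c) - norm (g x)" using that by (simp add: field_simps power2_eq_square)
    finally show ?thesis by simp
  qed
  have i: "(\<lambda>x. c / 2 + (norm (g x))\<^sup>2 / (2 * c)) integrable_on {s..t}" for c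
    by (intro integrable_add integrable_on_divide g'(4)) auto
  show a: "g absolutely_integrable_on {s..t}"
    by (rule measurable_bounded_by_integrable_imp_absolutely_integrable[OF g'(1) S i[of 1]]) (rule le, simp)
  then have a': "(\<lambda>x. norm (g x)) integrable_on {s..t}" by (simp add: absolutely_integrable_on_def)
  show "integral {s..t} (\<lambda>x. norm (g x)) \<le> sqrt (t - s) * L2_norm {s..t} g"
  proof (cases "s < t")
    case True
    define G where "G = L2_norm {s..t} g"
    have G0: "G \<ge> 0" by (simp add: G_def L2_norm_nonneg)
    define l where "l = sqrt (t - s)"
    have l: "l > 0" "t - s = l * l" using True by (simp_all add: l_def)
    have "integral {s..t} (\<lambda>x. norm (g x)) / l \<le> G"
    proof (rule field_le_epsilon)
      fix e :: real assume e: "e > 0"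
      define h where "h = G + e"
      have h: "h > 0" using e G0 by (simp add: h_def)
      define c where "c = h / l"
      have c: "c > 0" using h l by (simp add: c_def)
      have "integral {s..t} (\<lambda>x. norm (g x)) \<le> integral {s..t} (\<lambda>x. c / 2 + (norm (g x))\<^sup>2 / (2 * c))"
        using le[OF c] by (intro integral_le a' i) auto
      also have "\<dots> = c / 2 * (t - s) + G\<^sup>2 / (2 * c)"
        unfolding G_def g'(5) using True by (subst integral_add) (auto intro!: integrable_on_divide g'(4))
      also have "\<dots> \<le> c / 2 * (t - s) + h\<^sup>2 / (2 * c)"
        using c e G0 by (intro add_left_mono divide_right_mono power_mono) (auto simp: h_def)
      also have "\<dots> = l * h"
        using l(1) h unfolding l(2) c_def by (simp add: field_simps power2_eq_square)
      also have "\<dots> = l * (G + e)" by (simp add: h_def)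
      finally show "integral {s..t} (\<lambda>x. norm (g x)) / l \<le> G + e" using l(1) by (simp add: pos_divide_le_eq mult.commute)
    qed
    then have "integral {s..t} (\<lambda>x. norm (g x)) \<le> G * l" using l(1) by (simp only: pos_divide_le_eq)
    then show ?thesis by (simp only: G_def l_def mult.commute)
  qed (use st in simp)
qed

section \<open>Translations of square integrable functions\<close>

lemma L2_shift:
  assumes "continuous_on UNIV U" "U \<in> L2 UNIV"
  shows "(\<lambda>x. U (x + 1)) \<in> L2 UNIV" "L2_norm UNIV (\<lambda>x. U (x + 1)) = L2_norm UNIV U"
proof -
  let ?f = "\<lambda>x. (cmod (U x))\<^sup>2"
  have U[measurable]: "U \<in> borel_measurable borel" using assms(1) by (rule borel_measurable_continuous_onI)
  have i: "integrable lborel ?f"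
    using L2_facts(2)[OF assms(2)] by (simp add: lebesgue_on_UNIV_eq integrable_completion)
  have i': "integrable lborel (\<lambda>x. ?f (x + 1))"
    using lborel_integrable_real_affine[OF i, of 1 1] by (simp add: add.commute)
  have e: "(LINT x|lborel. ?f (x + 1)) = (LINT x|lborel. ?f x)"
    using lborel_integral_real_affine[of 1 ?f 1] by (simp add: add.commute)
  show "(\<lambda>x. U (x + 1)) \<in> L2 UNIV"
    using i' unfolding L2_def lebesgue_on_UNIV_eq by (auto simp: integrable_completion intro!: measurable_completion)
  show "L2_norm UNIV (\<lambda>x. U (x + 1)) = L2_norm UNIV U"
    using e unfolding L2_norm_def lebesgue_on_UNIV_eq by (subst (1 2) integral_completion) auto
qed

text \<open>Translation is an isometry, so that \<open>T - c\<close> is bounded below unless \<open>\<bar>c\<bar> = 1\<close>. This takes the place of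
the exponential dichotomy of the periodic system.\<close>

lemma L2_norm_shift_diff_ge:
  assumes "continuous_on UNIV U" "U \<in> L2 UNIV"
  shows "\<bar>1 - cmod c\<bar> * L2_norm UNIV U \<le> L2_norm UNIV (\<lambda>x. U (x + 1) - c * U x)"
proof -
  have "\<bar>1 - cmod c\<bar> * L2_norm UNIV U = \<bar>L2_norm UNIV (\<lambda>x. U (x + 1)) - L2_norm UNIV (\<lambda>x. c * U x)\<bar>"
  proof -
    have "L2_norm UNIV U - cmod c * L2_norm UNIV U = (1 - cmod c) * L2_norm UNIV U" by (simp add: algebra_simps)
    then show ?thesis
      using L2_norm_nonneg[of UNIV U] by (simp add: L2_shift(2)[OF assms] L2_norm_mult abs_mult)
  qed
  also have "\<dots> \<le> L2_norm UNIV (\<lambda>x. U (x + 1) - c * U x)"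
    by (rule L2_norm_triangle[OF L2_shift(1)[OF assms] L2_mult[OF assms(2)]])
  finally show ?thesis .
qed

lemma L2_norm_UNIV_le:
  assumes u: "u \<in> L2 UNIV" and B: "\<And>n. integral {-real n..real n} (\<lambda>x. (cmod (u x))\<^sup>2) \<le> B"
  shows "(L2_norm UNIV u)\<^sup>2 \<le> B"
proof -
  let ?f = "\<lambda>x. (cmod (u x))\<^sup>2"
  have f: "?f integrable_on UNIV" by (rule L2_facts(4)[OF u]) simp
  have a: "?f absolutely_integrable_on UNIV" by (rule L2_facts(3)[OF u]) simp
  have "(\<lambda>n. integral UNIV (\<lambda>x. if x \<in> {-real n..real n} then ?f x else 0)) \<longlonglongrightarrow> integral UNIV ?f"
  proof (rule dominated_convergence(2))
    show "(\<lambda>x. if x \<in> {-real n..real n} then ?f x else 0) integrable_on UNIV" for n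
      unfolding integrable_restrict_UNIV
      using set_integrable_subset[OF a, of "{-real n..real n}"] by (simp add: absolutely_integrable_on_def)
    show "(\<lambda>n. if x \<in> {-real n..real n} then ?f x else 0) \<longlonglongrightarrow> ?f x" for x
    proof (rule tendsto_eventually)
      obtain m where m: "\<bar>x\<bar> \<le> real m" using real_arch_simple by blast
      show "\<forall>\<^sub>F n in sequentially. (if x \<in> {-real n..real n} then ?f x else 0) = ?f x"
        by (rule eventually_sequentiallyI[of m]) (use m in auto)
    qed
  qed (use f in auto)
  then have "integral UNIV ?f \<le> B"
    unfolding integral_restrict_UNIV by (rule LIMSEQ_le_const2) (use B in blast)
  then show ?thesis using L2_facts(5)[OF u] by simp
qed

section \<open>Completeness\<close>

text \<open>The theorem of Riesz and Fischer. Along a subsequence whose consecutive distances are at most \<open>2\<^sup>-\<^sup>k\<close> the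
sum of \<open>2\<^sup>k \<bar>u\<^sub>k\<^sub>+\<^sub>1 - u\<^sub>k\<bar>\<^sup>2\<close> is integrable, hence finite almost everywhere; so the
differences are dominated by a geometric series and the subsequence converges pointwise. Fatou's lemma bounds
the distance to the limit.\<close>

lemma L2_complete:
  assumes u: "\<And>n. u n \<in> L2 UNIV"
    and cauchy: "\<And>e. e > 0 \<Longrightarrow> \<exists>N. \<forall>m\<ge>N. \<forall>n\<ge>N. L2_norm UNIV (\<lambda>x. u m x - u n x) < e"
  shows "\<exists>f\<in>L2 UNIV. (\<lambda>n. L2_norm UNIV (\<lambda>x. u n x - f x)) \<longlonglongrightarrow> 0"
proof -
  have um[measurable]: "u n \<in> borel_measurable lebesgue" for n
    using u[of n] by (simp add: L2_def lebesgue_on_UNIV_eq)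
  have nn: "(\<integral>\<^sup>+x. ennreal ((cmod (u m x - u n x))\<^sup>2) \<partial>lebesgue) = ennreal ((L2_norm UNIV (\<lambda>x. u m x - u n x))\<^sup>2)" for m n
    using L2_diff(1)[OF u u, of m n] unfolding L2_norm_square lebesgue_on_UNIV_eq L2_def
    by (intro nn_integral_eq_integral) auto
  obtain N where N: "\<And>k m n. m \<ge> N k \<Longrightarrow> n \<ge> N k \<Longrightarrow> L2_norm UNIV (\<lambda>x. u m x - u n x) < (1/2) ^ k"
    using cauchy[of "(1/2) ^ _"] by (metis zero_less_power half_gt_zero_iff zero_less_one)
  define r where "r k = (\<Sum>i\<le>k. N i)" for k
  have rN: "N k \<le> r k" "N k \<le> r (Suc k)" for k
    unfolding r_def by (rule member_le_sum; simp)+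
  define d where "d k x = (cmod (u (r (Suc k)) x - u (r k) x))\<^sup>2" for k x
  have [measurable]: "d k \<in> borel_measurable lebesgue" for k unfolding d_def by measurable
  have "(\<integral>\<^sup>+x. (\<Sum>k. ennreal (2 ^ k * d k x)) \<partial>lebesgue) = (\<Sum>k. \<integral>\<^sup>+x. ennreal (2 ^ k * d k x) \<partial>lebesgue)"
    by (rule nn_integral_suminf) measurable
  also have "\<dots> \<le> (\<Sum>k. ennreal ((1/2) ^ k))"
  proof (rule suminf_le)
    fix k
    have "(\<integral>\<^sup>+x. ennreal (2 ^ k * d k x) \<partial>lebesgue) = ennreal (2 ^ k) * (\<integral>\<^sup>+x. ennreal (d k x) \<partial>lebesgue)"
      by (simp add: ennreal_mult nn_integral_cmult d_def)
    also have "\<dots> = ennreal (2 ^ k * (L2_norm UNIV (\<lambda>x. u (r (Suc k)) x - u (r k) x))\<^sup>2)"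
      unfolding d_def nn by (simp add: ennreal_mult)
    also have "\<dots> \<le> ennreal (2 ^ k * ((1/2) ^ k)\<^sup>2)"
      using N[of k "r (Suc k)" "r k"] rN L2_norm_nonneg[of UNIV]
      by (intro ennreal_leI mult_left_mono power_mono) (auto simp: less_imp_le)
    also have "2 ^ k * ((1/2) ^ k)\<^sup>2 = ((1/2) ^ k :: real)"
      by (simp add: power2_eq_square power_divide)
    finally show "(\<integral>\<^sup>+x. ennreal (2 ^ k * d k x) \<partial>lebesgue) \<le> ennreal ((1/2) ^ k)" .
  qed auto
  also have "\<dots> = ennreal (\<Sum>k. (1/2) ^ k)"
    by (rule suminf_ennreal2) (auto intro: summable_geometric)
  also have "\<dots> < \<infinity>" by simp
  finally have "AE x in lebesgue. (\<Sum>k. ennreal (2 ^ k * d k x)) \<noteq> \<infinity>"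
    by (intro nn_integral_PInf_AE) auto
  then have conv: "AE x in lebesgue. convergent (\<lambda>k. u (r k) x)"
  proof eventually_elim
    case (elim x)
    have "summable (\<lambda>k. 2 ^ k * d k x)"
      using elim by (intro summable_suminf_not_top) (auto simp: d_def)
    then have "bounded (range (\<lambda>k. 2 ^ k * d k x))" by (intro convergent_imp_bounded) (auto dest: summable_LIMSEQ_zero)
    then obtain B where "\<forall>y\<in>range (\<lambda>k. 2 ^ k * d k x). norm y \<le> B" unfolding bounded_iff by blast
    from bspec[OF this rangeI] have B: "2 ^ k * d k x \<le> B" for k by (simp add: d_def abs_mult)
    have "summable (\<lambda>k. u (r (Suc k)) x - u (r k) x)"
    proof (rule summable_comparison_test')
      show "summable (\<lambda>k. sqrt B * (1 / sqrt 2) ^ k)"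
        by (intro summable_mult summable_geometric) simp
      fix k
      have "cmod (u (r (Suc k)) x - u (r k) x) = sqrt (2 ^ k * d k x) * (1 / sqrt 2) ^ k"
        by (simp add: d_def real_sqrt_mult real_sqrt_power power_divide)
      also have "\<dots> \<le> sqrt B * (1 / sqrt 2) ^ k"
        using B[of k] by (intro mult_right_mono) auto
      finally show "cmod (u (r (Suc k)) x - u (r k) x) \<le> sqrt B * (1 / sqrt 2) ^ k" .
    qed
    then have "convergent (\<lambda>n. \<Sum>k<n. u (r (Suc k)) x - u (r k) x)"
      by (simp add: summable_iff_convergent)
    then have "convergent (\<lambda>n. u (r n) x - u (r 0) x)" using sum_lessThan_telescope[of "\<lambda>k. u (r k) x"] by simp
    then show ?case using convergent_add_const_iff[of "- u (r 0) x" "\<lambda>n. u (r n) x"] by simp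
  qed
  define f where "f x = lim (\<lambda>k. u (r k) x)" for x
  have fm[measurable]: "f \<in> borel_measurable lebesgue" unfolding f_def by measurable
  have bound: "(\<integral>\<^sup>+x. ennreal ((cmod (u n x - f x))\<^sup>2) \<partial>lebesgue) \<le> ennreal (((1/2) ^ j)\<^sup>2)" if n: "n \<ge> N j" for n j
  proof -
    have "(\<integral>\<^sup>+x. ennreal ((cmod (u n x - f x))\<^sup>2) \<partial>lebesgue)
       = (\<integral>\<^sup>+x. liminf (\<lambda>k. ennreal ((cmod (u n x - u (r k) x))\<^sup>2)) \<partial>lebesgue)"
    proof (rule nn_integral_cong_AE)
      show "AE x in lebesgue. ennreal ((cmod (u n x - f x))\<^sup>2) = liminf (\<lambda>k. ennreal ((cmod (u n x - u (r k) x))\<^sup>2))"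
        using conv
      proof eventually_elim
        case (elim x)
        then have "(\<lambda>k. u (r k) x) \<longlonglongrightarrow> f x" unfolding f_def by (simp add: convergent_LIMSEQ_iff)
        then have "(\<lambda>k. ennreal ((cmod (u n x - u (r k) x))\<^sup>2)) \<longlonglongrightarrow> ennreal ((cmod (u n x - f x))\<^sup>2)"
          by (intro tendsto_ennrealI tendsto_intros)
        from lim_imp_Liminf[OF sequentially_bot this] show ?case by (rule sym)
      qed
    qed
    also have "\<dots> \<le> liminf (\<lambda>k. \<integral>\<^sup>+x. ennreal ((cmod (u n x - u (r k) x))\<^sup>2) \<partial>lebesgue)"
      by (rule nn_integral_liminf) measurable
    also have "\<dots> \<le> liminf (\<lambda>k. ennreal (((1/2) ^ j)\<^sup>2))"
    proof (rule Liminf_mono, rule eventually_sequentiallyI)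
      fix k assume "j \<le> k"
      then have "r j \<le> r k" unfolding r_def by (intro sum_mono2) auto
      then have "N j \<le> r k" using rN(1)[of j] by simp
      then show "(\<integral>\<^sup>+x. ennreal ((cmod (u n x - u (r k) x))\<^sup>2) \<partial>lebesgue) \<le> ennreal (((1/2) ^ j)\<^sup>2)"
        unfolding nn using N[OF n, of "r k"] L2_norm_nonneg[of UNIV]
        by (intro ennreal_leI power_mono) (auto simp: less_imp_le)
    qed
    also have "\<dots> = ennreal (((1/2) ^ j)\<^sup>2)" by (rule Liminf_const) simp
    finally show ?thesis .
  qed
  have L2d: "(\<lambda>x. u n x - f x) \<in> L2 UNIV" "L2_norm UNIV (\<lambda>x. u n x - f x) \<le> (1/2) ^ j" if n: "n \<ge> N j" for n j
  proof -
    have i: "integrable lebesgue (\<lambda>x. (cmod (u n x - f x))\<^sup>2)"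
    proof (rule integrableI_bounded)
      show "(\<integral>\<^sup>+x. ennreal (norm ((cmod (u n x - f x))\<^sup>2)) \<partial>lebesgue) < \<infinity>"
        using bound[OF n] by (simp add: le_less_trans[OF _ ennreal_less_top])
    qed measurable
    then show "(\<lambda>x. u n x - f x) \<in> L2 UNIV" unfolding L2_def lebesgue_on_UNIV_eq by simp
    have "ennreal (LINT x|lebesgue. (cmod (u n x - f x))\<^sup>2) \<le> ennreal (((1/2) ^ j)\<^sup>2)"
      using bound[OF n] nn_integral_eq_integral[OF i] by simp
    then have "(L2_norm UNIV (\<lambda>x. u n x - f x))\<^sup>2 \<le> ((1/2) ^ j)\<^sup>2"
      unfolding L2_norm_square lebesgue_on_UNIV_eq by (simp add: ennreal_le_iff)
    then show "L2_norm UNIV (\<lambda>x. u n x - f x) \<le> (1/2) ^ j" by (rule power2_le_imp_le) simp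
  qed
  have "f \<in> L2 UNIV"
    using L2_diff(1)[OF u L2d(1)[of 0 "N 0"], of "N 0"] by simp
  moreover have "(\<lambda>n. L2_norm UNIV (\<lambda>x. u n x - f x)) \<longlonglongrightarrow> 0"
  proof (rule LIMSEQ_I)
    fix e :: real assume "e > 0"
    then obtain j where "(1/2) ^ j < e" using real_arch_pow_inv[of e "1/2"] by auto
    then show "\<exists>N. \<forall>n\<ge>N. norm (L2_norm UNIV (\<lambda>x. u n x - f x) - 0) < e"
      using L2d(2)[of j] L2_norm_nonneg[of UNIV] by (intro exI[of _ "N j"]) (auto intro: le_less_trans)
  qed
  ultimately show ?thesis by blast
qed

section \<open>Floquet multipliers\<close>

lemma integral_norm_shift_le:
  fixes g :: "real \<Rightarrow> complex"
  assumes g: "g absolutely_integrable_on {0..3}" and j: "0 \<le> j" "j \<le> 2"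
  shows "integral {0..1} (\<lambda>t. norm (g (t + j))) \<le> integral {0..3} (\<lambda>t. norm (g t))"
proof -
  have "integral {0..1} (\<lambda>t. norm (g (t + j))) = integral {0 + j..1 + j} (\<lambda>t. norm (g t))"
    using integral_shift_Icc_real[of 0 1 "\<lambda>t. norm (g t)" j] by (simp add: o_def add.commute)
  also have "\<dots> \<le> integral {0..3} (\<lambda>t. norm (g t))"
    using g set_integrable_subset[OF g, of "{0 + j..1 + j}"] j
    by (intro integral_subset_le) (auto simp: absolutely_integrable_on_def)
  finally show ?thesis .
qed

context periodic_coefficients
begin

text \<open>The multiplier is characterized by the only consequence of Floquet theory that is used: the second-order
recurrence for solutions, up to an error that is controlled by the right-hand side on the three
periods involved.\<close>

definition floquet_multiplier :: "complex \<Rightarrow> complex \<Rightarrow> bool" where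
  "floquet_multiplier z \<rho> \<longleftrightarrow> \<rho> \<noteq> 0 \<and> (\<exists>C\<ge>0. \<forall>g U W k x.
     solves z {of_int k..of_int k + 3} g U W \<longrightarrow> x \<in> {of_int k..of_int k + 1} \<longrightarrow>
       norm (U (x + 2) - (\<rho> + 1 / \<rho>) * U (x + 1) + U x) \<le> C * integral {of_int k..of_int k + 3} (\<lambda>t. norm (g t)))"

text \<open>Let \<open>D\<close> be the trace of the monodromy matrix and \<open>\<rho>\<close> a root of \<open>\<rho>\<^sup>2 - D \<rho> + 1\<close>. For every
solution, \<open>V x = U (x + 2) - D U (x + 1) + U x\<close> again belongs to a solution, and by the theorem of Cayley
and Hamilton its initial data at \<open>0\<close> consist of error terms only. So it is small on the whole first period
by Gronwall's inequality; in this way the monodromy matrix is needed at one base point only.\<close>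

lemma exists_floquet_multiplier: "\<exists>\<rho>. floquet_multiplier z \<rho>"
proof -
  obtain m11 m12 m21 m22 C where det: "m11 * m22 - m12 * m21 = 1" and C: "0 \<le> C"
    and mon: "\<And>g U W. solves z {0..1} g U W \<Longrightarrow>
       norm (U 1 - (m11 * U 0 + m12 * W 0)) + norm (W 1 - (m21 * U 0 + m22 * W 0))
         \<le> C * integral {0..1} (\<lambda>t. norm (g t))"
    using exists_monodromy[of z] by blast
  define D where "D = m11 + m22"
  define \<rho> where "\<rho> = (D + csqrt (D\<^sup>2 - 4)) / 2"
  have quad: "\<rho> * (D - \<rho>) = 1"
  proof -
    have "\<rho> * (D - \<rho>) = (D\<^sup>2 - (csqrt (D\<^sup>2 - 4))\<^sup>2) / 4"
      by (simp add: \<rho>_def field_simps power2_eq_square)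
    then show ?thesis by simp
  qed
  have \<rho>: "\<rho> \<noteq> 0" "\<rho> + 1 / \<rho> = D"
  proof -
    show "\<rho> \<noteq> 0" using quad by auto
    then show "\<rho> + 1 / \<rho> = D" using quad by (simp add: field_simps)
  qed
  define \<mu> where "\<mu> = norm m11 + norm m12 + norm m21 + norm m22"
  have \<mu>: "0 \<le> \<mu>" "norm m11 \<le> \<mu>" "norm m12 \<le> \<mu>" "norm m21 \<le> \<mu>" "norm m22 \<le> \<mu>" by (simp_all add: \<mu>_def)
  define B where "B = ((2 * \<mu> + 2) * C + (2 + norm D)) * exp (growth z)"
  have B: "0 \<le> B" using \<mu> C by (simp add: B_def)
  have base: "norm (U (x + 2) - D * U (x + 1) + U x) \<le> B * integral {0..3} (\<lambda>t. norm (g t))"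
    if s: "solves z {0..3} g U W" and x: "x \<in> {0..1}" for g U W x
  proof -
    let ?G = "integral {0..3} (\<lambda>t. norm (g t))"
    have gi: "g absolutely_integrable_on {0..3}" by (rule solves_integrable[OF s])
    have G0: "0 \<le> ?G" using gi by (intro integral_nonneg) (auto simp: absolutely_integrable_on_def)
    have sh: "solves z {0..1} (\<lambda>x. g (x + of_int j)) (\<lambda>x. U (x + of_int j)) (\<lambda>x. W (x + of_int j))" if "0 \<le> j" "j \<le> 2" for j
      by (rule solves_shift) (rule solves_subset[OF s], use that in auto)
    have s0: "solves z {0..1} g U W" using sh[of 0] by simp
    have s1: "solves z {0..1} (\<lambda>x. g (x + 1)) (\<lambda>x. U (x + 1)) (\<lambda>x. W (x + 1))" using sh[of 1] by simp
    have s2: "solves z {0..1} (\<lambda>x. g (x + 2)) (\<lambda>x. U (x + 2)) (\<lambda>x. W (x + 2))" using sh[of 2] by simp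
    let ?V = "\<lambda>x. U (x + 2) - D * U (x + 1) + U x"
    let ?Y = "\<lambda>x. W (x + 2) - D * W (x + 1) + W x"
    let ?h = "\<lambda>x. g (x + 2) - D * g (x + 1) + g x"
    have sV: "solves z {0..1} ?h ?V ?Y"
      by (intro solves_add solves_diff solves_mult s0 s1 s2)
    have Gs: "integral {0..1} (\<lambda>t. norm (g (t + 2))) \<le> ?G" "integral {0..1} (\<lambda>t. norm (g (t + 1))) \<le> ?G"
       "integral {0..1} (\<lambda>t. norm (g t)) \<le> ?G"
      using integral_norm_shift_le[OF gi, of 2] integral_norm_shift_le[OF gi, of 1] integral_norm_shift_le[OF gi, of 0] by auto
    have nh: "integral {0..1} (\<lambda>t. norm (?h t)) \<le> (2 + norm D) * ?G"
    proof -
      have i: "(\<lambda>t. norm (g (t + 2))) integrable_on {0..1}" "(\<lambda>t. norm (g (t + 1))) integrable_on {0..1}" "(\<lambda>t. norm (g t)) integrable_on {0..1}"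
        using solves_integrable[OF s2] solves_integrable[OF s1] solves_integrable[OF s0] by (auto simp: absolutely_integrable_on_def)
      have "integral {0..1} (\<lambda>t. norm (?h t)) \<le> integral {0..1} (\<lambda>t. norm (g (t + 2)) + norm D * norm (g (t + 1)) + norm (g t))"
      proof (rule integral_le)
        show "(\<lambda>t. norm (?h t)) integrable_on {0..1}" using solves_integrable[OF sV] by (simp add: absolutely_integrable_on_def)
        show "(\<lambda>t. norm (g (t + 2)) + norm D * norm (g (t + 1)) + norm (g t)) integrable_on {0..1}"
          by (intro integrable_add integrable_on_mult_right i)
        show "norm (?h t) \<le> norm (g (t + 2)) + norm D * norm (g (t + 1)) + norm (g t)" for t
          using norm_triangle_ineq[of "g (t + 2) - D * g (t + 1)" "g t"] norm_triangle_ineq4[of "g (t + 2)" "D * g (t + 1)"]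
          by (simp add: norm_mult)
      qed
      also have "\<dots> = integral {0..1} (\<lambda>t. norm (g (t + 2))) + norm D * integral {0..1} (\<lambda>t. norm (g (t + 1))) + integral {0..1} (\<lambda>t. norm (g t))"
        using i by (subst integral_add, (intro integrable_add integrable_on_mult_right i)+, subst integral_add, (intro integrable_on_mult_right i)+, simp)
      also have "\<dots> \<le> ?G + norm D * ?G + ?G"
        by (intro add_mono mult_left_mono Gs) simp
      finally show ?thesis by (simp add: algebra_simps)
    qed
    define e f e' f' where "e = U 1 - (m11 * U 0 + m12 * W 0)" and "f = W 1 - (m21 * U 0 + m22 * W 0)"
      and "e' = U 2 - (m11 * U 1 + m12 * W 1)" and "f' = W 2 - (m21 * U 1 + m22 * W 1)"
    have ef: "norm e + norm f \<le> C * ?G"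
      using mon[OF s0] mult_left_mono[OF Gs(3) C] by (simp add: e_def f_def)
    have ef': "norm e' + norm f' \<le> C * ?G"
      using mon[OF s1] mult_left_mono[OF Gs(2) C] by (simp add: e'_def f'_def)
    \<comment> \<open>Cayley-Hamilton: the coefficient of the initial value is the determinant minus one.\<close>
    have V0: "?V 0 = m12 * f - m22 * e + e'"
    proof -
      have "?V 0 - (m12 * f - m22 * e + e') = U 0 * (1 - (m11 * m22 - m12 * m21))"
        by (simp add: D_def e_def f_def e'_def algebra_simps)
      then show ?thesis using det by simp
    qed
    have Y0: "?Y 0 = m21 * e - m11 * f + f'"
    proof -
      have "?Y 0 - (m21 * e - m11 * f + f') = W 0 * (1 - (m11 * m22 - m12 * m21))"
        by (simp add: D_def e_def f_def f'_def algebra_simps)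
      then show ?thesis using det by simp
    qed
    have nV: "norm (?V 0) \<le> \<mu> * norm f + \<mu> * norm e + norm e'"
    proof -
      have "norm (?V 0) \<le> norm (m12 * f) + norm (m22 * e) + norm e'"
        unfolding V0 using norm_triangle_ineq[of "m12 * f - m22 * e" e'] norm_triangle_ineq4[of "m12 * f" "m22 * e"] by linarith
      also have "\<dots> \<le> \<mu> * norm f + \<mu> * norm e + norm e'"
        unfolding norm_mult by (intro add_mono mult_right_mono \<mu>) auto
      finally show ?thesis .
    qed
    have nY: "norm (?Y 0) \<le> \<mu> * norm e + \<mu> * norm f + norm f'"
    proof -
      have "norm (?Y 0) \<le> norm (m21 * e) + norm (m11 * f) + norm f'"
        unfolding Y0 using norm_triangle_ineq[of "m21 * e - m11 * f" f'] norm_triangle_ineq4[of "m21 * e" "m11 * f"] by linarith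
      also have "\<dots> \<le> \<mu> * norm e + \<mu> * norm f + norm f'"
        unfolding norm_mult by (intro add_mono mult_right_mono \<mu>) auto
      finally show ?thesis .
    qed
    have n0: "norm (?V 0) + norm (?Y 0) \<le> (2 * \<mu> + 2) * C * ?G"
    proof -
      have "norm (?V 0) + norm (?Y 0) \<le> 2 * \<mu> * (norm e + norm f) + (norm e' + norm f')"
        using nV nY norm_ge_zero[of e'] norm_ge_zero[of f'] by (simp add: algebra_simps)
      also have "\<dots> \<le> 2 * \<mu> * (C * ?G) + C * ?G"
        using \<mu>(1) by (intro add_mono mult_left_mono ef ef') auto
      also have "\<dots> \<le> (2 * \<mu> + 2) * C * ?G" using C G0 mult_nonneg_nonneg[OF C G0] by (simp add: algebra_simps)
      finally show ?thesis .
    qed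
    have "norm (?V x) \<le> norm (?V x) + norm (?Y x)" by simp
    also have "\<dots> \<le> (norm (?V 0) + norm (?Y 0) + integral {0..1} (\<lambda>t. norm (?h t))) * exp (growth z * (x - 0))"
      by (rule solves_bound[OF sV x])
    also have "\<dots> \<le> ((2 * \<mu> + 2) * C * ?G + (2 + norm D) * ?G) * exp (growth z)"
    proof (rule mult_mono)
      show "norm (?V 0) + norm (?Y 0) + integral {0..1} (\<lambda>t. norm (?h t)) \<le> (2 * \<mu> + 2) * C * ?G + (2 + norm D) * ?G"
        using n0 nh by linarith
      have "growth z * x \<le> growth z * 1" using x growth_pos[of z] by (intro mult_left_mono) auto
      then show "exp (growth z * (x - 0)) \<le> exp (growth z)" by simp
    qed (use \<mu> C G0 in auto)
    also have "\<dots> = B * ?G" by (simp add: B_def algebra_simps)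
    finally show ?thesis .
  qed
  have "norm (U (x + 2) - (\<rho> + 1 / \<rho>) * U (x + 1) + U x) \<le> B * integral {of_int k..of_int k + 3} (\<lambda>t. norm (g t))"
    if s: "solves z {of_int k..of_int k + 3} g U W" and x: "x \<in> {of_int k..of_int k + 1}" for g U W k x
  proof -
    have "solves z {0..3} (\<lambda>x. g (x + of_int k)) (\<lambda>x. U (x + of_int k)) (\<lambda>x. W (x + of_int k))"
      by (rule solves_shift) (use s in \<open>simp add: add.commute\<close>)
    from base[OF this, of "x - of_int k"]
    have "norm (U (x + 2) - D * U (x + 1) + U x) \<le> B * integral {0..3} (\<lambda>t. norm (g (t + of_int k)))"
      using x by (simp add: algebra_simps)
    also have "integral {0..3} (\<lambda>t. norm (g (t + of_int k))) = integral {of_int k..of_int k + 3} (\<lambda>t. norm (g t))"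
      using integral_shift_Icc_real[of 0 3 "\<lambda>t. norm (g t)" "of_int k"] by (simp add: o_def add.commute)
    finally show ?thesis by (simp add: \<rho>)
  qed
  then have "floquet_multiplier z \<rho>" unfolding floquet_multiplier_def using \<rho>(1) B by blast
  then show ?thesis by blast
qed

end

text \<open>Square the pointwise bounds and sum over unit intervals. The Cauchy-Schwarz inequality on
intervals of length three gives a factor 3, and each point lies in three of these intervals.\<close>

lemma L2_norm_le_of_unit_intervals:
  fixes V g :: "real \<Rightarrow> complex"
  assumes V: "V \<in> L2 UNIV" and g: "g \<in> L2 UNIV" and C: "0 \<le> C"
    and le: "\<And>(k::int) x. x \<in> {of_int k..of_int k + 1} \<Longrightarrow>
      norm (V x) \<le> C * integral {of_int k..of_int k + 3} (\<lambda>t. norm (g t))"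
  shows "L2_norm UNIV V \<le> 3 * C * L2_norm UNIV g"
proof -
  let ?v = "\<lambda>x. (cmod (V x))\<^sup>2" and ?g = "\<lambda>x. (cmod (g x))\<^sup>2"
  have S: "{s..t} \<in> sets lebesgue" for s t :: real by simp
  have VI: "V \<in> L2 {s..t}" and gI: "g \<in> L2 {s..t}" "L2_norm {s..t} g \<le> L2_norm UNIV g" for s t :: real
    using L2_subset[OF V _ S] L2_subset[OF g _ S] by auto
  have vi: "?v integrable_on {s..t}" and gi: "?g integrable_on {s..t}" for s t
    using L2_facts(4)[OF VI S] L2_facts(4)[OF gI(1) S] by auto
  define I where "I s t = integral {s..t} ?g" for s t
  have I_le: "I s t \<le> (L2_norm UNIV g)\<^sup>2" for s t
    unfolding I_def L2_facts(5)[OF gI(1) S, symmetric] by (intro power_mono gI L2_norm_nonneg)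
  have I_add: "I s t + I t r = I s r" if "s \<le> t" "t \<le> r" for s t r
    unfolding I_def by (intro Henstock_Kurzweil_Integration.integral_combine that gi)
  have unit: "integral {of_int k..of_int k + 1} ?v \<le> 3 * C\<^sup>2 * I (of_int k) (of_int k + 3)" for k :: int
  proof -
    have b: "?v x \<le> 3 * C\<^sup>2 * I (of_int k) (of_int k + 3)" if x: "x \<in> {of_int k..of_int k + 1}" for x
    proof -
      have "norm (V x) \<le> C * integral {of_int k..of_int k + 3} (\<lambda>t. norm (g t))" by (rule le[OF x])
      also have "\<dots> \<le> C * (sqrt (of_int k + 3 - of_int k) * L2_norm {of_int k..of_int k + 3} g)"
        by (intro mult_left_mono C L2_Icc_integral_le(2) gI) simp
      finally have "?v x \<le> (C * (sqrt 3 * L2_norm {of_int k..of_int k + 3} g))\<^sup>2"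
        by (intro power_mono) auto
      then show ?thesis by (simp add: power_mult_distrib I_def L2_facts(5)[OF gI(1) S] mult_ac)
    qed
    have "integral {of_int k..of_int k + 1} ?v \<le> integral {of_int k..of_int k + 1 :: real} (\<lambda>_. 3 * C\<^sup>2 * I (of_int k) (of_int k + 3))"
      by (intro integral_le vi b) auto
    then show ?thesis by simp
  qed
  have sum: "integral {of_int k..of_int k + real m} ?v
      \<le> 3 * C\<^sup>2 * (I (of_int k) (of_int k + real m) + I (of_int k + 1) (of_int k + real m + 1) + I (of_int k + 2) (of_int k + real m + 2))"
    for k :: int and m
  proof (induction m)
    case 0
    then show ?case by (simp add: I_def)
  next
    case (Suc m)
    let ?k = "of_int k :: real" and ?j = "of_int (k + int m) :: real"
    have j: "?j = ?k + real m" by simp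
    have "integral {?k..?k + real (Suc m)} ?v = integral {?k..?j} ?v + integral {?j..?j + 1} ?v"
      using Henstock_Kurzweil_Integration.integral_combine[of ?k ?j "?j + 1" ?v] vi by (simp add: add_ac)
    also have "\<dots> \<le> 3 * C\<^sup>2 * (I ?k ?j + I (?k + 1) (?j + 1) + I (?k + 2) (?j + 2)) + 3 * C\<^sup>2 * I ?j (?j + 3)"
      using Suc.IH unit[of "k + int m"] unfolding j by linarith
    also have "I ?j (?j + 3) = I ?j (?j + 1) + I (?j + 1) (?j + 2) + I (?j + 2) (?j + 3)"
      using I_add[of ?j "?j + 1" "?j + 2"] I_add[of ?j "?j + 2" "?j + 3"] by simp
    also have "3 * C\<^sup>2 * (I ?k ?j + I (?k + 1) (?j + 1) + I (?k + 2) (?j + 2)) + 3 * C\<^sup>2 * (I ?j (?j + 1) + I (?j + 1) (?j + 2) + I (?j + 2) (?j + 3))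
      = 3 * C\<^sup>2 * ((I ?k ?j + I ?j (?j + 1)) + (I (?k + 1) (?j + 1) + I (?j + 1) (?j + 2)) + (I (?k + 2) (?j + 2) + I (?j + 2) (?j + 3)))"
      by (simp add: algebra_simps)
    also have "\<dots> = 3 * C\<^sup>2 * (I ?k (?j + 1) + I (?k + 1) (?j + 2) + I (?k + 2) (?j + 3))"
      using I_add[of ?k ?j "?j + 1"] I_add[of "?k + 1" "?j + 1" "?j + 2"] I_add[of "?k + 2" "?j + 2" "?j + 3"] j by simp
    finally show ?case by (simp add: add_ac)
  qed
  have "(L2_norm UNIV V)\<^sup>2 \<le> 9 * C\<^sup>2 * (L2_norm UNIV g)\<^sup>2"
  proof (rule L2_norm_UNIV_le[OF V])
    fix n :: nat
    have "integral {- real n..real n} ?v = integral {of_int (- int n)..of_int (- int n) + real (2 * n)} ?v" by simp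
    also have "\<dots> \<le> 3 * C\<^sup>2 * ((L2_norm UNIV g)\<^sup>2 + (L2_norm UNIV g)\<^sup>2 + (L2_norm UNIV g)\<^sup>2)"
      by (rule order_trans[OF sum]) (intro mult_left_mono add_mono I_le, simp)
    finally show "integral {- real n..real n} ?v \<le> 9 * C\<^sup>2 * (L2_norm UNIV g)\<^sup>2" by simp
  qed
  also have "\<dots> = (3 * C * L2_norm UNIV g)\<^sup>2" by (simp add: power_mult_distrib)
  finally show ?thesis by (rule power2_le_imp_le) (use C L2_norm_nonneg[of UNIV g] in simp)
qed

text \<open>The modulus is periodic on a half-line, so that the integral of its square over \<open>n\<close> periods is \<open>n\<close> times that
over one period, yet it is bounded independently of \<open>n\<close>.\<close>

lemma quasi_periodic_L2_eq_0:
  assumes Y: "continuous_on UNIV Y" "Y \<in> L2 UNIV" and c: "cmod c = 1"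
    and quasi: "\<And>x. x \<le> X \<Longrightarrow> Y (x + 1) = c * Y x" and x: "x \<le> X"
  shows "Y x = 0"
proof -
  let ?f = "\<lambda>x. (cmod (Y x))\<^sup>2"
  have cf: "continuous_on A ?f" for A by (intro continuous_intros continuous_on_subset[OF Y(1)]) auto
  have i: "?f integrable_on {s..t}" for s t by (intro integrable_continuous_real cf)
  have per: "?f (y - real n) = ?f y" if "y \<le> X" for y n
  proof (induction n)
    case (Suc n)
    have "Y (y - real (Suc n) + 1) = c * Y (y - real (Suc n))" using that by (intro quasi) simp
    moreover have "y - real (Suc n) + 1 = y - real n" by simp
    ultimately have "cmod (Y (y - real n)) = cmod (Y (y - real (Suc n)))" using c by (simp add: norm_mult)
    then show ?case using Suc by simp
  qed simp
  define J where "J = integral {x - 1..x} ?f"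
  have J: "integral {x - real n..x} ?f = real n * J" for n
  proof (induction n)
    case (Suc n)
    have "integral {x - real (Suc n)..x} ?f = integral {x - real (Suc n)..x - real n} ?f + integral {x - real n..x} ?f"
      by (intro Henstock_Kurzweil_Integration.integral_combine[symmetric] i) auto
    also have "integral {x - real (Suc n)..x - real n} ?f = integral {x - 1..x} (\<lambda>y. ?f (y - real n))"
      using integral_shift_Icc_real[of "x - 1" x ?f "- real n"] by (simp add: o_def add.commute algebra_simps)
    also have "\<dots> = J" unfolding J_def by (rule integral_cong) (use per x in auto)
    finally show ?case using Suc by (simp add: algebra_simps)
  qed simp
  have J0: "0 \<le> J" unfolding J_def by (intro integral_nonneg i) auto
  have LY: "(L2_norm UNIV Y)\<^sup>2 = integral UNIV ?f" by (rule L2_facts(5)[OF Y(2)]) simp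
  have "real n * J \<le> (L2_norm UNIV Y)\<^sup>2" for n
    unfolding J[symmetric] LY
    by (intro integral_subset_le i L2_facts(4)[OF Y(2)]) auto
  then have "J = 0"
    using J0 by (metis mult.commute reals_Archimedean3 order.order_iff_strict not_le)
  then have "\<forall>y\<in>{x - 1..x}. ?f y = 0"
    unfolding J_def using integral_eq_0_iff[of "x - 1" x ?f] cf by auto
  then show ?thesis by simp
qed

lemma integral_zero_imp_continuous_zero:
  fixes w :: "real \<Rightarrow> complex"
  assumes w: "continuous_on {s..t} w" and 0: "\<And>y. y \<in> {s..t} \<Longrightarrow> integral {s..y} w = 0" and x: "s < x" "x < t"
  shows "w x = 0"
proof -
  have "((\<lambda>y. integral {s..y} w) has_vector_derivative w x) (at x within {s..t})"
    by (rule integral_has_vector_derivative[OF w]) (use x in auto)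
  then have "((\<lambda>y. 0) has_vector_derivative w x) (at x within {s..t})"
    by (rule has_vector_derivative_transform[rotated 2]) (use 0 x in auto)
  then have "((\<lambda>y. 0) has_vector_derivative w x) (at x)" using x by (simp add: at_within_Icc_at)
  moreover have "((\<lambda>y. 0 :: complex) has_vector_derivative 0) (at x)" by simp
  ultimately show ?thesis by (rule vector_derivative_unique_at)
qed

lemma exists_point_le_L2_norm:
  assumes U: "continuous_on {s..t} U" and st: "s < t"
  shows "\<exists>x\<in>{s..t}. norm (U x) \<le> L2_norm {s..t} U / sqrt (t - s)"
proof -
  obtain x where x: "x \<in> {s..t}" "\<And>y. y \<in> {s..t} \<Longrightarrow> norm (U x) \<le> norm (U y)"
    using continuous_attains_inf[of "{s..t}" "\<lambda>x. norm (U x)"] continuous_on_norm[OF U] st by auto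
  have S: "{s..t} \<in> sets lebesgue" by simp
  have "(sqrt (t - s) * norm (U x))\<^sup>2 = integral {s..t} (\<lambda>_. (norm (U x))\<^sup>2)"
    using st by (simp add: power_mult_distrib)
  also have "\<dots> \<le> integral {s..t} (\<lambda>y. (norm (U y))\<^sup>2)"
    using x(2) by (intro integral_le L2_facts(4)[OF continuous_L2_Icc[OF U] S]) (auto intro: power_mono)
  also have "\<dots> = (L2_norm {s..t} U)\<^sup>2" by (rule L2_facts(5)[OF continuous_L2_Icc[OF U] S, symmetric])
  finally have "sqrt (t - s) * norm (U x) \<le> L2_norm {s..t} U"
    using L2_norm_nonneg by (rule power2_le_imp_le)
  then show ?thesis using st x(1) by (intro bexI[of _ x]) (auto simp: pos_le_divide_eq mult.commute)
qed

context periodic_coefficients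
begin

lemma solves_UNIV_continuous:
  assumes "solves z UNIV g U W"
  shows "continuous_on A U" "continuous_on A W"
  using assms primitive_on_continuous unfolding solves_def by blast+

text \<open>Apply the lower bound for \<open>T - c\<close> with \<open>c = 1 / \<rho>\<close> and \<open>c = \<rho>\<close> to the factorization of the
recurrence. This a priori estimate replaces the boundedness of the resolvent.\<close>

lemma non_unimodular_estimate:
  assumes \<rho>: "floquet_multiplier z \<rho>" "cmod \<rho> \<noteq> 1"
  shows "\<exists>M\<ge>0. \<forall>g U W. solves z UNIV g U W \<longrightarrow> U \<in> L2 UNIV \<longrightarrow> g \<in> L2 UNIV \<longrightarrow>
    L2_norm UNIV U \<le> M * L2_norm UNIV g"
proof -
  obtain C where C: "0 \<le> C" and rec: "\<And>g U W (k::int) x. solves z {of_int k..of_int k + 3} g U W \<Longrightarrow> x \<in> {of_int k..of_int k + 1} \<Longrightarrow>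
       norm (U (x + 2) - (\<rho> + 1 / \<rho>) * U (x + 1) + U x) \<le> C * integral {of_int k..of_int k + 3} (\<lambda>t. norm (g t))"
    and \<rho>0: "\<rho> \<noteq> 0"
    using \<rho>(1) unfolding floquet_multiplier_def by blast
  define d where "d = \<bar>1 - cmod \<rho>\<bar> * \<bar>1 - cmod (1 / \<rho>)\<bar>"
  have d: "d > 0" using \<rho>(2) \<rho>0 by (simp add: d_def norm_divide)
  show ?thesis
  proof (intro exI[of _ "3 * C / d"] conjI allI impI)
    show "0 \<le> 3 * C / d" using C d by simp
    fix g U W assume s: "solves z UNIV g U W" and U: "U \<in> L2 UNIV" and g: "g \<in> L2 UNIV"
    have cU: "continuous_on UNIV U" by (rule solves_UNIV_continuous[OF s])
    define Y where "Y x = U (x + 1) - (1 / \<rho>) * U x" for x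
    have cY: "continuous_on UNIV Y" unfolding Y_def
      by (intro continuous_intros cU continuous_on_compose2[OF cU]) auto
    have Y: "Y \<in> L2 UNIV" unfolding Y_def by (intro L2_diff(1) L2_mult U L2_shift cU)
    define V where "V x = Y (x + 1) - \<rho> * Y x" for x
    have V: "V \<in> L2 UNIV" unfolding V_def by (intro L2_diff(1) L2_mult Y L2_shift cY)
    have Veq: "V x = U (x + 2) - (\<rho> + 1 / \<rho>) * U (x + 1) + U x" for x
      using \<rho>0 by (simp add: V_def Y_def algebra_simps)
    have "\<bar>1 - cmod \<rho>\<bar> * (\<bar>1 - cmod (1 / \<rho>)\<bar> * L2_norm UNIV U) \<le> \<bar>1 - cmod \<rho>\<bar> * L2_norm UNIV Y"
      unfolding Y_def by (intro mult_left_mono L2_norm_shift_diff_ge[OF cU U]) simp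
    also have "\<dots> \<le> L2_norm UNIV V" unfolding V_def by (rule L2_norm_shift_diff_ge[OF cY Y])
    also have "\<dots> \<le> 3 * C * L2_norm UNIV g"
      by (rule L2_norm_le_of_unit_intervals[OF V g C])
        (unfold Veq, rule rec, rule solves_subset[OF s], auto)
    finally have "L2_norm UNIV U * d \<le> 3 * C * L2_norm UNIV g" by (simp add: d_def mult_ac)
    then show "L2_norm UNIV U \<le> 3 * C / d * L2_norm UNIV g" using d by (simp add: pos_le_divide_eq)
  qed
qed

text \<open>No nonzero solution of the unperturbed equation on a half-line is square integrable. The factors
\<open>T - \<rho>\<close> and \<open>T - 1 / \<rho>\<close> are removed one after the other. The margin of three comes from
the reach of the recurrence.\<close>

lemma unimodular_vanishing:
  assumes \<rho>: "floquet_multiplier z \<rho>" "cmod \<rho> = 1" and s: "solves z UNIV g U W" and U: "U \<in> L2 UNIV"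
    and g: "\<And>x. x \<le> of_int m \<Longrightarrow> g x = 0"
  shows "x \<le> of_int m - 3 \<Longrightarrow> U x = 0" "x < of_int m - 3 \<Longrightarrow> W x = 0"
proof -
  obtain C where C: "0 \<le> C" and rec: "\<And>g U W (k::int) x. solves z {of_int k..of_int k + 3} g U W \<Longrightarrow> x \<in> {of_int k..of_int k + 1} \<Longrightarrow>
       norm (U (x + 2) - (\<rho> + 1 / \<rho>) * U (x + 1) + U x) \<le> C * integral {of_int k..of_int k + 3} (\<lambda>t. norm (g t))"
    and \<rho>0: "\<rho> \<noteq> 0"
    using \<rho>(1) unfolding floquet_multiplier_def by blast
  have cU: "continuous_on A U" and cW: "continuous_on A W" for A by (rule solves_UNIV_continuous[OF s])+
  define Y where "Y x = U (x + 1) - (1 / \<rho>) * U x" for x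
  have cY: "continuous_on UNIV Y" unfolding Y_def
    by (intro continuous_intros cU continuous_on_compose2[OF cU[of UNIV]]) auto
  have Y: "Y \<in> L2 UNIV" unfolding Y_def by (intro L2_diff(1) L2_mult U L2_shift cU)
  have rec0: "U (x + 2) - (\<rho> + 1 / \<rho>) * U (x + 1) + U x = 0" if x: "x \<le> of_int m - 3" for x
  proof -
    have k: "of_int \<lfloor>x\<rfloor> \<le> x" "x \<le> of_int \<lfloor>x\<rfloor> + 1" by linarith+
    have "integral {of_int \<lfloor>x\<rfloor>..of_int \<lfloor>x\<rfloor> + 3} (\<lambda>t. norm (g t)) = integral {of_int \<lfloor>x\<rfloor>..of_int \<lfloor>x\<rfloor> + 3 :: real} (\<lambda>_. 0)"
    proof (rule integral_cong)
      fix t assume "t \<in> {of_int \<lfloor>x\<rfloor>..of_int \<lfloor>x\<rfloor> + 3 :: real}"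
      then have "t \<le> of_int \<lfloor>x\<rfloor> + 3" by simp
      then have "t \<le> of_int m" using k(1) x by linarith
      then show "norm (g t) = 0" using g by simp
    qed
    then have "norm (U (x + 2) - (\<rho> + 1 / \<rho>) * U (x + 1) + U x) \<le> 0"
      using rec[OF solves_subset[OF s subset_UNIV], of x "\<lfloor>x\<rfloor>"] k by simp
    then show ?thesis by simp
  qed
  have Y0: "Y x = 0" if "x \<le> of_int m - 3" for x
  proof (rule quasi_periodic_L2_eq_0[OF cY Y \<rho>(2) _ that])
    show "Y (x + 1) = \<rho> * Y x" if "x \<le> of_int m - 3" for x
      using rec0[OF that] \<rho>0 by (simp add: Y_def algebra_simps)
  qed
  have U0: "U x = 0" if "x \<le> of_int m - 3" for x
  proof (rule quasi_periodic_L2_eq_0[OF cU U _ _ that])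
    show "cmod (1 / \<rho>) = 1" using \<rho>(2) by (simp add: norm_divide)
    show "U (x + 1) = 1 / \<rho> * U x" if "x \<le> of_int m - 3" for x
      using Y0[OF that] by (simp add: Y_def)
  qed
  then show "x \<le> of_int m - 3 \<Longrightarrow> U x = 0" by blast
  show "W x = 0" if x: "x < of_int m - 3"
  proof -
    have "W x / of_real (p x) = 0"
    proof (rule integral_zero_imp_continuous_zero[of "x - 1" "of_int m - 3" "\<lambda>x. W x / of_real (p x)"])
      show "continuous_on {x - 1..of_int m - 3} (\<lambda>x. W x / of_real (p x))"
        by (intro continuous_intros cW p_continuous) (use p_pos in \<open>simp add: less_imp_neq[symmetric]\<close>)
      show "integral {x - 1..y} (\<lambda>x. W x / of_real (p x)) = 0" if "y \<in> {x - 1..of_int m - 3}" for y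
        using s that U0[of y] U0[of "x - 1"] x unfolding solves_def
        by (subst primitive_onD(2)[where I=UNIV and F=U]) auto
    qed (use x in auto)
    then show ?thesis using p_pos[of x] by simp
  qed
qed

text \<open>The \<open>L\<^sub>2\<close>-norms over one period control the values at its end. On this period \<open>W\<close> differs from \<open>W s\<close> at most by
a constant \<open>B\<close>; hence \<open>U\<close> differs from an affine function of \<open>\<integral>1 / p\<close> with slope \<open>W s\<close> by a bounded amount.
Comparing two points, one in the first and one in the last third of the period, at which \<open>\<bar>U\<bar>\<close> is at
most twice the sum of the two norms, bounds the slope.\<close>

lemma initial_data_bound:
  "\<exists>c\<ge>0. \<forall>g U W. solves z {s - 1..s} g U W \<longrightarrow> g \<in> L2 {s - 1..s} \<longrightarrow>
     norm (U s) + norm (W s) \<le> c * (L2_norm {s - 1..s} U + L2_norm {s - 1..s} g)"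
proof -
  obtain P where P: "P > 0" "\<And>x. p x \<le> P" using p_bounded by blast
  let ?\<kappa> = "growth z"
  have \<kappa>: "?\<kappa> > 0" by (rule growth_pos)
  \<comment> \<open>Read off from the estimates \<open>Ws\<close> and \<open>Us\<close> below.\<close>
  define c1 where "c1 = 3 * P * (4 + ?\<kappa> * (?\<kappa> + 1))"
  define c2 where "c2 = 2 + ?\<kappa> * (c1 + (?\<kappa> + 1))"
  have c: "0 \<le> c1" "0 \<le> c2" using P \<kappa> by (auto simp: c1_def c2_def)
  show ?thesis
  proof (intro exI[of _ "c1 + c2"] conjI allI impI)
    show "0 \<le> c1 + c2" using c by simp
    fix g U W assume sol: "solves z {s - 1..s} g U W" and g: "g \<in> L2 {s - 1..s}"
    define A where "A = L2_norm {s - 1..s} U + L2_norm {s - 1..s} g"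
    have A: "0 \<le> A" "L2_norm {s - 1..s} U \<le> A" "L2_norm {s - 1..s} g \<le> A"
      by (simp_all add: A_def L2_norm_nonneg)
    have cU: "continuous_on {s - 1..s} U" and cW: "continuous_on {s - 1..s} W" by (rule solves_continuous[OF sol])+
    define w where "w x = (of_real (q x) - z) * U x - g x" for x
    have prW: "primitive_on {s - 1..s} w W" using sol unfolding solves_def w_def by blast
    have wi: "w absolutely_integrable_on {s - 1..s}" by (rule primitive_onD(1)[OF prW]) auto
    have prU: "primitive_on {s - 1..s} (\<lambda>x. W x / of_real (p x)) U" using sol by (simp add: solves_def)
    define B where "B = integral {s - 1..s} (\<lambda>x. norm (w x))"
    have B: "B \<le> (?\<kappa> + 1) * A"
    proof -
      have Ui: "(\<lambda>x. norm (U x)) integrable_on {s - 1..s}" by (intro integrable_continuous_real continuous_intros cU)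
      have gi: "(\<lambda>x. norm (g x)) integrable_on {s - 1..s}" using L2_Icc_integral_le(1)[OF g] by (simp add: absolutely_integrable_on_def)
      have "B \<le> integral {s - 1..s} (\<lambda>x. ?\<kappa> * norm (U x) + norm (g x))"
        unfolding B_def
      proof (rule integral_le)
        show "norm (w x) \<le> ?\<kappa> * norm (U x) + norm (g x)" for x
          using norm_triangle_ineq4[of "(of_real (q x) - z) * U x" "g x"] norm_q_mult_le[of x z "U x"] unfolding w_def by linarith
      qed (use wi Ui gi in \<open>auto simp: absolutely_integrable_on_def intro!: integrable_add integrable_on_mult_right\<close>)
      also have "\<dots> = ?\<kappa> * integral {s - 1..s} (\<lambda>x. norm (U x)) + integral {s - 1..s} (\<lambda>x. norm (g x))"
        using Ui gi by (subst integral_add) (auto intro!: integrable_on_mult_right)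
      also have "\<dots> \<le> ?\<kappa> * L2_norm {s - 1..s} U + L2_norm {s - 1..s} g"
        using L2_Icc_integral_le(2)[OF continuous_L2_Icc[OF cU]] L2_Icc_integral_le(2)[OF g] \<kappa>
        by (intro add_mono mult_left_mono) auto
      also have "\<dots> \<le> ?\<kappa> * A + A" using A \<kappa> by (intro add_mono mult_left_mono) auto
      finally show ?thesis by (simp add: algebra_simps)
    qed
    have WB: "norm (W x - W s) \<le> B" if x: "x \<in> {s - 1..s}" for x
    proof -
      have "norm (W s - W x) \<le> integral {x..s} (\<lambda>t. norm (w t))"
        using x by (intro primitive_on_norm_diff_le[OF prW]) auto
      also have "\<dots> \<le> B" unfolding B_def
        using x wi set_integrable_subset[OF wi, of "{x..s}"]
        by (intro integral_subset_le) (auto simp: absolutely_integrable_on_def)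
      finally show ?thesis by (simp add: norm_minus_commute)
    qed
    have point: "\<exists>x\<in>{l..r}. norm (U x) \<le> 2 * A" if lr: "{l..r} \<subseteq> {s - 1..s}" "r - l = 1/3" for l r
    proof -
      have cU': "continuous_on {l..r} U" using cU lr(1) by (rule continuous_on_subset)
      obtain x where x: "x \<in> {l..r}" "norm (U x) \<le> L2_norm {l..r} U / sqrt (r - l)"
        using exists_point_le_L2_norm[OF cU'] lr(2) by auto
      have LA: "L2_norm {l..r} U \<le> A"
        using L2_subset(2)[OF continuous_L2_Icc[OF cU], of "{l..r}"] lr(1) A by simp
      have "norm (U x) \<le> sqrt 3 * L2_norm {l..r} U"
        using x(2) unfolding lr(2) by (simp add: real_sqrt_divide mult.commute)
      also have "\<dots> \<le> sqrt 3 * A" by (rule mult_left_mono[OF LA]) simp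
      also have "sqrt 3 * A \<le> 2 * A" using A(1) by (intro mult_right_mono real_le_lsqrt) auto
      finally show ?thesis using x(1) by blast
    qed
    obtain x1 where x1: "x1 \<in> {s - 1..s - 2/3}" "norm (U x1) \<le> 2 * A" using point[of "s - 1" "s - 2/3"] by auto
    obtain x2 where x2: "x2 \<in> {s - 1/3..s}" "norm (U x2) \<le> 2 * A" using point[of "s - 1/3" s] by auto
    have diffU: "norm (U y - U x - W s * of_real (integral {x..y} (\<lambda>t. 1 / p t))) \<le> ?\<kappa> * B"
      if xy: "x \<in> {s - 1..s}" "y \<in> {s - 1..s}" "x \<le> y" for x y
    proof -
      have sub: "{x..y} \<subseteq> {s - 1..s}" using xy by auto
      have cW': "continuous_on {x..y} W" using cW sub by (rule continuous_on_subset)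
      have i1: "(\<lambda>t. W t / of_real (p t)) integrable_on {x..y}" "(\<lambda>t. W s / of_real (p t)) integrable_on {x..y}"
        using inverse_p_integrable[OF cW'] inverse_p_integrable[OF continuous_on_const, of x y "W s"]
        by (simp_all add: absolutely_integrable_on_def)
      have ip: "(\<lambda>t. 1 / p t) integrable_on {x..y}"
        by (intro integrable_continuous_real continuous_intros p_continuous) (use p_pos in \<open>simp add: less_imp_neq[symmetric]\<close>)
      have "W s * of_real (integral {x..y} (\<lambda>t. 1 / p t)) = integral {x..y} (\<lambda>t. W s * of_real (1 / p t))"
        using has_integral_mult_right[OF has_integral_of_real[OF integrable_integral[OF ip]], of "W s"] by (simp add: integral_unique)
      also have "\<dots> = integral {x..y} (\<lambda>t. W s / of_real (p t))" by simp
      finally have "U y - U x - W s * of_real (integral {x..y} (\<lambda>t. 1 / p t)) = integral {x..y} (\<lambda>t. W t / of_real (p t) - W s / of_real (p t))"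
        using primitive_onD(2)[OF prU xy] integral_diff[OF i1] by simp
      also have "norm \<dots> \<le> integral {x..y} (\<lambda>t. ?\<kappa> * B)"
      proof (rule integral_norm_bound_integral)
        fix t assume t: "t \<in> {x..y}"
        have "norm (W t / of_real (p t) - W s / of_real (p t)) = norm ((W t - W s) / of_real (p t))" by (simp add: diff_divide_distrib)
        also have "\<dots> \<le> ?\<kappa> * norm (W t - W s)" by (rule norm_div_p_le)
        also have "\<dots> \<le> ?\<kappa> * B" using WB[of t] t sub \<kappa> by (intro mult_left_mono) auto
        finally show "norm (W t / of_real (p t) - W s / of_real (p t)) \<le> ?\<kappa> * B" .
      qed (auto intro!: integrable_diff i1)
      also have "\<dots> = (y - x) * (?\<kappa> * B)" using xy by simp
      also have "\<dots> \<le> 1 * (?\<kappa> * B)"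
      proof (rule mult_right_mono)
        show "0 \<le> ?\<kappa> * B" using WB[of s] \<kappa> xy by simp
      qed (use xy in auto)
      finally show ?thesis by simp
    qed
    have Ws: "norm (W s) \<le> c1 * A"
    proof -
      let ?I = "integral {x1..x2} (\<lambda>t. 1 / p t)"
      have "(1/3) / P \<le> integral {x1..x2} (\<lambda>t. 1 / P)" using x1 x2 P by (simp add: field_simps)
      also have "\<dots> \<le> ?I"
      proof (rule integral_le)
        show "(\<lambda>t. 1 / p t) integrable_on {x1..x2}"
          by (intro integrable_continuous_real continuous_intros p_continuous) (use p_pos in \<open>simp add: less_imp_neq[symmetric]\<close>)
        show "1 / P \<le> 1 / p t" for t using P(2)[of t] p_pos[of t] by (intro divide_left_mono) auto
      qed auto
      finally have I: "1 / (3 * P) \<le> ?I" by simp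
      have "norm (W s) * (1 / (3 * P)) \<le> norm (W s) * ?I" by (intro mult_left_mono I) simp
      also have "\<dots> = norm (W s * of_real ?I)" using I P(1) order_trans[of 0 "1 / (3 * P)" ?I] by (simp add: norm_mult)
      also have "\<dots> \<le> norm (U x2 - U x1 - W s * of_real ?I) + norm (U x2) + norm (U x1)"
        using norm_triangle_ineq4[of "U x2 - U x1" "U x2 - U x1 - W s * of_real ?I"] norm_triangle_ineq4[of "U x2" "U x1"] by simp
      also have "\<dots> \<le> ?\<kappa> * B + 2 * A + 2 * A"
        using x1 x2 by (intro add_mono diffU) auto
      also have "\<dots> \<le> ?\<kappa> * ((?\<kappa> + 1) * A) + 2 * A + 2 * A" using B \<kappa> by (intro add_mono mult_left_mono) auto
      also have "\<dots> = (4 + ?\<kappa> * (?\<kappa> + 1)) * A" by (simp add: algebra_simps)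
      finally show ?thesis using P(1) by (simp add: c1_def field_simps)
    qed
    have Us: "norm (U s) \<le> c2 * A"
    proof -
      have "norm (U s - U x2) \<le> integral {x2..s} (\<lambda>t. norm (W t / of_real (p t)))"
        using x2 by (intro primitive_on_norm_diff_le[OF prU]) auto
      also have "\<dots> \<le> integral {x2..s} (\<lambda>t. ?\<kappa> * (c1 * A + B))"
      proof (rule integral_le)
        show "(\<lambda>t. norm (W t / of_real (p t))) integrable_on {x2..s}"
          using inverse_p_integrable[OF continuous_on_subset[OF cW], of x2 s] x2 by (simp add: absolutely_integrable_on_def)
        fix t assume "t \<in> {x2..s}"
        then have "norm (W t) \<le> c1 * A + B" using WB[of t] Ws x2 norm_triangle_sub[of "W t" "W s"] by auto
        then show "norm (W t / of_real (p t)) \<le> ?\<kappa> * (c1 * A + B)"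
          using norm_div_p_le[of "W t" t z] \<kappa> by (meson mult_left_mono less_imp_le order_trans)
      qed auto
      also have "\<dots> = (s - x2) * (?\<kappa> * (c1 * A + B))" using x2 by simp
      also have "\<dots> \<le> 1 * (?\<kappa> * (c1 * A + B))"
      proof (rule mult_right_mono)
        have "0 \<le> B" using WB[of s] by simp
        then show "0 \<le> ?\<kappa> * (c1 * A + B)" using c A \<kappa> by simp
      qed (use x2 in auto)
      also have "\<dots> \<le> ?\<kappa> * (c1 * A + (?\<kappa> + 1) * A)" using B \<kappa> by simp
      finally show ?thesis using x2(2) norm_triangle_sub[of "U s" "U x2"] by (simp add: c2_def algebra_simps)
    qed
    show "norm (U s) + norm (W s) \<le> (c1 + c2) * (L2_norm {s - 1..s} U + L2_norm {s - 1..s} g)"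
      using Us Ws by (simp add: A_def algebra_simps)
  qed
qed

end

section \<open>Classical representatives of Sobolev functions\<close>

lemma bounded_complex_of_real_L2:
  assumes f: "f \<in> borel_measurable borel" "\<And>x. \<bar>f x\<bar> \<le> B" and u: "u \<in> L2 S"
  shows "(\<lambda>x. of_real (f x) * u x) \<in> L2 S"
proof (rule L2_bounded_measurable_mult[OF u])
  have "(\<lambda>x. of_real (f x) :: complex) \<in> borel_measurable borel"
    by (rule measurable_compose[OF f(1)]) (intro borel_measurable_continuous_onI continuous_intros)
  then show "(\<lambda>x. of_real (f x) :: complex) \<in> borel_measurable (lebesgue_on S)"
    by (intro measurable_restrict_space1 measurable_completion) simp
  show "norm (of_real (f x) :: complex) \<le> B" for x using f(2) by simp
qed

lemma L2_norm_le_sup: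
  assumes m: "f \<in> borel_measurable (lebesgue_on {a<..<b})" and B: "\<And>x. x \<in> {a<..<b} \<Longrightarrow> norm (f x) \<le> B"
    and ab: "a < b" and B0: "0 \<le> B"
  shows "f \<in> L2 {a<..<b}" "L2_norm {a<..<b} f \<le> sqrt (b - a) * B"
proof -
  have S: "{a<..<b} \<in> sets lebesgue" by simp
  have f2: "norm ((cmod (f x))\<^sup>2) \<le> B\<^sup>2" if "x \<in> {a<..<b}" for x using B[OF that] by (simp add: power_mono)
  have ci: "(\<lambda>x. B\<^sup>2) integrable_on {a<..<b}" and ci': "integral {a<..<b} (\<lambda>x. B\<^sup>2) = (b - a) * B\<^sup>2"
    using integrable_on_open_interval_real[of "\<lambda>x. B\<^sup>2" a b] integral_open_interval_real[of a b "\<lambda>x. B\<^sup>2"] ab by auto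
  have "(\<lambda>x. (cmod (f x))\<^sup>2) absolutely_integrable_on {a<..<b}"
    using m by (intro measurable_bounded_by_integrable_imp_absolutely_integrable[OF _ S ci f2]) measurable
  then show fL: "f \<in> L2 {a<..<b}" using m by (simp add: L2_def integrable_lebesgue_on_iff[OF S])
  have "(L2_norm {a<..<b} f)\<^sup>2 \<le> integral {a<..<b} (\<lambda>x. B\<^sup>2)"
    unfolding L2_facts(5)[OF fL S] by (intro integral_le L2_facts(4)[OF fL S] ci) (use f2 in auto)
  also have "\<dots> = (sqrt (b - a) * B)\<^sup>2" using ab by (simp add: ci' power_mult_distrib)
  finally show "L2_norm {a<..<b} f \<le> sqrt (b - a) * B" by (rule power2_le_imp_le) (use ab B0 in simp)
qed

lemma sqrt_sum_squares3_le:
  fixes x y w :: real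
  assumes "0 \<le> x" "0 \<le> y" "0 \<le> w"
  shows "sqrt (x\<^sup>2 + y\<^sup>2 + w\<^sup>2) \<le> x + y + w"
proof (rule real_le_lsqrt)
  show "x\<^sup>2 + y\<^sup>2 + w\<^sup>2 \<le> (x + y + w)\<^sup>2"
    using assms by (simp add: power2_sum power2_eq_square algebra_simps add_nonneg_nonneg)
qed (use assms in auto)

context periodic_coefficients
begin

text \<open>The derivative of \<open>p\<close>, set to zero where it does not exist, is periodic because \<open>p\<close> is, although the
function that piecewise continuous differentiability provides need not be; hence it is bounded on the
whole line. This is needed for \<open>(p u')'\<close> to be square integrable.\<close>

lemma bounded_derivatives_p_inverse_p:
  "\<exists>p' B. p' \<in> borel_measurable borel \<and> (\<forall>x. \<bar>p' x\<bar> \<le> B) \<and>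
     primitive_on UNIV (\<lambda>x. of_real (p' x)) (\<lambda>x. of_real (p x)) \<and>
     primitive_on UNIV (\<lambda>x. of_real (- p' x / (p x)\<^sup>2)) (\<lambda>x. of_real (1 / p x))"
proof -
  obtain dp where dp: "piecewise_cont dp" and fin: "\<And>a b. finite {x\<in>{a..b}. \<not> (p has_real_derivative dp x) (at x)}"
    using p_C1 unfolding piecewise_C1_def by blast
  define p' where "p' x = (if p differentiable (at x) then deriv p x else 0)" for x
  have eq: "p' x = dp x" if "(p has_real_derivative dp x) (at x)" for x
    using that DERIV_imp_deriv[OF that] by (auto simp: p'_def real_differentiable_def)
  have der: "(p has_real_derivative p' x) (at x)" if "(p has_real_derivative dp x) (at x)" for x
    using that eq by simp
  have sh: "(p has_real_derivative D) (at (x + 1)) \<longleftrightarrow> (p has_real_derivative D) (at x)" for x D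
  proof -
    have "(\<lambda>x. p (x + 1)) = p" using p_periodic by (auto simp: one_periodic_def)
    then show ?thesis using DERIV_shift[of p D x 1] by simp
  qed
  have per: "one_periodic p'"
    unfolding one_periodic_def p'_def deriv_def real_differentiable_def using sh by simp
  have m: "p' \<in> borel_measurable borel"
  proof (rule measurable_discrete_difference[OF piecewise_cont_borel_measurable[OF dp]])
    show "countable {x. \<not> (p has_real_derivative dp x) (at x)}" by (rule countable_if_finite_Icc[OF fin])
    show "{x} \<in> sets borel" for x :: real by simp
    show "dp x = p' x" if "x \<in> space borel" "x \<notin> {x. \<not> (p has_real_derivative dp x) (at x)}" for x
      using eq that by simp
  qed auto
  obtain B1 where B1: "\<forall>x\<in>{0..1}. \<bar>dp x\<bar> \<le> B1" using piecewise_cont_bounded_Icc[OF dp] by blast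
  define F where "F = {x\<in>{0..1}. \<not> (p has_real_derivative dp x) (at x)}"
  have F: "finite F" unfolding F_def by (rule fin)
  define B where "B = max B1 (Max (insert 0 ((\<lambda>x. \<bar>p' x\<bar>) ` F)))"
  have B: "\<bar>p' x\<bar> \<le> B" for x
  proof (rule one_periodic_bounded[OF per])
    fix x :: real assume x: "x \<in> {0..1}"
    show "\<bar>p' x\<bar> \<le> B"
    proof (cases "x \<in> F")
      case True
      then have "\<bar>p' x\<bar> \<le> Max (insert 0 ((\<lambda>x. \<bar>p' x\<bar>) ` F))" using F by (intro Max_ge) auto
      then show ?thesis by (simp add: B_def)
    next
      case False
      then show ?thesis using x B1 eq[of x] by (force simp: F_def B_def)
    qed
  qed
  have ai: "(\<lambda>x. of_real (f x) :: complex) absolutely_integrable_on {x..y}"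
    if "f \<in> borel_measurable borel" "\<And>x. \<bar>f x\<bar> \<le> K" for f :: "real \<Rightarrow> real" and K x y :: real
  proof (rule measurable_bounded_by_integrable_imp_absolutely_integrable)
    have "(\<lambda>x. of_real (f x) :: complex) \<in> borel_measurable borel"
      by (rule measurable_compose[OF that(1)]) (intro borel_measurable_continuous_onI continuous_intros)
    then show "(\<lambda>x. of_real (f x) :: complex) \<in> borel_measurable (lebesgue_on {x..y})"
      by (intro measurable_restrict_space1 measurable_completion) simp
    show "(\<lambda>x. K) integrable_on {x..y}" by (rule integrable_const_ivl)
  qed (use that in auto)
  have fin': "finite {t \<in> {x..y}. \<not> ((\<lambda>x. of_real (f x) :: complex) has_vector_derivative of_real (f' t)) (at t)}"
    if "\<And>t. (p has_real_derivative dp t) (at t) \<Longrightarrow> (f has_real_derivative f' t) (at t)" for f f' and x y :: real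
  proof (rule finite_subset[OF _ fin[of x y]])
    show "{t \<in> {x..y}. \<not> ((\<lambda>x. of_real (f x) :: complex) has_vector_derivative of_real (f' t)) (at t)}
      \<subseteq> {t \<in> {x..y}. \<not> (p has_real_derivative dp t) (at t)}"
      using that by (auto simp: has_real_derivative_iff_has_vector_derivative intro: has_vector_derivative_of_real)
  qed
  have pc: "continuous_on A (\<lambda>x. of_real (p x) :: complex)" "continuous_on A (\<lambda>x. of_real (1 / p x) :: complex)" for A
    using p_pos by (auto intro!: continuous_intros p_continuous simp: less_imp_neq[symmetric])
  have "primitive_on UNIV (\<lambda>x. of_real (p' x)) (\<lambda>x. of_real (p x))"
    by (rule primitive_onI_deriv) (use der fin' pc ai[OF m B] in auto)
  moreover have "primitive_on UNIV (\<lambda>x. of_real (- p' x / (p x)\<^sup>2)) (\<lambda>x. of_real (1 / p x))"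
  proof (rule primitive_onI_deriv[OF fin' pc(2)])
    fix t assume "(p has_real_derivative dp t) (at t)"
    from der[OF this] show "((\<lambda>x. 1 / p x) has_real_derivative - p' t / (p t)\<^sup>2) (at t)"
      using p_pos[of t] by (auto intro!: derivative_eq_intros simp: power2_eq_square)
  next
    have pm: "p \<in> borel_measurable borel" by (intro borel_measurable_continuous_onI p_continuous)
    show "(\<lambda>x. of_real (- p' x / (p x)\<^sup>2) :: complex) absolutely_integrable_on {x..y}" for x y
    proof (rule ai)
      show "(\<lambda>x. - p' x / (p x)\<^sup>2) \<in> borel_measurable borel" using m pm by measurable
      show "\<bar>- p' x / (p x)\<^sup>2\<bar> \<le> B / p\<^sub>0\<^sup>2" for x
        using B[of x] p_ge[of x] p0_pos by (simp add: abs_divide) (intro frac_le power_mono, auto)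
    qed
  qed
  ultimately show ?thesis using m B by blast
qed

text \<open>The operator \<open>H0\<close> is defined through arbitrarily selected weak derivatives. The product rule
shows that \<open>p u'\<close> does have a weak derivative, so that the selection is meaningful, and identifies it.\<close>

lemma W22_representative:
  assumes "u \<in> W22 UNIV"
  shows "\<exists>U W. (AE x in lebesgue. u x = U x) \<and> U \<in> L2 UNIV \<and> H0 p q u \<in> L2 UNIV \<and> solves 0 UNIV (H0 p q u) U W"
proof -
  have U[simp]: "UNIV \<in> sets lebesgue" by simp
  obtain v w where uL: "u \<in> L2 UNIV" and vL: "v \<in> L2 UNIV" and wL: "w \<in> L2 UNIV"
    and uv: "has_weak_deriv UNIV u v" and vw: "has_weak_deriv UNIV v w"
    using assms unfolding W22_def by blast
  obtain U where prU: "primitive_on UNIV v U" and uU: "AE x in lebesgue. u x = U x"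
    using has_weak_deriv_imp_primitive[OF uv] by blast
  obtain V where prV: "primitive_on UNIV w V" and vV: "AE x in lebesgue. v x = V x"
    using has_weak_deriv_imp_primitive[OF vw] by blast
  obtain p' B where p': "p' \<in> borel_measurable borel" "\<And>x. \<bar>p' x\<bar> \<le> B"
    and pr: "primitive_on UNIV (\<lambda>x. of_real (p' x)) (\<lambda>x. of_real (p x))"
    using bounded_derivatives_p_inverse_p by blast
  obtain P where P: "\<And>x. p x \<le> P" using p_bounded by blast
  define W where "W x = of_real (p x) * V x" for x
  define d where "d x = of_real (p' x) * V x + of_real (p x) * w x" for x
  have prW: "primitive_on UNIV d W"
    unfolding d_def W_def by (rule primitive_on_prod[OF is_interval_univ pr prV])
  have UL: "U \<in> L2 UNIV"
    by (rule L2_cong_AE(1)[OF U uL]) (unfold lebesgue_on_UNIV_eq, rule uU)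
  have VL: "V \<in> L2 UNIV"
    by (rule L2_cong_AE(1)[OF U vL]) (unfold lebesgue_on_UNIV_eq, rule vV)
  have pm: "p \<in> borel_measurable borel" by (intro borel_measurable_continuous_onI p_continuous)
  have pP: "\<bar>p x\<bar> \<le> P" for x using P[of x] p_pos[of x] by simp
  have dL: "d \<in> L2 UNIV" unfolding d_def
    by (intro L2_add(1) bounded_complex_of_real_L2[OF p' VL] bounded_complex_of_real_L2[OF pm pP wL])
  have "AE x in lebesgue. weak_deriv UNIV u x = v x"
    using weak_deriv_AE_eq[OF open_UNIV uv] unfolding lebesgue_on_UNIV_eq .
  with vV have "AE x in lebesgue. of_real (p x) * weak_deriv UNIV u x = W x"
    by eventually_elim (simp add: W_def)
  then have "AE x in lebesgue_on UNIV. W x = of_real (p x) * weak_deriv UNIV u x"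
    unfolding lebesgue_on_UNIV_eq by eventually_elim simp
  from has_weak_deriv_cong_AE[OF this _ U primitive_imp_has_weak_deriv[OF prW U], of d]
  have wdd: "has_weak_deriv UNIV (\<lambda>x. of_real (p x) * weak_deriv UNIV u x) d" by simp
  have "AE x in lebesgue. weak_deriv UNIV (\<lambda>x. of_real (p x) * weak_deriv UNIV u x) x = d x"
    using weak_deriv_AE_eq[OF open_UNIV wdd] unfolding lebesgue_on_UNIV_eq .
  with uU have H: "AE x in lebesgue. of_real (q x) * U x - d x = H0 p q u x"
    by eventually_elim (simp add: H0_def)
  have qd: "(\<lambda>x. of_real (q x) * U x - d x) \<in> L2 UNIV"
    by (intro L2_diff(1) dL bounded_complex_of_real_L2[OF q_measurable q_le_bound UL])
  have HL: "H0 p q u \<in> L2 UNIV"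
    by (rule L2_cong_AE(1)[OF U qd]) (unfold lebesgue_on_UNIV_eq, rule H)
  have "AE x in lebesgue. v x = W x / of_real (p x)"
    using vV by eventually_elim (use p_pos in \<open>simp add: W_def less_imp_neq[symmetric]\<close>)
  then have "primitive_on UNIV (\<lambda>x. W x / of_real (p x)) U" by (rule primitive_on_cong_AE[OF prU])
  moreover have "AE x in lebesgue. d x = (of_real (q x) - 0) * U x - H0 p q u x"
    using H by eventually_elim (simp add: algebra_simps)
  then have "primitive_on UNIV (\<lambda>x. (of_real (q x) - 0) * U x - H0 p q u x) W" by (rule primitive_on_cong_AE[OF prW])
  ultimately have "solves 0 UNIV (H0 p q u) U W" by (simp add: solves_def)
  then show ?thesis using uU UL HL by blast
qed

text \<open>Gronwall's inequality from \<open>s\<close> to the end of the perturbed interval bounds \<open>U\<close> and \<open>W\<close>, hence \<open>u\<close> and \<open>u'\<close>; the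
system itself expresses \<open>u''\<close> through \<open>U\<close>, \<open>W\<close> and \<open>g\<close>. The constant depends on \<open>z\<close> only through the
bound \<open>\<kappa>\<close> for \<open>growth z\<close>.\<close>

lemma local_W22_estimate:
  assumes ab: "a < b" and s: "s \<le> a"
  shows "\<exists>c\<ge>0. \<forall>z g U W u. growth z \<le> \<kappa> \<longrightarrow> solves z UNIV g U W \<longrightarrow> g \<in> L2 UNIV \<longrightarrow> (AE x in lebesgue. u x = U x) \<longrightarrow>
     zero_outside {a<..<b} u \<in> W22 {a<..<b} \<and>
     W22_norm {a<..<b} (zero_outside {a<..<b} u) \<le> c * (norm (U s) + norm (W s) + L2_norm {s..b} g)"
proof -
  let ?S = "{a<..<b}"
  have S: "?S \<in> sets lebesgue" by simp
  obtain p' B where p': "p' \<in> borel_measurable borel" "\<And>x. \<bar>p' x\<bar> \<le> B"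
    and pr: "primitive_on UNIV (\<lambda>x. of_real (- p' x / (p x)\<^sup>2)) (\<lambda>x. of_real (1 / p x))"
    using bounded_derivatives_p_inverse_p by blast
  have B0: "0 \<le> B" using p'(2)[of 0] by simp
  define k where "k = \<bar>\<kappa>\<bar>"
  \<comment> \<open>The factor in Gronwall's inequality, and the sum of the bounds for \<open>U\<close>, \<open>V1\<close> and \<open>V2\<close> below.\<close>
  define e where "e = (1 + sqrt (b - s)) * exp (k * (b - s))"
  define c where "c = sqrt (b - a) * e * (1 + k + (k * k + B / p\<^sub>0\<^sup>2)) + k"
  have k0: "0 \<le> k" by (simp add: k_def)
  have e0: "0 \<le> e" using s ab by (simp add: e_def)
  show ?thesis
  proof (intro exI[of _ c] conjI allI impI)
    show "0 \<le> c" using k0 e0 B0 ab by (simp add: c_def)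
    fix z g U W u assume gz: "growth z \<le> \<kappa>" and sol: "solves z UNIV g U W" and g: "g \<in> L2 UNIV" and uU: "AE x in lebesgue. u x = U x"
    have gk: "growth z \<le> k" using gz by (simp add: k_def)
    define G where "G = norm (U s) + norm (W s) + L2_norm {s..b} g"
    have G0: "0 \<le> G" by (simp add: G_def L2_norm_nonneg)
    have gI: "g \<in> L2 {s..b}" by (rule L2_subset[OF g]) auto
    have gS: "g \<in> L2 ?S" by (rule L2_subset[OF g]) auto
    have gS_le: "L2_norm ?S g \<le> G"
    proof -
      have "L2_norm ?S g \<le> L2_norm {s..b} g" by (rule L2_subset(2)[OF gI _ S]) (use s in auto)
      then show ?thesis using norm_ge_zero[of "U s"] norm_ge_zero[of "W s"] unfolding G_def by linarith
    qed
    have bound: "norm (U x) + norm (W x) \<le> e * G" if x: "x \<in> {a<..<b}" for x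
    proof -
      have x': "x \<in> {s..b}" using x s by auto
      have "norm (U x) + norm (W x) \<le> (norm (U s) + norm (W s) + integral {s..b} (\<lambda>t. norm (g t))) * exp (growth z * (x - s))"
        by (rule solves_bound[OF solves_subset[OF sol subset_UNIV] x'])
      also have "\<dots> \<le> (norm (U s) + norm (W s) + sqrt (b - s) * L2_norm {s..b} g) * exp (k * (b - s))"
      proof (rule mult_mono)
        show "norm (U s) + norm (W s) + integral {s..b} (\<lambda>t. norm (g t)) \<le> norm (U s) + norm (W s) + sqrt (b - s) * L2_norm {s..b} g"
          using L2_Icc_integral_le(2)[OF gI] s ab by simp
        show "exp (growth z * (x - s)) \<le> exp (k * (b - s))"
          using gk k0 x' by (simp add: mult_mono)
      qed (use s ab L2_norm_nonneg in auto)
      also have "\<dots> \<le> ((1 + sqrt (b - s)) * G) * exp (k * (b - s))"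
      proof (rule mult_right_mono)
        have "0 \<le> sqrt (b - s) * (norm (U s) + norm (W s))" using s ab by simp
        then show "norm (U s) + norm (W s) + sqrt (b - s) * L2_norm {s..b} g \<le> (1 + sqrt (b - s)) * G"
          using L2_norm_nonneg[of "{s..b}" g] by (simp add: G_def algebra_simps)
      qed simp
      finally show ?thesis by (simp add: e_def mult_ac)
    qed
    have UW: "norm (U x) \<le> e * G" "norm (W x) \<le> e * G" if "x \<in> {a<..<b}" for x
      using bound[OF that] norm_ge_zero[of "U x"] norm_ge_zero[of "W x"] by linarith+
    have eG: "0 \<le> e * G" using e0 G0 by simp
    have cU: "continuous_on UNIV U" and cW: "continuous_on UNIV W" by (rule solves_UNIV_continuous[OF sol])+
    \<comment> \<open>\<open>V1\<close> and \<open>V2\<close> represent \<open>u'\<close> and \<open>u''\<close>, and \<open>r\<close> is the part of \<open>u''\<close> without \<open>g\<close>.\<close>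
    define V1 where "V1 x = W x / of_real (p x)" for x
    define r where "r x = ((of_real (q x) - z) * U x) * of_real (1 / p x) + W x * of_real (- p' x / (p x)\<^sup>2)" for x
    define V2 where "V2 x = r x - of_real (1 / p x) * g x" for x
    have prU: "primitive_on UNIV V1 U" using sol unfolding solves_def V1_def[abs_def] by blast
    have prV1: "primitive_on UNIV V2 V1"
    proof -
      have "primitive_on UNIV (\<lambda>x. ((of_real (q x) - z) * U x - g x) * of_real (1 / p x) + W x * of_real (- p' x / (p x)\<^sup>2)) (\<lambda>x. W x * of_real (1 / p x))"
        using sol unfolding solves_def by (intro primitive_on_prod[OF is_interval_univ] pr) blast
      moreover have "(\<lambda>x. ((of_real (q x) - z) * U x - g x) * of_real (1 / p x) + W x * of_real (- p' x / (p x)\<^sup>2)) = V2"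
        by (simp add: V2_def r_def fun_eq_iff algebra_simps)
      moreover have "(\<lambda>x. W x * of_real (1 / p x)) = V1" by (simp add: V1_def fun_eq_iff)
      ultimately show ?thesis by simp
    qed
    have cV1: "continuous_on UNIV V1" by (rule primitive_on_continuous[OF prV1])
    have pm: "p \<in> borel_measurable borel" by (intro borel_measurable_continuous_onI p_continuous)
    have toS: "f \<in> borel_measurable borel \<Longrightarrow> f \<in> borel_measurable (lebesgue_on ?S)" for f :: "real \<Rightarrow> complex"
      by (intro measurable_restrict_space1 measurable_completion) simp
    have mc: "(\<lambda>x. of_real (f x) :: complex) \<in> borel_measurable borel" if "f \<in> borel_measurable borel" for f
      by (rule measurable_compose[OF that]) (intro borel_measurable_continuous_onI continuous_intros)
    have mr: "r \<in> borel_measurable borel"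
    proof -
      have [measurable]: "(\<lambda>x. of_real (q x) :: complex) \<in> borel_measurable borel" by (rule mc[OF q_measurable])
      have [measurable]: "(\<lambda>x. of_real (1 / p x) :: complex) \<in> borel_measurable borel"
        by (rule mc) (use pm in measurable)
      have [measurable]: "(\<lambda>x. of_real (- p' x / (p x)\<^sup>2) :: complex) \<in> borel_measurable borel"
        by (rule mc) (use pm p'(1) in measurable)
      have [measurable]: "U \<in> borel_measurable borel" "W \<in> borel_measurable borel"
        using cU cW by (auto intro: borel_measurable_continuous_onI)
      show ?thesis unfolding r_def by measurable
    qed
    have nV1: "norm (V1 x) \<le> k * (e * G)" if "x \<in> {a<..<b}" for x
    proof -
      have "norm (V1 x) \<le> growth z * norm (W x)" unfolding V1_def by (rule norm_div_p_le)
      also have "\<dots> \<le> k * (e * G)" using UW(2)[OF that] gk k0 by (intro mult_mono) auto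
      finally show ?thesis .
    qed
    have nr: "norm (r x) \<le> (k * k + B / p\<^sub>0\<^sup>2) * (e * G)" if x: "x \<in> {a<..<b}" for x
    proof -
      have "norm (((of_real (q x) - z) * U x) * of_real (1 / p x)) \<le> growth z * norm ((of_real (q x) - z) * U x)"
        using norm_div_p_le[of "(of_real (q x) - z) * U x" x z] by simp
      also have "\<dots> \<le> k * (k * (e * G))"
      proof (rule mult_mono)
        have "norm ((of_real (q x) - z) * U x) \<le> growth z * norm (U x)" by (rule norm_q_mult_le)
        also have "\<dots> \<le> k * (e * G)" using UW(1)[OF x] gk k0 by (intro mult_mono) auto
        finally show "norm ((of_real (q x) - z) * U x) \<le> k * (e * G)" .
      qed (use gk k0 in auto)
      finally have 1: "norm (((of_real (q x) - z) * U x) * of_real (1 / p x)) \<le> k * (k * (e * G))" .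
      have "\<bar>- p' x / (p x)\<^sup>2\<bar> \<le> B / p\<^sub>0\<^sup>2"
        using p'(2)[of x] p_ge[of x] p0_pos by (simp add: abs_divide) (intro frac_le power_mono, auto)
      then have 2: "norm (W x * of_real (- p' x / (p x)\<^sup>2)) \<le> (e * G) * (B / p\<^sub>0\<^sup>2)"
        unfolding norm_mult norm_of_real using UW(2)[OF x] eG by (intro mult_mono) auto
      have "norm (r x) \<le> k * (k * (e * G)) + (e * G) * (B / p\<^sub>0\<^sup>2)"
        unfolding r_def using norm_triangle_le[OF add_mono[OF 1 2]] .
      then show ?thesis by (simp add: algebra_simps)
    qed
    have LU: "U \<in> L2 ?S" "L2_norm ?S U \<le> sqrt (b - a) * (e * G)"
      using L2_norm_le_sup[OF toS[OF borel_measurable_continuous_onI[OF cU]] UW(1) ab eG] by auto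
    have LV1: "V1 \<in> L2 ?S" "L2_norm ?S V1 \<le> sqrt (b - a) * (k * (e * G))"
      using L2_norm_le_sup[OF toS[OF borel_measurable_continuous_onI[OF cV1]] nV1 ab] k0 eG by auto
    have Lr: "r \<in> L2 ?S" "L2_norm ?S r \<le> sqrt (b - a) * ((k * k + B / p\<^sub>0\<^sup>2) * (e * G))"
      using L2_norm_le_sup[OF toS[OF mr] nr ab] k0 eG B0 by auto
    have Lg: "(\<lambda>x. of_real (1 / p x) * g x) \<in> L2 ?S" "L2_norm ?S (\<lambda>x. of_real (1 / p x) * g x) \<le> k * G"
    proof -
      have np: "norm (of_real (1 / p x) * y) \<le> k * norm y" for x and y :: complex
      proof -
        have "norm (of_real (1 / p x) * y) \<le> growth z * norm y" using norm_div_p_le[of y x z] by simp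
        also have "\<dots> \<le> k * norm y" using gk by (intro mult_right_mono) auto
        finally show ?thesis .
      qed
      have "norm (of_real (1 / p x) :: complex) \<le> k" for x using np[of x 1] by simp
      then show L: "(\<lambda>x. of_real (1 / p x) * g x) \<in> L2 ?S"
        by (intro L2_bounded_measurable_mult[OF gS] toS mc) (use pm in measurable)
      have "(L2_norm ?S (\<lambda>x. of_real (1 / p x) * g x))\<^sup>2 \<le> (L2_norm ?S (\<lambda>x. of_real k * g x))\<^sup>2"
        unfolding L2_facts(5)[OF L S] L2_facts(5)[OF L2_mult[OF gS] S]
      proof (intro integral_le L2_facts(4)[OF L S] L2_facts(4)[OF L2_mult[OF gS] S] power_mono)
        show "cmod (of_real (1 / p x) * g x) \<le> cmod (of_real k * g x)" for x
          using np[of x "g x"] k0 by (simp add: norm_mult)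
      qed simp
      then have "L2_norm ?S (\<lambda>x. of_real (1 / p x) * g x) \<le> L2_norm ?S (\<lambda>x. of_real k * g x)"
        using L2_norm_nonneg by (rule power2_le_imp_le)
      also have "\<dots> = k * L2_norm ?S g" unfolding L2_norm_mult using k0 by simp
      also have "\<dots> \<le> k * G" by (intro mult_left_mono gS_le k0)
      finally show "L2_norm ?S (\<lambda>x. of_real (1 / p x) * g x) \<le> k * G" .
    qed
    have LV2: "V2 \<in> L2 ?S" "L2_norm ?S V2 \<le> sqrt (b - a) * ((k * k + B / p\<^sub>0\<^sup>2) * (e * G)) + k * G"
      using L2_diff[OF Lr(1) Lg(1)] Lr(2) Lg(2) unfolding V2_def by auto
    let ?u = "zero_outside ?S u"
    have uU': "AE x in lebesgue_on ?S. U x = ?u x"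
    proof -
      have "AE x in lebesgue_on ?S. u x = U x" by (rule AE_lebesgue_imp_AE_on[OF uU S])
      moreover have "AE x in lebesgue_on ?S. x \<in> ?S" by (rule AE_I2) (simp add: space_restrict_space)
      ultimately show ?thesis by eventually_elim (simp add: zero_outside_def)
    qed
    have wd1: "has_weak_deriv ?S ?u V1"
      by (rule has_weak_deriv_cong_AE[OF uU' _ S primitive_imp_has_weak_deriv[OF prU S]]) simp
    have wd2: "has_weak_deriv ?S V1 V2" by (rule primitive_imp_has_weak_deriv[OF prV1 S])
    have oS: "open ?S" by simp
    have d1: "AE x in lebesgue_on ?S. weak_deriv ?S ?u x = V1 x" by (rule weak_deriv_AE_eq[OF oS wd1])
    then have d1': "AE x in lebesgue_on ?S. V1 x = weak_deriv ?S ?u x" by eventually_elim simp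
    have "has_weak_deriv ?S (weak_deriv ?S ?u) V2" by (rule has_weak_deriv_cong_AE[OF d1' _ S wd2]) simp
    then have d2: "AE x in lebesgue_on ?S. weak_deriv ?S (weak_deriv ?S ?u) x = V2 x" by (rule weak_deriv_AE_eq[OF oS])
    then have d2': "AE x in lebesgue_on ?S. V2 x = weak_deriv ?S (weak_deriv ?S ?u) x" by eventually_elim simp
    have uL: "?u \<in> L2 ?S" by (rule L2_cong_AE(1)[OF S LU(1) uU'])
    show "?u \<in> W22 ?S" unfolding W22_def using uL LV1(1) LV2(1) wd1 wd2 by blast
    have "W22_norm ?S ?u = sqrt ((L2_norm ?S U)\<^sup>2 + (L2_norm ?S V1)\<^sup>2 + (L2_norm ?S V2)\<^sup>2)"
      unfolding W22_norm_def L2_cong_AE(2)[OF S LU(1) uU'] L2_cong_AE(2)[OF S LV1(1) d1'] L2_cong_AE(2)[OF S LV2(1) d2'] ..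
    also have "\<dots> \<le> L2_norm ?S U + L2_norm ?S V1 + L2_norm ?S V2"
      by (rule sqrt_sum_squares3_le) (rule L2_norm_nonneg)+
    also have "\<dots> \<le> sqrt (b - a) * (e * G) + sqrt (b - a) * (k * (e * G)) + (sqrt (b - a) * ((k * k + B / p\<^sub>0\<^sup>2) * (e * G)) + k * G)"
      by (intro add_mono LU LV1 LV2)
    also have "\<dots> = c * G" by (simp add: c_def algebra_simps)
    finally show "W22_norm ?S ?u \<le> c * (norm (U s) + norm (W s) + L2_norm {s..b} g)" by (simp add: G_def)
  qed
qed

end

section \<open>The perturbed operator\<close>

lemma zero_outside_L2:
  assumes S: "S \<in> sets lebesgue" and v: "v \<in> L2 S"
  shows "zero_outside S v \<in> L2 UNIV" "L2_norm UNIV (zero_outside S v) = L2_norm S v"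
proof -
  have "zero_outside S v \<in> borel_measurable lebesgue"
    using L2_facts(1)[OF v S] S by (simp add: zero_outside_def borel_measurable_if)
  moreover have "(\<lambda>x. if x \<in> S then (cmod (v x))\<^sup>2 else 0) absolutely_integrable_on UNIV"
    using L2_facts(3)[OF v S] by (simp only: absolutely_integrable_restrict_UNIV)
  moreover have eq: "(\<lambda>x. (cmod (zero_outside S v x))\<^sup>2) = (\<lambda>x. if x \<in> S then (cmod (v x))\<^sup>2 else 0)"
    by (auto simp: zero_outside_def)
  ultimately show z: "zero_outside S v \<in> L2 UNIV"
    unfolding L2_def using integrable_lebesgue_on_iff[of UNIV "\<lambda>x. (cmod (zero_outside S v x))\<^sup>2"]
    by (simp add: lebesgue_on_UNIV_eq)
  have "(L2_norm UNIV (zero_outside S v))\<^sup>2 = integral UNIV (\<lambda>x. if x \<in> S then (cmod (v x))\<^sup>2 else 0)"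
    using L2_facts(5)[OF z] unfolding eq by simp
  also have "\<dots> = (L2_norm S v)\<^sup>2" unfolding integral_restrict_UNIV L2_facts(5)[OF v S] ..
  finally show "L2_norm UNIV (zero_outside S v) = L2_norm S v"
    using L2_norm_nonneg by (simp add: power2_eq_iff_nonneg)
qed

lemma perturbation_norm_le:
  assumes L: "bounded_operator_W22_L2 S C L" and S: "S \<in> sets lebesgue" and Z: "zero_outside S u \<in> W22 S"
    and W: "W22_norm S (zero_outside S u) \<le> B"
  shows "L2_norm UNIV (zero_outside S (L (zero_outside S u))) \<le> \<bar>C\<bar> * B"
proof -
  have LL: "L (zero_outside S u) \<in> L2 S" and le: "L2_norm S (L (zero_outside S u)) \<le> C * W22_norm S (zero_outside S u)"
    using L Z unfolding bounded_operator_W22_L2_def by blast+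
  have W0: "0 \<le> W22_norm S (zero_outside S u)" by (simp add: W22_norm_def)
  have "L2_norm UNIV (zero_outside S (L (zero_outside S u))) \<le> C * W22_norm S (zero_outside S u)"
    unfolding zero_outside_L2(2)[OF S LL] by (rule le)
  also have "\<dots> \<le> \<bar>C\<bar> * W22_norm S (zero_outside S u)" using W0 by (intro mult_right_mono) auto
  also have "\<dots> \<le> \<bar>C\<bar> * B" using W by (intro mult_left_mono) auto
  finally show ?thesis .
qed

text \<open>The operator is linear only up to null sets, and \<open>zero_outside\<close> commutes with differences exactly.\<close>

lemma perturbation_diff_AE:
  assumes L: "bounded_operator_W22_L2 S C L" and S: "S \<in> sets lebesgue"
    and Z: "zero_outside S u \<in> W22 S" "zero_outside S v \<in> W22 S"
  shows "AE x in lebesgue. zero_outside S (L (zero_outside S (\<lambda>x. u x - v x))) x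
     = zero_outside S (L (zero_outside S u)) x - zero_outside S (L (zero_outside S v)) x"
proof -
  let ?v = "\<lambda>y. (-1) * zero_outside S v y"
  have e: "zero_outside S (\<lambda>x. u x - v x) = (\<lambda>y. zero_outside S u y + ?v y)"
    by (auto simp: zero_outside_def)
  have vW: "?v \<in> W22 S"
  proof -
    obtain v1 v2 where v12: "zero_outside S v \<in> L2 S" "v1 \<in> L2 S" "v2 \<in> L2 S"
       "has_weak_deriv S (zero_outside S v) v1" "has_weak_deriv S v1 v2"
      using Z(2) unfolding W22_def by blast
    have neg: "has_weak_deriv S (\<lambda>y. (-1) * g y) (\<lambda>y. (-1) * g' y)" if "has_weak_deriv S g g'" for g g'
      using that unfolding has_weak_deriv_def locally_integrable_def by simp
    show ?thesis unfolding W22_def using neg[OF v12(4)] neg[OF v12(5)] L2_mult[of _ S "-1"] v12(1-3) by blast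
  qed
  have "AE x in lebesgue_on S. L (\<lambda>y. zero_outside S u y + ?v y) x = L (zero_outside S u) x + L ?v x"
  proof -
    have "\<forall>u\<in>W22 S. \<forall>v\<in>W22 S. AE x in lebesgue_on S. L (\<lambda>y. u y + v y) x = L u x + L v x"
      using L unfolding bounded_operator_W22_L2_def by (elim conjE)
    from bspec[OF bspec[OF this Z(1)] vW] show ?thesis .
  qed
  moreover have "AE x in lebesgue_on S. L ?v x = (-1) * L (zero_outside S v) x"
  proof -
    have "\<forall>c. \<forall>u\<in>W22 S. AE x in lebesgue_on S. L (\<lambda>y. c * u y) x = c * L u x"
      using L unfolding bounded_operator_W22_L2_def by (elim conjE)
    from bspec[OF spec[OF this] Z(2)] show ?thesis .
  qed
  ultimately have "AE x in lebesgue_on S. L (zero_outside S (\<lambda>x. u x - v x)) x = L (zero_outside S u) x - L (zero_outside S v) x"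
    unfolding e by eventually_elim simp
  then have "AE x in lebesgue. x \<in> S \<longrightarrow> L (zero_outside S (\<lambda>x. u x - v x)) x = L (zero_outside S u) x - L (zero_outside S v) x"
    using S by (subst (asm) AE_restrict_space_iff) auto
  then show ?thesis by eventually_elim (simp add: zero_outside_def)
qed

context periodic_coefficients
begin

lemma restriction_W22:
  assumes ab: "a < b" and "solves z UNIV g U W" "g \<in> L2 UNIV" "AE x in lebesgue. u x = U x"
  shows "zero_outside {a<..<b} u \<in> W22 {a<..<b}"
proof -
  obtain c where "\<And>z' g U W u. growth z' \<le> growth z \<Longrightarrow> solves z' UNIV g U W \<Longrightarrow> g \<in> L2 UNIV \<Longrightarrow> (AE x in lebesgue. u x = U x) \<Longrightarrow>
     zero_outside {a<..<b} u \<in> W22 {a<..<b}"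
    using local_W22_estimate[OF ab order_refl, where \<kappa>="growth z"] by blast
  from this[OF order_refl assms(2-4)] show ?thesis .
qed

text \<open>With the residual \<open>f = H\<^sub>\<epsilon> u - z u\<close> and the perturbation term \<open>\<phi>\<close>, the function \<open>u\<close> solves the
unperturbed system with right-hand side \<open>f + \<epsilon> \<phi>\<close>. Membership of \<open>f\<close> in \<open>L2\<close> gives meaning to
its norm in the definition of the continuous spectrum.\<close>

lemma perturbed_representative:
  fixes z :: complex
  assumes u: "u \<in> W22 UNIV" and L: "bounded_operator_W22_L2 {a<..<b} C (L \<epsilon>)" and ab: "a < b"
  defines "\<phi> \<equiv> zero_outside {a<..<b} (L \<epsilon> (zero_outside {a<..<b} u))"
  defines "f \<equiv> (\<lambda>x. H_perturbed p q {a<..<b} L \<epsilon> u x - z * u x)"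
  shows "\<exists>U W. (AE x in lebesgue. u x = U x) \<and> U \<in> L2 UNIV \<and> \<phi> \<in> L2 UNIV \<and> f \<in> L2 UNIV \<and>
    zero_outside {a<..<b} u \<in> W22 {a<..<b} \<and>
    solves z UNIV (\<lambda>x. f x + of_real \<epsilon> * \<phi> x) U W"
proof -
  let ?S = "{a<..<b}"
  have S: "?S \<in> sets lebesgue" by simp
  obtain U W where uU: "AE x in lebesgue. u x = U x" and UL: "U \<in> L2 UNIV" and HL: "H0 p q u \<in> L2 UNIV"
    and sol: "solves 0 UNIV (H0 p q u) U W" using W22_representative[OF u] by blast
  have Z: "zero_outside ?S u \<in> W22 ?S"
    by (rule restriction_W22[OF ab sol HL uU])
  then have "L \<epsilon> (zero_outside ?S u) \<in> L2 ?S" using L unfolding bounded_operator_W22_L2_def by blast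
  then have lL: "\<phi> \<in> L2 UNIV" unfolding \<phi>_def by (rule zero_outside_L2(1)[OF S])
  have uL: "u \<in> L2 UNIV" using u by (simp add: W22_def)
  have f_eq: "f = (\<lambda>x. (H0 p q u x - of_real \<epsilon> * \<phi> x) - z * u x)"
    by (simp add: f_def \<phi>_def H_perturbed_def)
  have fL: "f \<in> L2 UNIV" unfolding f_eq by (intro L2_diff(1) L2_mult HL lL uL)
  have "primitive_on UNIV (\<lambda>x. (of_real (q x) - z) * U x - (f x + of_real \<epsilon> * \<phi> x)) W"
  proof (rule primitive_on_cong_AE)
    show "primitive_on UNIV (\<lambda>x. (of_real (q x) - 0) * U x - H0 p q u x) W" using sol unfolding solves_def by blast
    show "AE x in lebesgue. (of_real (q x) - 0) * U x - H0 p q u x = (of_real (q x) - z) * U x - (f x + of_real \<epsilon> * \<phi> x)"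
      using uU by eventually_elim (simp add: f_eq algebra_simps)
  qed
  then have "solves z UNIV (\<lambda>x. f x + of_real \<epsilon> * \<phi> x) U W" using sol unfolding solves_def by blast
  then show ?thesis using uU UL lL fL Z by blast
qed

text \<open>Contraposition: for \<open>\<bar>\<rho>\<bar> \<noteq> 1\<close> every bounded sequence with residuals tending to zero has a
convergent subsequence. The a priori estimate on the line has the uncontrolled constant \<open>M\<close>, so the
perturbation is absorbed before that estimate is applied, by means of the local estimate alone.\<close>

lemma continuous_spectrum_imp_unimodular:
  assumes ab: "a < b" and L: "bounded_operator_W22_L2 {a<..<b} C (L \<epsilon>)" and \<epsilon>: "0 < \<epsilon>"
    and s: "s \<le> a" and c0: "0 \<le> c"
    and est: "\<And>g U W u. solves z UNIV g U W \<Longrightarrow> g \<in> L2 UNIV \<Longrightarrow> (AE x in lebesgue. u x = U x) \<Longrightarrow>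
     W22_norm {a<..<b} (zero_outside {a<..<b} u) \<le> c * (norm (U s) + norm (W s) + L2_norm {s..b} g)"
    and small: "\<epsilon> * (\<bar>C\<bar> * c) \<le> 1/2"
    and spec: "z \<in> continuous_spectrum (W22 UNIV) (H_perturbed p q {a<..<b} L \<epsilon>)"
    and \<rho>: "floquet_multiplier z \<rho>"
  shows "cmod \<rho> = 1"
proof (rule ccontr)
  assume "cmod \<rho> \<noteq> 1"
  then obtain M where M: "0 \<le> M" and hyp: "\<And>g U W. solves z UNIV g U W \<Longrightarrow> U \<in> L2 UNIV \<Longrightarrow> g \<in> L2 UNIV \<Longrightarrow>
    L2_norm UNIV U \<le> M * L2_norm UNIV g"
    using non_unimodular_estimate[OF \<rho>] by blast
  let ?S = "{a<..<b}" and ?H = "H_perturbed p q {a<..<b} L \<epsilon>"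
  have S: "?S \<in> sets lebesgue" and UN: "UNIV \<in> sets lebesgue" by simp_all
  obtain u B where uW: "\<And>n. u n \<in> W22 UNIV" and uB: "\<And>n. L2_norm UNIV (u n) \<le> B"
    and nconv: "\<not> has_convergent_subseq u"
    and lim: "(\<lambda>n. L2_norm UNIV (\<lambda>x. ?H (u n) x - z * u n x)) \<longlonglongrightarrow> 0"
    using spec unfolding continuous_spectrum_def by blast
  define f where "f n x = ?H (u n) x - z * u n x" for n x
  define \<phi> where "\<phi> n = zero_outside ?S (L \<epsilon> (zero_outside ?S (u n)))" for n
  define g where "g n x = f n x + of_real \<epsilon> * \<phi> n x" for n x
  have "\<exists>U W. (AE x in lebesgue. u n x = U x) \<and> U \<in> L2 UNIV \<and> \<phi> n \<in> L2 UNIV \<and> f n \<in> L2 UNIV \<and>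
    zero_outside ?S (u n) \<in> W22 ?S \<and> solves z UNIV (g n) U W" for n
    using perturbed_representative[of "u n" a b C L \<epsilon> z, OF uW L ab] unfolding f_def[abs_def] \<phi>_def g_def[abs_def] .
  then obtain U W where uU: "\<And>n. AE x in lebesgue. u n x = U n x" and UL: "\<And>n. U n \<in> L2 UNIV" and lL: "\<And>n. \<phi> n \<in> L2 UNIV"
    and fL: "\<And>n. f n \<in> L2 UNIV" and Z: "\<And>n. zero_outside ?S (u n) \<in> W22 ?S" and sol: "\<And>n. solves z UNIV (g n) (U n) (W n)"
    by metis
  have uL: "u n \<in> L2 UNIV" for n using uW by (simp add: W22_def)
  have gL: "g n \<in> L2 UNIV" for n unfolding g_def by (intro L2_add(1) L2_mult fL lL)
  have flim: "(\<lambda>n. L2_norm UNIV (f n)) \<longlonglongrightarrow> 0" using lim by (simp only: f_def[abs_def])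
  then obtain F where F: "\<And>n. L2_norm UNIV (f n) \<le> F"
    using Bseq_def[of "\<lambda>n. L2_norm UNIV (f n)"] convergent_imp_Bseq[OF convergentI[OF flim]] L2_norm_nonneg
    by (metis abs_of_nonneg real_norm_def)
  have UB: "L2_norm UNIV (U n) \<le> B" for n
  proof -
    have "L2_norm UNIV (U n) = L2_norm UNIV (u n)"
      by (rule L2_cong_AE(2)[OF UN uL]) (unfold lebesgue_on_UNIV_eq, rule uU)
    then show ?thesis using uB by simp
  qed
  \<comment> \<open>To the left of \<open>s\<close> the perturbation vanishes, so that the data at \<open>s\<close> are controlled by the
    residuals.\<close>
  obtain c' where c': "0 \<le> c'" and init: "\<And>g U W. solves z {s - 1..s} g U W \<Longrightarrow> g \<in> L2 {s - 1..s} \<Longrightarrow>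
     norm (U s) + norm (W s) \<le> c' * (L2_norm {s - 1..s} U + L2_norm {s - 1..s} g)"
    using initial_data_bound[where s=s and z=z] by blast
  have I: "{s - 1..s} \<in> sets lebesgue" by simp
  have data: "norm (U n s) + norm (W n s) \<le> c' * (B + F)" for n
  proof -
    have "g n x = f n x" if "x \<in> {s - 1..s}" for x
      using that s by (simp add: g_def \<phi>_def zero_outside_def)
    then have "L2_norm {s - 1..s} (g n) = L2_norm {s - 1..s} (f n)"
      unfolding L2_norm_def by (intro arg_cong[where f=sqrt] Bochner_Integration.integral_cong) (auto simp: space_restrict_space)
    also have "\<dots> \<le> F" using L2_subset(2)[OF fL UN I] F by (meson order_trans subset_UNIV)
    finally have 1: "L2_norm {s - 1..s} (g n) \<le> F" .
    have 2: "L2_norm {s - 1..s} (U n) \<le> B" using L2_subset(2)[OF UL UN I] UB by (meson order_trans subset_UNIV)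
    have "norm (U n s) + norm (W n s) \<le> c' * (L2_norm {s - 1..s} (U n) + L2_norm {s - 1..s} (g n))"
      by (rule init[OF solves_subset[OF sol subset_UNIV] L2_subset(1)[OF gL UN I subset_UNIV]])
    also have "\<dots> \<le> c' * (B + F)" by (intro mult_left_mono add_mono 1 2 c')
    finally show ?thesis .
  qed
  have "bounded (range (\<lambda>n. (U n s, W n s)))"
  proof (rule boundedI)
    fix y assume "y \<in> range (\<lambda>n. (U n s, W n s))"
    then obtain n where "y = (U n s, W n s)" by blast
    then show "norm y \<le> c' * (B + F)" using norm_Pair_le[of "U n s" "W n s"] data[of n] by simp
  qed
  then obtain y r where r: "strict_mono r" and y: "((\<lambda>n. (U n s, W n s)) \<circ> r) \<longlonglongrightarrow> y"
    using bounded_imp_convergent_subsequence by blast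
  have U_conv: "(\<lambda>n. U (r n) s) \<longlonglongrightarrow> fst y" and W_conv: "(\<lambda>n. W (r n) s) \<longlonglongrightarrow> snd y"
    using tendsto_fst[OF y] tendsto_snd[OF y] by (simp_all add: o_def)
  \<comment> \<open>The norm \<open>?G\<close> of the right-hand side occurs on both sides of the estimate and is absorbed.\<close>
  have diff: "L2_norm UNIV (\<lambda>x. u m x - u n x) \<le>
     M * (2 * (L2_norm UNIV (f m) + L2_norm UNIV (f n)) + (norm (U m s - U n s) + norm (W m s - W n s)))" for m n
  proof -
    let ?\<Delta> = "norm (U m s - U n s) + norm (W m s - W n s)"
    let ?g = "\<lambda>x. g m x - g n x"
    let ?G = "L2_norm UNIV ?g"
    have sd: "solves z UNIV ?g (\<lambda>x. U m x - U n x) (\<lambda>x. W m x - W n x)" by (rule solves_diff[OF sol sol])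
    have gd: "?g \<in> L2 UNIV" by (rule L2_diff(1)[OF gL gL])
    have ud: "AE x in lebesgue. u m x - u n x = U m x - U n x" using uU[of m] uU[of n] by eventually_elim simp
    let ?l = "zero_outside ?S (L \<epsilon> (zero_outside ?S (\<lambda>x. u m x - u n x)))"
    have "W22_norm ?S (zero_outside ?S (\<lambda>x. u m x - u n x)) \<le> c * (?\<Delta> + L2_norm {s..b} ?g)"
      by (rule est[OF sd gd ud])
    also have "\<dots> \<le> c * (?\<Delta> + ?G)"
      using L2_subset(2)[OF gd UN, of "{s..b}"] c0 by (intro mult_left_mono add_mono) auto
    finally have W: "W22_norm ?S (zero_outside ?S (\<lambda>x. u m x - u n x)) \<le> c * (?\<Delta> + ?G)" .
    have Zd: "zero_outside ?S (\<lambda>x. u m x - u n x) \<in> W22 ?S"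
      by (rule restriction_W22[OF ab sd gd ud])
    have "L2_norm UNIV (\<lambda>x. \<phi> m x - \<phi> n x) = L2_norm UNIV ?l"
    proof (rule L2_cong_AE(2)[OF UN])
      have "L \<epsilon> (zero_outside ?S (\<lambda>x. u m x - u n x)) \<in> L2 ?S" using L Zd unfolding bounded_operator_W22_L2_def by blast
      then show "?l \<in> L2 UNIV" by (rule zero_outside_L2(1)[OF S])
      show "AE x in lebesgue_on UNIV. ?l x = \<phi> m x - \<phi> n x"
        unfolding lebesgue_on_UNIV_eq \<phi>_def by (rule perturbation_diff_AE[OF L S Z Z])
    qed
    also have "\<dots> \<le> \<bar>C\<bar> * (c * (?\<Delta> + ?G))" by (rule perturbation_norm_le[OF L S Zd W])
    finally have ld: "L2_norm UNIV (\<lambda>x. \<phi> m x - \<phi> n x) \<le> \<bar>C\<bar> * (c * (?\<Delta> + ?G))" .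
    have "?G = L2_norm UNIV (\<lambda>x. (f m x - f n x) + of_real \<epsilon> * (\<phi> m x - \<phi> n x))"
      by (simp add: g_def algebra_simps)
    also have "\<dots> \<le> L2_norm UNIV (\<lambda>x. f m x - f n x) + \<epsilon> * L2_norm UNIV (\<lambda>x. \<phi> m x - \<phi> n x)"
      using L2_add(2)[OF L2_diff(1)[OF fL fL] L2_mult[OF L2_diff(1)[OF lL lL]], of m n "of_real \<epsilon>" m n] \<epsilon>
      unfolding L2_norm_mult by simp
    also have "\<dots> \<le> (L2_norm UNIV (f m) + L2_norm UNIV (f n)) + \<epsilon> * (\<bar>C\<bar> * (c * (?\<Delta> + ?G)))"
      using \<epsilon> by (intro add_mono mult_left_mono ld L2_diff(2) fL) auto
    also have "\<epsilon> * (\<bar>C\<bar> * (c * (?\<Delta> + ?G))) = (\<epsilon> * (\<bar>C\<bar> * c)) * (?\<Delta> + ?G)" by (simp add: mult_ac)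
    also have "\<dots> \<le> 1/2 * (?\<Delta> + ?G)" using L2_norm_nonneg[of UNIV ?g] by (intro mult_right_mono small) auto
    finally have "?G \<le> (L2_norm UNIV (f m) + L2_norm UNIV (f n)) + 1/2 * (?\<Delta> + ?G)" by simp
    then have G: "?G \<le> 2 * (L2_norm UNIV (f m) + L2_norm UNIV (f n)) + ?\<Delta>" by argo
    have "L2_norm UNIV (\<lambda>x. u m x - u n x) = L2_norm UNIV (\<lambda>x. U m x - U n x)"
    proof (rule L2_cong_AE(2)[OF UN L2_diff(1)[OF UL UL]])
      show "AE x in lebesgue_on UNIV. U m x - U n x = u m x - u n x"
        unfolding lebesgue_on_UNIV_eq using ud by eventually_elim simp
    qed
    also have "\<dots> \<le> M * ?G" by (rule hyp[OF sd L2_diff(1)[OF UL UL] gd])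
    also have "\<dots> \<le> M * (2 * (L2_norm UNIV (f m) + L2_norm UNIV (f n)) + ?\<Delta>)" by (intro mult_left_mono G M)
    finally show ?thesis .
  qed
  have "\<exists>h\<in>L2 UNIV. (\<lambda>n. L2_norm UNIV (\<lambda>x. u (r n) x - h x)) \<longlonglongrightarrow> 0"
  proof (rule L2_complete[OF uL])
    fix e :: real assume e: "e > 0"
    define d where "d = e / (6 * (M + 1))"
    have d: "d > 0" using e M by (simp add: d_def)
    have "(\<lambda>n. L2_norm UNIV (f (r n))) \<longlonglongrightarrow> 0" using LIMSEQ_subseq_LIMSEQ[OF flim r] by (simp add: o_def)
    then obtain N1 where N1: "\<And>n. n \<ge> N1 \<Longrightarrow> L2_norm UNIV (f (r n)) < d"
      using LIMSEQ_D[OF _ d] L2_norm_nonneg by (metis abs_of_nonneg diff_zero real_norm_def)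
    obtain N2 where N2: "\<And>m n. m \<ge> N2 \<Longrightarrow> n \<ge> N2 \<Longrightarrow> norm (U (r m) s - U (r n) s) < d"
      using CauchyD[OF LIMSEQ_imp_Cauchy[OF U_conv] d] by blast
    obtain N3 where N3: "\<And>m n. m \<ge> N3 \<Longrightarrow> n \<ge> N3 \<Longrightarrow> norm (W (r m) s - W (r n) s) < d"
      using CauchyD[OF LIMSEQ_imp_Cauchy[OF W_conv] d] by blast
    show "\<exists>N. \<forall>m\<ge>N. \<forall>n\<ge>N. L2_norm UNIV (\<lambda>x. u (r m) x - u (r n) x) < e"
    proof (intro exI[of _ "N1 + N2 + N3"] allI impI)
      fix m n assume mn: "N1 + N2 + N3 \<le> m" "N1 + N2 + N3 \<le> n"
      have "L2_norm UNIV (\<lambda>x. u (r m) x - u (r n) x) \<le> M * (2 * (L2_norm UNIV (f (r m)) + L2_norm UNIV (f (r n)))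
         + (norm (U (r m) s - U (r n) s) + norm (W (r m) s - W (r n) s)))" by (rule diff)
      also have "\<dots> \<le> M * (2 * (d + d) + (d + d))"
        using N1[of m] N1[of n] N2[of m n] N3[of m n] mn M by (intro mult_left_mono add_mono) auto
      also have "\<dots> = M * 6 * d" by simp
      also have "\<dots> < (M + 1) * 6 * d" using d by simp
      also have "\<dots> = e" using M by (simp add: d_def field_simps)
      finally show "L2_norm UNIV (\<lambda>x. u (r m) x - u (r n) x) < e" .
    qed
  qed
  then have "has_convergent_subseq u" unfolding has_convergent_subseq_def using r by blast
  then show False using nconv by blast
qed

text \<open>An eigenfunction has zero initial data at \<open>s\<close>, and the absorption argument makes its right-hand
side vanish; then Gronwall's inequality makes it vanish to the right of \<open>s\<close> as well.\<close>

lemma unimodular_imp_no_eigenvalue: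
  assumes ab: "a < b" and L: "bounded_operator_W22_L2 {a<..<b} C (L \<epsilon>)" and \<epsilon>: "0 < \<epsilon>"
    and m: "of_int m \<le> a" "s < of_int m - 3" and c0: "0 \<le> c"
    and est: "\<And>g U W u. solves z UNIV g U W \<Longrightarrow> g \<in> L2 UNIV \<Longrightarrow> (AE x in lebesgue. u x = U x) \<Longrightarrow>
     W22_norm {a<..<b} (zero_outside {a<..<b} u) \<le> c * (norm (U s) + norm (W s) + L2_norm {s..b} g)"
    and small: "\<epsilon> * (\<bar>C\<bar> * c) \<le> 1/2"
    and \<rho>: "floquet_multiplier z \<rho>" "cmod \<rho> = 1"
  shows "\<not> is_eigenvalue (W22 UNIV) (H_perturbed p q {a<..<b} L \<epsilon>) z"
proof
  let ?S = "{a<..<b}"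
  assume "is_eigenvalue (W22 UNIV) (H_perturbed p q ?S L \<epsilon>) z"
  then obtain u where uW: "u \<in> W22 UNIV" and u0: "\<not> (AE x in lebesgue. u x = 0)"
    and eig: "AE x in lebesgue. H_perturbed p q ?S L \<epsilon> u x = z * u x"
    unfolding is_eigenvalue_def by blast
  have S: "?S \<in> sets lebesgue" and UN: "UNIV \<in> sets lebesgue" by simp_all
  define \<phi> where "\<phi> = zero_outside ?S (L \<epsilon> (zero_outside ?S u))"
  define g where "g x = of_real \<epsilon> * \<phi> x" for x
  obtain U W where uU: "AE x in lebesgue. u x = U x" and UL: "U \<in> L2 UNIV" and lL: "\<phi> \<in> L2 UNIV"
    and Z: "zero_outside ?S u \<in> W22 ?S"
    and sol': "solves z UNIV (\<lambda>x. (H_perturbed p q ?S L \<epsilon> u x - z * u x) + of_real \<epsilon> * \<phi> x) U W"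
    using perturbed_representative[of u a b C L \<epsilon> z, OF uW L ab] unfolding \<phi>_def by blast
  have gL: "g \<in> L2 UNIV" unfolding g_def by (rule L2_mult[OF lL])
  have "primitive_on UNIV (\<lambda>x. (of_real (q x) - z) * U x - g x) W"
  proof (rule primitive_on_cong_AE)
    show "primitive_on UNIV (\<lambda>x. (of_real (q x) - z) * U x - ((H_perturbed p q ?S L \<epsilon> u x - z * u x) + of_real \<epsilon> * \<phi> x)) W"
      using sol' unfolding solves_def by blast
    show "AE x in lebesgue. (of_real (q x) - z) * U x - ((H_perturbed p q ?S L \<epsilon> u x - z * u x) + of_real \<epsilon> * \<phi> x)
       = (of_real (q x) - z) * U x - g x"
      using eig by eventually_elim (simp add: g_def)
  qed
  then have sol: "solves z UNIV g U W" using sol' unfolding solves_def by blast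
  have g0: "g x = 0" if "x \<le> of_int m" for x
    using that m by (simp add: g_def \<phi>_def zero_outside_def)
  have left: "U x = 0" "W x = 0" if "x \<le> s" for x
    using unimodular_vanishing[OF \<rho> sol UL g0, where x=x] that m by auto
  have sa: "s \<le> a" using m by linarith
  have "W22_norm ?S (zero_outside ?S u) \<le> c * (norm (U s) + norm (W s) + L2_norm {s..b} g)"
    by (rule est[OF sol gL uU])
  also have "\<dots> = c * L2_norm {s..b} g" using left by simp
  also have "\<dots> \<le> c * L2_norm UNIV g" using L2_subset(2)[OF gL UN, of "{s..b}"] c0 by (intro mult_left_mono) auto
  finally have "L2_norm UNIV \<phi> \<le> \<bar>C\<bar> * (c * L2_norm UNIV g)"
    unfolding \<phi>_def by (rule perturbation_norm_le[OF L S Z])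
  then have "\<epsilon> * L2_norm UNIV \<phi> \<le> \<epsilon> * (\<bar>C\<bar> * (c * L2_norm UNIV g))" using \<epsilon> by (intro mult_left_mono) auto
  also have "\<dots> = (\<epsilon> * (\<bar>C\<bar> * c)) * L2_norm UNIV g" by (simp add: mult_ac)
  also have "\<dots> \<le> 1/2 * L2_norm UNIV g" by (intro mult_right_mono small L2_norm_nonneg)
  also have "\<epsilon> * L2_norm UNIV \<phi> = L2_norm UNIV g"
    unfolding g_def L2_norm_mult using \<epsilon> by simp
  finally have G: "L2_norm UNIV g = 0" using L2_norm_nonneg[of UNIV g] by simp
  have "U x = 0" for x
  proof (cases "x \<le> s")
    case False
    have gI: "g \<in> L2 {s..x}" "L2_norm {s..x} g \<le> 0" using L2_subset[OF gL UN, of "{s..x}"] G by auto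
    have "integral {s..x} (\<lambda>t. norm (g t)) \<le> sqrt (x - s) * L2_norm {s..x} g"
      using False by (intro L2_Icc_integral_le gI) simp
    also have "\<dots> \<le> 0" using gI(2) False by (simp add: mult_nonneg_nonpos)
    finally have i: "integral {s..x} (\<lambda>t. norm (g t)) \<le> 0" .
    have "norm (U x) + norm (W x) \<le> (norm (U s) + norm (W s) + integral {s..x} (\<lambda>t. norm (g t))) * exp (growth z * (x - s))"
      using False by (intro solves_bound[OF solves_subset[OF sol subset_UNIV]]) auto
    also have "\<dots> \<le> 0" using i left by (simp add: mult_nonpos_nonneg)
    finally show ?thesis using norm_ge_zero[of "U x"] norm_ge_zero[of "W x"] by (metis add_nonneg_eq_0_iff add_nonneg_nonneg norm_eq_zero order_antisym)
  qed (use left in blast)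
  then have "AE x in lebesgue. u x = 0" using uU by simp
  then show False using u0 by blast
qed

end

theorem theorem2p4:
  fixes p q :: "real \<Rightarrow> real" and p\<^sub>0 a b \<epsilon>\<^sub>1 C :: real
    and L :: "real \<Rightarrow> (real \<Rightarrow> complex) \<Rightarrow> real \<Rightarrow> complex"
    and K :: "complex set"
  assumes "one_periodic p" and "one_periodic q"
    and "piecewise_C1 p" and "piecewise_cont q"
    and "p\<^sub>0 > 0" and "\<And>x. p x \<ge> p\<^sub>0" and "p 0 = 1"
    and "a < b"
    and "\<epsilon>\<^sub>1 > 0"
    and "\<And>\<epsilon>. 0 < \<epsilon> \<Longrightarrow> \<epsilon> < \<epsilon>\<^sub>1 \<Longrightarrow> bounded_operator_W22_L2 {a<..<b} C (L \<epsilon>)"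
    and "compact K"
    and "K \<inter> continuous_spectrum (W22 UNIV) (H0 p q) \<noteq> {}"
  shows "\<exists>\<epsilon>\<^sub>0 > 0. \<forall>\<epsilon>. 0 < \<epsilon> \<and> \<epsilon> < \<epsilon>\<^sub>0 \<longrightarrow>
           (\<forall>z \<in> continuous_spectrum (W22 UNIV) (H_perturbed p q {a<..<b} L \<epsilon>) \<inter> K.
              \<not> is_eigenvalue (W22 UNIV) (H_perturbed p q {a<..<b} L \<epsilon>) z)"
proof -
  interpret periodic_coefficients p q p\<^sub>0
    by unfold_locales (use assms(1-6) in auto)
  obtain R where R: "\<And>z. z \<in> K \<Longrightarrow> norm z \<le> R"
    using compact_imp_bounded[OF \<open>compact K\<close>] unfolding bounded_iff by blast
  define \<kappa> where "\<kappa> = 1 / p\<^sub>0 + q_bound + R"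
  have \<kappa>: "growth z \<le> \<kappa>" if "z \<in> K" for z using R[OF that] by (simp add: growth_def \<kappa>_def)
  define m where "m = \<lfloor>a\<rfloor>"
  \<comment> \<open>Far enough to the left of \<open>a\<close> for the recurrence, which needs three periods without
    perturbation.\<close>
  define s :: real where "s = of_int m - 4"
  have m: "of_int m \<le> a" "s < of_int m - 3" "s \<le> a" unfolding m_def s_def by linarith+
  obtain c where c0: "0 \<le> c" and est: "\<And>z g U W u. growth z \<le> \<kappa> \<Longrightarrow> solves z UNIV g U W \<Longrightarrow> g \<in> L2 UNIV \<Longrightarrow> (AE x in lebesgue. u x = U x) \<Longrightarrow>
     W22_norm {a<..<b} (zero_outside {a<..<b} u) \<le> c * (norm (U s) + norm (W s) + L2_norm {s..b} g)"
    using local_W22_estimate[OF \<open>a < b\<close> m(3), of \<kappa>] by blast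
  define \<epsilon>\<^sub>0 where "\<epsilon>\<^sub>0 = min \<epsilon>\<^sub>1 (1 / (2 * (\<bar>C\<bar> * c + 1)))"
  have Cc: "0 \<le> \<bar>C\<bar> * c" using c0 by simp
  show ?thesis
  proof (intro exI[of _ \<epsilon>\<^sub>0] conjI allI impI ballI)
    show "\<epsilon>\<^sub>0 > 0" using \<open>\<epsilon>\<^sub>1 > 0\<close> Cc by (simp add: \<epsilon>\<^sub>0_def)
    fix \<epsilon> z assume \<epsilon>: "0 < \<epsilon> \<and> \<epsilon> < \<epsilon>\<^sub>0"
      and z: "z \<in> continuous_spectrum (W22 UNIV) (H_perturbed p q {a<..<b} L \<epsilon>) \<inter> K"
    have L: "bounded_operator_W22_L2 {a<..<b} C (L \<epsilon>)" using \<epsilon> by (intro assms(10)) (auto simp: \<epsilon>\<^sub>0_def)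
    have small: "\<epsilon> * (\<bar>C\<bar> * c) \<le> 1/2"
    proof -
      have "\<epsilon> * (\<bar>C\<bar> * c) \<le> \<epsilon> * (\<bar>C\<bar> * c + 1)" using \<epsilon> by (intro mult_left_mono) auto
      also have "\<dots> \<le> 1 / (2 * (\<bar>C\<bar> * c + 1)) * (\<bar>C\<bar> * c + 1)"
        using \<epsilon> Cc by (intro mult_right_mono) (auto simp: \<epsilon>\<^sub>0_def)
      also have "\<dots> = 1/2" using Cc by simp
      finally show ?thesis .
    qed
    obtain \<rho> where \<rho>: "floquet_multiplier z \<rho>" using exists_floquet_multiplier by blast
    have gz: "growth z \<le> \<kappa>" using z by (intro \<kappa>) blast
    have est_z: "W22_norm {a<..<b} (zero_outside {a<..<b} u) \<le> c * (norm (U s) + norm (W s) + L2_norm {s..b} g)"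
      if "solves z UNIV g U W" "g \<in> L2 UNIV" "AE x in lebesgue. u x = U x" for g U W u
      by (rule est[OF gz that])
    have "cmod \<rho> = 1"
    proof (rule continuous_spectrum_imp_unimodular[where L=L and \<epsilon>=\<epsilon> and z=z and s=s and c=c, OF \<open>a < b\<close> L _ m(3) c0 _ small _ \<rho>])
      show "0 < \<epsilon>" using \<epsilon> by blast
      show "z \<in> continuous_spectrum (W22 UNIV) (H_perturbed p q {a<..<b} L \<epsilon>)" using z by blast
    qed (rule est_z)
    then show "\<not> is_eigenvalue (W22 UNIV) (H_perturbed p q {a<..<b} L \<epsilon>) z"
      using \<epsilon> by (intro unimodular_imp_no_eigenvalue[where L=L and \<epsilon>=\<epsilon> and z=z and s=s and c=c, OF \<open>a < b\<close> L _ m(1,2) c0 _ small \<rho>] est_z) auto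
  qed
qed

end
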